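(* Suppose that (A1) $(\mathbf y_p^\top A_p\mathbf y_p-\mathrm{tr}(\Sigma_p A_p))/p\to 0$ in probability as $p\to\infty$ for all sequences of real symmetric positive semi-definite $p\times p$ matrices $A_p$ with uniformly bounded spectral norms $\|A_p\|$; and (A2) $\mathrm{tr}(\Sigma_p^2)/p^2\to 0$ in probability as $p\to\infty$. Then for all $z\in\mathbb C^+$, $$p^{-1}\mathrm{tr}\big(n^{-1}\mathbf Y_{pn}\mathbf Y_{pn}^\top-zI_p\big)^{-1}-p^{-1}\mathrm{tr}\big(n^{-1}\mathbf Z_{pn}\mathbf Z_{pn}^\top-zI_p\big)^{-1}\to 0\quad\text{almost surely}$$ as $n\to\infty$, where $p=p(n)$ is such that $p/n\to y$ for some $y>0$.
   Context: For each $p\ge 1$, $\mathbf y_p$ is a random vector in $\mathbb R^p$ and $\Sigma_p$ is a random symmetric positive semi-definite $p\times p$ matrix defined on the same probability space. $\Sigma_p^{1/2}$ is the principal square root of $\Sigma_p$. Let $\mathbf w_p$ be a standard normal vector in $\mathbb R^p$ independent of $\Sigma_p$ and $\mathbf z_p=\Sigma_p^{1/2}\mathbf w_p$. $\mathbf Y_{pn}$ is a $p\times n$ random matrix whose columns are independent copies of $\mathbf y_p$, and $\mathbf Z_{pn}$ is a $p\times n$ random matrix whose columns are independent copies of $\mathbf z_p$ (all matrices, over all $n$, are defined on a common probability space). $I_p$ is the $p\times p$ identity matrix and $\mathbb C^+=\{w\in\mathbb C:\mathrm{Im}(w)>0\}$. $\mathrm{tr}(M)^{-1}$ denotes the trace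 of the inverse matrix $M^{-1}$. *)

theory Defs
  imports "HOL-Probability.Probability" "Jordan_Normal_Form.Gauss_Jordan_Elimination"
begin

text \<open>
  The dimension \<open>p\<close> varies, so vectors and matrices are those of \<^theory>\<open>Jordan_Normal_Form.Matrix\<close>,
  whose dimensions are values. The notations of \<open>HOL-Analysis\<close> for vectors and inner products are
  switched off to make room for theirs.
\<close>

unbundle no vec_syntax
no_notation inner (infix \<open>\<bullet>\<close> 70)

definition mat_trace :: "'a :: comm_monoid_add mat \<Rightarrow> 'a" where
  "mat_trace A = (\<Sum>i<dim_row A. A $$ (i, i))"

definition vec_norm2 :: "real vec \<Rightarrow> real" where
  "vec_norm2 v = sqrt (v \<bullet> v)"

definition spectral_norm :: "real mat \<Rightarrow> real" where
  "spectral_norm A =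
     (SUP v \<in> {v \<in> carrier_vec (dim_col A). vec_norm2 v \<le> 1}. vec_norm2 (A *\<^sub>v v))"

definition sym_psd_mat :: "nat \<Rightarrow> real mat \<Rightarrow> bool" where
  "sym_psd_mat p A \<longleftrightarrow>
     A \<in> carrier_mat p p \<and> transpose_mat A = A \<and> (\<forall>v \<in> carrier_vec p. 0 \<le> v \<bullet> (A *\<^sub>v v))"

text \<open>The principal square root: the unique symmetric positive semi-definite \<open>B\<close> with \<open>B B = S\<close>
  (meaningful for symmetric positive semi-definite \<open>S\<close>).\<close>

definition psd_sqrt :: "real mat \<Rightarrow> real mat" where
  "psd_sqrt S = (THE B. sym_psd_mat (dim_row S) B \<and> B * B = S)"

text \<open>The types of vectors and matrices carry no topology; the Borel sigma-algebras of the spaces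
  of fixed dimension are generated by the coordinate maps. In particular, a measurable map into
  \<open>vec_borel p\<close> or \<open>mat_borel r c\<close> takes values of the right dimension on the whole space.\<close>

definition vec_borel :: "nat \<Rightarrow> real vec measure" where
  "vec_borel p = vimage_algebra (carrier_vec p) (\<lambda>v. restrict (\<lambda>i. v $ i) {..<p})
     (PiM {..<p} (\<lambda>_. borel))"

definition mat_borel :: "nat \<Rightarrow> nat \<Rightarrow> real mat measure" where
  "mat_borel r c =
     vimage_algebra (carrier_mat r c) (\<lambda>A. restrict (\<lambda>ij. A $$ ij) ({..<r} \<times> {..<c}))
       (PiM ({..<r} \<times> {..<c}) (\<lambda>_. borel))"

definition std_normal_vec :: "'a measure \<Rightarrow> nat \<Rightarrow> ('a \<Rightarrow> real vec) \<Rightarrow> bool" where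
  "std_normal_vec M p w \<longleftrightarrow>
     w \<in> measurable M (vec_borel p) \<and>
     prob_space.indep_vars M (\<lambda>_. borel) (\<lambda>i \<omega>. w \<omega> $ i) {..<p} \<and>
     (\<forall>i<p. distributed M lborel (\<lambda>\<omega>. w \<omega> $ i) std_normal_density)"

text \<open>Independence of two random variables with values in spaces of different types, which
  \<open>indep_var\<close> does not allow: independence of the sigma-algebras they generate.\<close>

definition indep_rv ::
  "'a measure \<Rightarrow> 'b measure \<Rightarrow> ('a \<Rightarrow> 'b) \<Rightarrow> 'c measure \<Rightarrow> ('a \<Rightarrow> 'c) \<Rightarrow> bool" where
  "indep_rv M S X T W \<longleftrightarrow>
     X \<in> measurable M S \<and> W \<in> measurable M T \<and>
     prob_space.indep_set M
       {X -` A \<inter> space M | A. A \<in> sets S} {W -` B \<inter> space M | B. B \<in> sets T}"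

text \<open>\<open>Y\<close> is a random \<open>p \<times> n\<close> matrix on \<open>N\<close> whose columns are independent copies of the random
  vector \<open>x\<close>, which may live on another probability space \<open>M\<close>.\<close>

definition iid_columns ::
  "'b measure \<Rightarrow> nat \<Rightarrow> nat \<Rightarrow> ('b \<Rightarrow> real mat) \<Rightarrow> 'a measure \<Rightarrow> ('a \<Rightarrow> real vec) \<Rightarrow> bool" where
  "iid_columns N p n Y M x \<longleftrightarrow>
     Y \<in> measurable N (mat_borel p n) \<and>
     prob_space.indep_vars N (\<lambda>_. vec_borel p) (\<lambda>j \<omega>. col (Y \<omega>) j) {..<n} \<and>
     (\<forall>j<n. distr N (vec_borel p) (\<lambda>\<omega>. col (Y \<omega>) j) = distr M (vec_borel p) x)"

text \<open>Convergence to \<open>0\<close> in probability, where the \<open>p\<close>-th variable may live on its own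
  probability space.\<close>

definition tendsto_0_in_prob :: "(nat \<Rightarrow> 'a measure) \<Rightarrow> (nat \<Rightarrow> 'a \<Rightarrow> real) \<Rightarrow> bool" where
  "tendsto_0_in_prob M X \<longleftrightarrow>
     (\<forall>\<epsilon>>0. (\<lambda>p. measure (M p) {\<omega> \<in> space (M p). \<bar>X p \<omega>\<bar> > \<epsilon>}) \<longlonglongrightarrow> 0)"

text \<open>\<open>p\<^sup>-\<^sup>1 tr (n\<^sup>-\<^sup>1 Y Y\<^sup>T - z I\<^sub>p)\<^sup>-\<^sup>1\<close> for a \<open>p \<times> n\<close> matrix \<open>Y\<close>. For \<open>z\<close> off the real axis and \<open>n \<ge> 1\<close> the
  matrix is invertible, so that \<^const>\<open>mat_inverse\<close> does return its inverse.\<close>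

definition stieltjes_trace :: "nat \<Rightarrow> nat \<Rightarrow> real mat \<Rightarrow> complex \<Rightarrow> complex" where
  "stieltjes_trace p n Y z =
     mat_trace (the (mat_inverse
       (map_mat complex_of_real ((1 / real n) \<cdot>\<^sub>m (Y * transpose_mat Y)) - z \<cdot>\<^sub>m 1\<^sub>m p)))
     / of_nat p"

end

theory Submission
  imports Defs "Jordan_Normal_Form.Determinant"
begin

text \<open>
  Exchanging one column of a \<open>p \<times> n\<close> matrix changes the trace of the resolvent by a bounded amount, so
  McDiarmid's inequality and the Borel-Cantelli lemma reduce the claim to expectations. There the columns
  \<open>y\<close> are replaced by \<open>z\<close> one at a time. With \<open>R\<close> the resolvent of the matrix of the other columns, the
  Sherman-Morrison formula gives the contribution \<open>- b / (1 + a)\<close> of a column \<open>x\<close>, where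
  \<open>a = x\<^sup>T R x / n\<close> and \<open>b = x\<^sup>T R\<^sup>2 x / n\<close>. For \<open>x = y\<close> by (A1), and for \<open>x = z\<close> by (A2) and a second
  moment computation, these quadratic forms are close in probability to \<open>tr (\<Sigma> R) / n\<close> and
  \<open>tr (\<Sigma> R\<^sup>2) / n\<close>, uniformly in \<open>R\<close>. Hence each of the \<open>n\<close> replacements changes the expected trace by
  \<open>o(1)\<close>, and the normalised trace changes by \<open>o(n / p) = o(1)\<close> in total.
\<close>

section \<open>Operator bounds\<close>

text \<open>The columns \<open>y\<close> and \<open>z\<close> are not compared with each other but
  with a common value, in which the quadratic forms are replaced by traces against
  \<open>\<Sigma>\<close>. This value stays random through \<open>\<Sigma>\<close>, so no
  deterministic limit has to be identified. The hypotheses provide convergence in probability only,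
  with no moments of \<open>y\<close>; it passes to expectations because \<open>b / (1 + a)\<close>
  is bounded by \<open>1 / Im z\<close> whatever the size of the column, a consequence of positivity
  properties of the resolvent. The resolvent \<open>R\<close> is itself random, but it is built from
  the other columns. By Fubini these can be frozen, and since the concentration is uniform in
  \<open>R\<close>, it holds for each frozen value. Two gaps separate the hypotheses from this use.
  (A1) speaks of real positive semi-definite matrices, whereas \<open>R\<close> is complex
  symmetric, so real and imaginary parts are taken and shifted by a multiple of the identity. And
  \<open>psd_sqrt\<close> is a definite description, so existence, uniqueness and measurability of
  the root have to be established; an explicit iteration gives existence and measurability
  together.\<close>

text \<open>The type is left open so that the same operator bounds serve real matrices and complex
  resolvents; embedding a real vector into the complex ones preserves this norm.\<close>

definition vnorm :: "'a::real_normed_field vec \<Rightarrow> real" where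
  "vnorm v = L2_set (\<lambda>i. norm (v $ i)) {..<dim_vec v}"

lemma vnorm_nonneg [simp]: "0 \<le> vnorm v"
  by (simp add: vnorm_def L2_set_nonneg)

lemma vnorm_square: "v \<in> carrier_vec p \<Longrightarrow> (vnorm v)\<^sup>2 = (\<Sum>i<p. (norm (v $ i))\<^sup>2)"
  by (auto simp: vnorm_def L2_set_def sum_nonneg)

lemma vnorm_square_real: "(v :: real vec) \<in> carrier_vec p \<Longrightarrow> (vnorm v)\<^sup>2 = v \<bullet> v"
  by (subst vnorm_square) (auto simp: scalar_prod_def power2_eq_square atLeast0LessThan)

lemma vec_norm2_eq_vnorm: "vec_norm2 v = vnorm v"
  by (simp add: vec_norm2_def vnorm_square_real[of v "dim_vec v", symmetric])

lemma vnorm_triangle: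
  assumes "v \<in> carrier_vec p" "w \<in> carrier_vec p"
  shows "vnorm (v + w) \<le> vnorm v + vnorm w"
proof -
  have "vnorm (v + w) = L2_set (\<lambda>i. norm (v $ i + w $ i)) {..<p}"
    using assms by (auto simp: vnorm_def intro!: L2_set_cong)
  also have "\<dots> \<le> L2_set (\<lambda>i. norm (v $ i) + norm (w $ i)) {..<p}"
    by (intro L2_set_mono) (auto intro: norm_triangle_ineq)
  also have "\<dots> \<le> vnorm v + vnorm w"
    using assms L2_set_triangle_ineq[of "\<lambda>i. norm (v $ i)" "\<lambda>i. norm (w $ i)" "{..<p}"]
    by (auto simp: vnorm_def)
  finally show ?thesis .
qed

lemma vnorm_smult [simp]: "vnorm (a \<cdot>\<^sub>v v) = norm a * vnorm v"
proof -
  have "vnorm (a \<cdot>\<^sub>v v) = L2_set (\<lambda>i. norm a * norm (v $ i)) {..<dim_vec v}"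
    unfolding vnorm_def by (auto simp: norm_mult intro!: L2_set_cong)
  also have "\<dots> = norm a * vnorm v"
    unfolding vnorm_def by (rule L2_set_right_distrib[symmetric]) simp
  finally show ?thesis .
qed

lemma norm_scalar_prod_le:
  assumes "v \<in> carrier_vec p" "w \<in> carrier_vec p"
  shows "norm (v \<bullet> w) \<le> vnorm v * vnorm w"
proof -
  have "norm (v \<bullet> w) = norm (\<Sum>i<p. v $ i * w $ i)"
    using assms by (auto simp: scalar_prod_def atLeast0LessThan)
  also have "\<dots> \<le> (\<Sum>i<p. norm (v $ i * w $ i))" by (rule norm_sum)
  also have "\<dots> = (\<Sum>i<p. \<bar>norm (v $ i)\<bar> * \<bar>norm (w $ i)\<bar>)" by (simp add: norm_mult)
  also have "\<dots> \<le> vnorm v * vnorm w"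
    using L2_set_mult_ineq[of "\<lambda>i. norm (v $ i)" "\<lambda>i. norm (w $ i)" "{..<p}"] assms
    by (auto simp: vnorm_def)
  finally show ?thesis .
qed

lemma norm_vec_index_le: "i < dim_vec v \<Longrightarrow> norm (v $ i) \<le> vnorm v"
  unfolding vnorm_def by (intro member_le_L2_set) auto

lemma vnorm_unit_vec [simp]: "i < p \<Longrightarrow> vnorm (unit_vec p i) = 1"
proof -
  assume "i < p"
  then have "(vnorm (unit_vec p i :: 'a vec))\<^sup>2 = (\<Sum>j<p. if j = i then 1 else 0)"
    by (subst vnorm_square[of _ p]) (use \<open>i < p\<close> in \<open>auto simp del: sum.delta intro!: sum.cong\<close>)
  also have "\<dots> = 1" using \<open>i < p\<close> by simp
  finally show ?thesis
    using vnorm_nonneg[of "unit_vec p i :: 'a vec"] by (simp add: power2_eq_1_iff)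
qed

text \<open>A bound as a predicate avoids suprema and combines directly under sums and products. The
  condition \<open>0 \<le> K\<close> has content for \<open>p = 0\<close>, where every real
  \<open>K\<close> satisfies the inequality.\<close>

definition op_bounded :: "nat \<Rightarrow> 'a::real_normed_field mat \<Rightarrow> real \<Rightarrow> bool" where
  "op_bounded p A K \<longleftrightarrow> A \<in> carrier_mat p p \<and> 0 \<le> K \<and>
     (\<forall>v\<in>carrier_vec p. vnorm (A *\<^sub>v v) \<le> K * vnorm v)"

lemma op_boundedD:
  assumes "op_bounded p A K"
  shows "A \<in> carrier_mat p p" "0 \<le> K" "v \<in> carrier_vec p \<Longrightarrow> vnorm (A *\<^sub>v v) \<le> K * vnorm v"
  using assms by (auto simp: op_bounded_def)

lemma op_bounded_mono: "op_bounded p A K \<Longrightarrow> K \<le> L \<Longrightarrow> op_bounded p A L"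
  unfolding op_bounded_def by (meson mult_right_mono order_trans vnorm_nonneg)

lemma op_bounded_add:
  assumes "op_bounded p A K" "op_bounded p B L"
  shows "op_bounded p (A + B) (K + L)"
  unfolding op_bounded_def
proof (intro conjI ballI)
  note A = op_boundedD[OF assms(1)] and B = op_boundedD[OF assms(2)]
  show "A + B \<in> carrier_mat p p" "0 \<le> K + L" using A B by auto
  fix v :: "'a vec" assume v: "v \<in> carrier_vec p"
  have "vnorm ((A + B) *\<^sub>v v) = vnorm (A *\<^sub>v v + B *\<^sub>v v)"
    using A(1) B(1) v by (simp add: add_mult_distrib_mat_vec)
  also have "\<dots> \<le> vnorm (A *\<^sub>v v) + vnorm (B *\<^sub>v v)"
    using A(1) B(1) v by (intro vnorm_triangle[of _ p]) auto
  also have "\<dots> \<le> (K + L) * vnorm v"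
    using A(3)[OF v] B(3)[OF v] by (simp add: algebra_simps)
  finally show "vnorm ((A + B) *\<^sub>v v) \<le> (K + L) * vnorm v" .
qed

lemma smult_mat_mult_vec:
  "A \<in> carrier_mat n m \<Longrightarrow> v \<in> carrier_vec m \<Longrightarrow> (a \<cdot>\<^sub>m A) *\<^sub>v v = a \<cdot>\<^sub>v (A *\<^sub>v (v :: 'a::comm_ring_1 vec))"
  by (intro eq_vecI) (auto)

lemma op_bounded_smult:
  assumes "op_bounded p A K"
  shows "op_bounded p (a \<cdot>\<^sub>m A) (norm a * K)"
  using op_boundedD[OF assms]
  by (auto simp: op_bounded_def smult_mat_mult_vec mult.assoc intro!: mult_left_mono)

lemma op_bounded_mult:
  assumes "op_bounded p A K" "op_bounded p B L"
  shows "op_bounded p (A * B) (K * L)"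
  unfolding op_bounded_def
proof (intro conjI ballI)
  note A = op_boundedD[OF assms(1)] and B = op_boundedD[OF assms(2)]
  show "A * B \<in> carrier_mat p p" "0 \<le> K * L" using A B by auto
  fix v :: "'a vec" assume v: "v \<in> carrier_vec p"
  have "vnorm ((A * B) *\<^sub>v v) = vnorm (A *\<^sub>v (B *\<^sub>v v))"
    using A(1) B(1) v by simp
  also have "\<dots> \<le> K * vnorm (B *\<^sub>v v)"
    using A B v by (intro A) auto
  also have "\<dots> \<le> K * (L * vnorm v)"
    using A B v by (intro mult_left_mono) auto
  finally show "vnorm ((A * B) *\<^sub>v v) \<le> K * L * vnorm v" by simp
qed

lemma op_bounded_one: "op_bounded p (1\<^sub>m p) 1"
  by (auto simp: op_bounded_def)

lemma op_bounded_zero: "op_bounded p (0\<^sub>m p p) 0"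
proof -
  have "vnorm (0\<^sub>m p p *\<^sub>v v) \<le> 0" if "v \<in> carrier_vec p" for v :: "'a vec"
  proof -
    have "vnorm (0\<^sub>m p p *\<^sub>v v) = vnorm (0 \<cdot>\<^sub>v (0\<^sub>m p p *\<^sub>v v))"
      using that by (intro arg_cong[of _ _ vnorm] eq_vecI) auto
    then show ?thesis by (simp only: vnorm_smult) simp
  qed
  then show ?thesis by (auto simp: op_bounded_def)
qed

lemma op_bounded_entry:
  assumes "op_bounded p A K" "i < p" "j < p"
  shows "norm (A $$ (i, j)) \<le> K"
proof -
  note A = op_boundedD[OF assms(1)]
  have "A $$ (i, j) = (A *\<^sub>v unit_vec p j) $ i"
    using A assms by auto
  also have "norm \<dots> \<le> vnorm (A *\<^sub>v unit_vec p j)"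
    using A assms by (intro norm_vec_index_le) auto
  also have "\<dots> \<le> K" using A(3)[of "unit_vec p j"] assms by simp
  finally show ?thesis .
qed

text \<open>Cauchy-Schwarz in each row. The bound is an explicit function of the entries, hence
  usable as a measurable scaling factor.\<close>

lemma op_bounded_frobenius:
  assumes A: "A \<in> carrier_mat p p"
  shows "op_bounded p A (sqrt (\<Sum>i<p. \<Sum>j<p. (norm (A $$ (i, j)))\<^sup>2))"
  unfolding op_bounded_def
proof (intro conjI ballI A)
  show "0 \<le> sqrt (\<Sum>i<p. \<Sum>j<p. (norm (A $$ (i, j)))\<^sup>2)" by (simp add: sum_nonneg)
  fix v :: "'a vec" assume v: "v \<in> carrier_vec p"
  have "(vnorm (A *\<^sub>v v))\<^sup>2 = (\<Sum>i<p. (norm (row A i \<bullet> v))\<^sup>2)"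
    using A v by (subst vnorm_square[of _ p]) auto
  also have "\<dots> \<le> (\<Sum>i<p. (vnorm (row A i) * vnorm v)\<^sup>2)"
    using A v by (intro sum_mono power_mono norm_scalar_prod_le[of _ p]) auto
  also have "\<dots> = (\<Sum>i<p. \<Sum>j<p. (norm (A $$ (i, j)))\<^sup>2) * (vnorm v)\<^sup>2"
    unfolding sum_distrib_right power_mult_distrib
    using A by (auto simp: vnorm_square[of "row A _" p] sum_distrib_right intro!: sum.cong)
  finally have "vnorm (A *\<^sub>v v) \<le> sqrt ((\<Sum>i<p. \<Sum>j<p. (norm (A $$ (i, j)))\<^sup>2) * (vnorm v)\<^sup>2)"
    by (simp add: real_le_rsqrt)
  then show "vnorm (A *\<^sub>v v) \<le> sqrt (\<Sum>i<p. \<Sum>j<p. (norm (A $$ (i, j)))\<^sup>2) * vnorm v"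
    by (simp add: real_sqrt_mult)
qed

section \<open>The positive semi-definite square root\<close>

lemma sym_psd_matD:
  assumes "sym_psd_mat p A"
  shows "A \<in> carrier_mat p p" "transpose_mat A = A" "v \<in> carrier_vec p \<Longrightarrow> 0 \<le> v \<bullet> (A *\<^sub>v v)"
  using assms by (auto simp: sym_psd_mat_def)

lemma scalar_prod_sym_mat:
  fixes A :: "'a::comm_ring_1 mat"
  assumes "A \<in> carrier_mat p p" "transpose_mat A = A" "v \<in> carrier_vec p" "w \<in> carrier_vec p"
  shows "v \<bullet> (A *\<^sub>v w) = w \<bullet> (A *\<^sub>v v)"
  using transpose_vec_mult_scalar[OF assms(1,4,3)] assms
  by (simp add: comm_scalar_prod[of _ p])

lemma transpose_smult: "transpose_mat (a \<cdot>\<^sub>m A) = a \<cdot>\<^sub>m transpose_mat A"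
  by (intro eq_matI) auto

lemma transpose_eqI:
  "A \<in> carrier_mat p p \<Longrightarrow> (\<And>i j. i < p \<Longrightarrow> j < p \<Longrightarrow> A $$ (i, j) = A $$ (j, i)) \<Longrightarrow> transpose_mat A = A"
  by (intro eq_matI) auto

lemma transpose_eqD:
  "transpose_mat A = A \<Longrightarrow> A \<in> carrier_mat p p \<Longrightarrow> i < p \<Longrightarrow> j < p \<Longrightarrow> A $$ (i, j) = A $$ (j, i)"
  by (metis carrier_matD index_transpose_mat(1))

text \<open>This is the operator inequality \<open>A * A \<le> K A\<close>, obtained without
  diagonalisation: the form of \<open>A\<close> is evaluated at \<open>v - t A v\<close> and is
  non-negative there.\<close>

lemma psd_vnorm_le:
  assumes A: "sym_psd_mat p A" and K: "op_bounded p A K" "0 < K" and v: "v \<in> carrier_vec p"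
  shows "(vnorm (A *\<^sub>v v))\<^sup>2 \<le> K * (v \<bullet> (A *\<^sub>v v))"
proof -
  note Ac = sym_psd_matD[OF A]
  define u where "u = A *\<^sub>v v"
  have u: "u \<in> carrier_vec p" using Ac v by (auto simp: u_def)
  \<comment> \<open>With \<open>u = A v\<close> the form is at most \<open>v \<bullet> u - 2 t (u
    \<bullet> u) + t * t * K * (u \<bullet> u)\<close>, which is smallest at
    \<open>t = 1 / K\<close>.\<close>
  define t where "t = 1 / K"
  have "0 \<le> (v - t \<cdot>\<^sub>v u) \<bullet> (A *\<^sub>v (v - t \<cdot>\<^sub>v u))"
    using u v by (intro Ac) auto
  also have "A *\<^sub>v (v - t \<cdot>\<^sub>v u) = u - t \<cdot>\<^sub>v (A *\<^sub>v u)"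
    using Ac u v by (simp add: mult_minus_distrib_mat_vec[of _ p p] mult_mat_vec[of _ p p] u_def)
  also have "(v - t \<cdot>\<^sub>v u) \<bullet> (u - t \<cdot>\<^sub>v (A *\<^sub>v u)) =
      v \<bullet> u - t * (v \<bullet> (A *\<^sub>v u)) - t * (u \<bullet> u) + t * t * (u \<bullet> (A *\<^sub>v u))"
    using Ac u v
    by (simp add: minus_scalar_prod_distrib[of _ p] scalar_prod_minus_distrib[of _ p] algebra_simps)
  also have "v \<bullet> (A *\<^sub>v u) = u \<bullet> u"
    using scalar_prod_sym_mat[OF Ac(1,2) v u] by (simp add: u_def)
  also have "u \<bullet> (A *\<^sub>v u) \<le> K * (u \<bullet> u)"
  proof -
    have "u \<bullet> (A *\<^sub>v u) \<le> vnorm u * vnorm (A *\<^sub>v u)"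
      using norm_scalar_prod_le[of u p "A *\<^sub>v u"] u Ac by simp
    also have "\<dots> \<le> vnorm u * (K * vnorm u)"
      using op_boundedD(3)[OF K(1) u] by (intro mult_left_mono) auto
    also have "\<dots> = K * (u \<bullet> u)" using vnorm_square_real[OF u] by (simp add: power2_eq_square)
    finally show ?thesis .
  qed
  finally have "0 \<le> v \<bullet> u - t * (u \<bullet> u) - t * (u \<bullet> u) + t * t * (K * (u \<bullet> u))"
    by (simp add: mult_left_mono)
  then have "0 \<le> v \<bullet> u - (u \<bullet> u) / K" using K by (simp add: t_def field_simps)
  then show ?thesis using K vnorm_square_real[OF u] by (simp add: field_simps u_def)
qed

lemma psd_form_eq_0:
  assumes A: "sym_psd_mat p A" and v: "v \<in> carrier_vec p" and "v \<bullet> (A *\<^sub>v v) = 0"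
  shows "A *\<^sub>v v = 0\<^sub>v p"
proof -
  note Ac = sym_psd_matD[OF A]
  \<comment> \<open>Any operator bound would do; adding 1 makes it strictly positive, also for the
    zero matrix.\<close>
  define K where "K = sqrt (\<Sum>i<p. \<Sum>j<p. (norm (A $$ (i, j)))\<^sup>2) + 1"
  have "op_bounded p A K"
    by (rule op_bounded_mono[OF op_bounded_frobenius[OF Ac(1)]]) (simp add: K_def)
  moreover have "0 < K" by (simp add: K_def sum_nonneg add_nonneg_pos)
  ultimately have "(vnorm (A *\<^sub>v v))\<^sup>2 \<le> 0"
    using psd_vnorm_le[OF A _ _ v] assms(3) by fastforce
  then have "vnorm (A *\<^sub>v v) = 0" by simp
  then have "norm ((A *\<^sub>v v) $ i) \<le> 0" if "i < p" for i
    using norm_vec_index_le[of i "A *\<^sub>v v"] that Ac(1) by auto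
  then show ?thesis using Ac(1) by (intro eq_vecI) auto
qed

section \<open>Traces and uniqueness of the square root\<close>

lemma mat_trace_sum: "A \<in> carrier_mat p p \<Longrightarrow> mat_trace A = (\<Sum>i<p. A $$ (i, i))"
  by (auto simp: mat_trace_def)

lemma mat_trace_mult:
  assumes "A \<in> carrier_mat p q" "B \<in> carrier_mat q p"
  shows "mat_trace (A * B) = (\<Sum>i<p. \<Sum>j<q. A $$ (i, j) * B $$ (j, i))"
  using assms by (auto simp: mat_trace_def scalar_prod_def atLeast0LessThan intro!: sum.cong)

lemma mat_trace_mult_comm:
  fixes A B :: "'a::comm_ring_1 mat"
  assumes "A \<in> carrier_mat p q" "B \<in> carrier_mat q p"
  shows "mat_trace (A * B) = mat_trace (B * A)"
  unfolding mat_trace_mult[OF assms] mat_trace_mult[OF assms(2,1)]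
  by (subst sum.swap) (simp add: mult.commute)

lemma mat_trace_add:
  "A \<in> carrier_mat p p \<Longrightarrow> B \<in> carrier_mat p p \<Longrightarrow> mat_trace (A + B) = mat_trace A + mat_trace B"
  by (auto simp: mat_trace_def sum.distrib)

text \<open>By cyclicity the left side is the trace of \<open>D A D\<close>, whose diagonal entries
  are the forms of \<open>A\<close> at the columns of \<open>D\<close>. So the trace is non-negative
  for positive semi-definite \<open>A\<close>.\<close>

lemma mat_trace_sandwich:
  fixes D A :: "'a::comm_ring_1 mat"
  assumes D: "D \<in> carrier_mat p p" "transpose_mat D = D" and A: "A \<in> carrier_mat p p"
  shows "mat_trace (D * D * A) = (\<Sum>k<p. col D k \<bullet> (A *\<^sub>v col D k))"
proof -
  have "mat_trace (D * D * A) = mat_trace (D * (D * A))" using assms by simp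
  also have "\<dots> = mat_trace ((D * A) * D)"
    using assms by (intro mat_trace_mult_comm[of _ p p]) auto
  also have "\<dots> = mat_trace (D * (A * D))" using assms by simp
  also have "\<dots> = (\<Sum>k<p. row D k \<bullet> col (A * D) k)"
    using assms by (auto simp: mat_trace_def)
  also have "\<dots> = (\<Sum>k<p. col D k \<bullet> (A *\<^sub>v col D k))"
  proof (intro sum.cong refl)
    fix k assume k: "k \<in> {..<p}"
    have "row D k = col D k" using D k by (metis carrier_matD(1) lessThan_iff row_transpose carrier_matD(2))
    moreover have "col (A * D) k = A *\<^sub>v col D k" using assms k by auto
    ultimately show "row D k \<bullet> col (A * D) k = col D k \<bullet> (A *\<^sub>v col D k)" by simp
  qed
  finally show ?thesis .
qed

lemma mult_zero_cols:
  assumes "A \<in> carrier_mat p p" "D \<in> carrier_mat p p" "\<And>k. k < p \<Longrightarrow> A *\<^sub>v col D k = 0\<^sub>v p"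
  shows "A * D = 0\<^sub>m p p"
proof (intro eq_matI)
  fix i j assume ij: "i < dim_row (0\<^sub>m p p)" "j < dim_col (0\<^sub>m p p)"
  have "(A * D) $$ (i, j) = (A *\<^sub>v col D j) $ i" using assms(1,2) ij by auto
  then show "(A * D) $$ (i, j) = 0\<^sub>m p p $$ (i, j)" using assms(3) ij by simp
qed (use assms in auto)

text \<open>With \<open>D = A - B\<close> one has \<open>D A + B D = 0\<close>, so the non-negative traces of \<open>D A D\<close> and
  \<open>D B D\<close> add up to zero.\<close>

lemma psd_square_inj:
  assumes A: "sym_psd_mat p A" and B: "sym_psd_mat p B" and eq: "A * A = B * B"
  shows "A = B"
proof -
  note Ac = sym_psd_matD[OF A] and Bc = sym_psd_matD[OF B]
  define D where "D = A - B"
  have D: "D \<in> carrier_mat p p" "transpose_mat D = D"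
    using Ac Bc by (auto simp: D_def transpose_minus[of _ p p])
  have DA: "D * A = A * A - B * A" using Ac Bc by (simp add: D_def minus_mult_distrib_mat[of _ p p])
  have BD: "B * D = B * A - B * B" using Ac Bc by (simp add: D_def mult_minus_distrib_mat[of _ p p])
  have "D * A + B * D = 0\<^sub>m p p"
    unfolding DA BD eq using Ac(1) Bc(1) by (intro eq_matI) auto
  moreover have "mat_trace (D * (D * A + B * D)) = mat_trace (D * D * A) + mat_trace (D * D * B)"
  proof -
    have "D * (D * A + B * D) = D * (D * A) + D * (B * D)"
      using Ac Bc D by (intro mult_add_distrib_mat) auto
    moreover have "mat_trace (D * (B * D)) = mat_trace ((B * D) * D)"
      using Ac Bc D by (intro mat_trace_mult_comm) auto
    moreover have "mat_trace ((B * D) * D) = mat_trace (D * D * B)"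
      using Ac Bc D mat_trace_mult_comm[of B p p "D * D"] by simp
    ultimately show ?thesis using Ac Bc D by (simp add: mat_trace_add[of _ p])
  qed
  moreover have "mat_trace (D * 0\<^sub>m p p) = 0" using D by (simp add: mat_trace_def)
  ultimately have "(\<Sum>k<p. col D k \<bullet> (A *\<^sub>v col D k)) + (\<Sum>k<p. col D k \<bullet> (B *\<^sub>v col D k)) = 0"
    using mat_trace_sandwich[OF D Ac(1)] mat_trace_sandwich[OF D Bc(1)] by simp
  moreover have "0 \<le> col D k \<bullet> (A *\<^sub>v col D k)" "0 \<le> col D k \<bullet> (B *\<^sub>v col D k)" for k
    using Ac(3)[of "col D k"] Bc(3)[of "col D k"] D by auto
  ultimately have "(\<Sum>k<p. col D k \<bullet> (A *\<^sub>v col D k)) = 0" "(\<Sum>k<p. col D k \<bullet> (B *\<^sub>v col D k)) = 0"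
    by (simp_all add: add_nonneg_eq_0_iff sum_nonneg)
  then have "\<And>k. k < p \<Longrightarrow> col D k \<bullet> (A *\<^sub>v col D k) = 0" "\<And>k. k < p \<Longrightarrow> col D k \<bullet> (B *\<^sub>v col D k) = 0"
    using \<open>\<And>k. 0 \<le> col D k \<bullet> (A *\<^sub>v col D k)\<close> \<open>\<And>k. 0 \<le> col D k \<bullet> (B *\<^sub>v col D k)\<close>
    by (simp_all add: sum_nonneg_eq_0_iff)
  then have "A * D = 0\<^sub>m p p" "B * D = 0\<^sub>m p p"
    using D Ac Bc by (auto intro!: mult_zero_cols psd_form_eq_0[OF A] psd_form_eq_0[OF B])
  then have DD: "D * D = 0\<^sub>m p p"
    using Ac Bc D minus_mult_distrib_mat[of A p p B D p] by (simp add: D_def[symmetric])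
  \<comment> \<open>Since \<open>D\<close> is symmetric, the diagonal entries of
    \<open>D * D\<close> are the squared norms of its columns, and these all vanish.\<close>
  have "D $$ (i, j) = 0" if "i < p" "j < p" for i j
  proof -
    have "(\<Sum>k<p. D $$ (j, k) * D $$ (k, j)) = (D * D) $$ (j, j)"
      using D that by (simp add: scalar_prod_def atLeast0LessThan)
    then have "(\<Sum>k<p. (D $$ (k, j))\<^sup>2) = 0"
      using transpose_eqD[OF D(2,1) \<open>j < p\<close>] that by (simp add: power2_eq_square DD)
    then show ?thesis using that by (simp add: sum_nonneg_eq_0_iff)
  qed
  then show ?thesis using Ac Bc by (intro eq_matI) (auto simp: D_def)
qed

section \<open>Existence of the square root by a convergent iteration\<close>

lemma scalar_prod_mat_sum:
  "A \<in> carrier_mat p p \<Longrightarrow> v \<in> carrier_vec p \<Longrightarrow> w \<in> carrier_vec p \<Longrightarrow>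
    v \<bullet> (A *\<^sub>v w) = (\<Sum>i<p. \<Sum>j<p. v $ i * (A $$ (i, j) * (w :: 'a::comm_ring_1 vec) $ j))"
  by (auto simp: scalar_prod_def atLeast0LessThan sum_distrib_left)

text \<open>If \<open>X = (C + X\<^sup>2) / 2\<close> then \<open>(1 - X)\<^sup>2 = 1 - C\<close>. For \<open>\<parallel>C\<parallel> \<le> 1\<close> the increments of the matrix iteration
  are dominated by those of the scalar iteration, which increases to a limit \<open>\<le> 1\<close>. The explicit
  approximation also shows that the square root depends measurably on the matrix.\<close>

fun sqrt_iter :: "nat \<Rightarrow> real mat \<Rightarrow> nat \<Rightarrow> real mat" where
  "sqrt_iter p C 0 = 0\<^sub>m p p"
| "sqrt_iter p C (Suc k) = (1 / 2) \<cdot>\<^sub>m (C + sqrt_iter p C k * sqrt_iter p C k)"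

fun sqrt_iter_bound :: "nat \<Rightarrow> real" where
  "sqrt_iter_bound 0 = 0"
| "sqrt_iter_bound (Suc k) = (1 + (sqrt_iter_bound k)\<^sup>2) / 2"

lemma sqrt_iter_bound_le: "0 \<le> sqrt_iter_bound k \<and> sqrt_iter_bound k \<le> 1"
proof (induction k)
  case (Suc k)
  then have "(sqrt_iter_bound k)\<^sup>2 \<le> 1" by (simp add: power_le_one)
  then show ?case by simp
qed simp

text \<open>With \<open>r = sqrt_iter_bound k\<close> the increment equals half the square of
  \<open>1 - r\<close>.\<close>

lemma sqrt_iter_bound_mono: "sqrt_iter_bound k \<le> sqrt_iter_bound (Suc k)"
proof -
  have "0 \<le> (1 - sqrt_iter_bound k)\<^sup>2" by simp
  then show ?thesis by (simp add: power2_eq_square algebra_simps)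
qed

text \<open>The limit is taken entry by entry, as matrices carry no topology here.
  \<open>lim\<close> is a total function that preserves measurability, so the definition can be used
  before convergence is known.\<close>

definition sqrt_lim :: "nat \<Rightarrow> real mat \<Rightarrow> real mat" where
  "sqrt_lim p C = mat p p (\<lambda>ij. lim (\<lambda>k. sqrt_iter p C k $$ ij))"

context
  fixes p :: nat and C :: "real mat"
  assumes C: "op_bounded p C 1" and Csym: "transpose_mat C = C"
begin

lemma sqrt_iter_carrier [simp]: "sqrt_iter p C k \<in> carrier_mat p p"
  using C by (induction k) (auto simp: op_bounded_def)

lemma sqrt_iter_sym: "transpose_mat (sqrt_iter p C k) = sqrt_iter p C k"
proof (induction k)
  case (Suc k)
  have "transpose_mat (sqrt_iter p C k * sqrt_iter p C k) = sqrt_iter p C k * sqrt_iter p C k"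
    using Suc by (subst transpose_mult[of _ p p _ p]) auto
  then have "transpose_mat (C + sqrt_iter p C k * sqrt_iter p C k) = C + sqrt_iter p C k * sqrt_iter p C k"
    using op_boundedD(1)[OF C] Csym mult_carrier_mat[OF sqrt_iter_carrier[of k] sqrt_iter_carrier[of k]]
    by (subst transpose_add[of _ p p]) auto
  then show ?case by (simp add: transpose_smult)
qed simp

lemma sqrt_iter_op_bounded: "op_bounded p (sqrt_iter p C k) (sqrt_iter_bound k)"
proof (induction k)
  case (Suc k)
  from op_bounded_smult[OF op_bounded_add[OF C op_bounded_mult[OF Suc Suc]], of "1/2"]
  show ?case by (simp add: power2_eq_square add_divide_distrib)
qed (simp add: op_bounded_zero)

text \<open>For consecutive iterates \<open>X\<close> and \<open>X'\<close> one has
  \<open>X' * X' - X * X = X' * (X' - X) + (X' - X) * X\<close>. The scalar iteration satisfies the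
  same identity, so the norm estimate of the right side is exactly the next scalar
  increment.\<close>

lemma sqrt_iter_diff_op_bounded:
  "op_bounded p (sqrt_iter p C (Suc k) - sqrt_iter p C k) (sqrt_iter_bound (Suc k) - sqrt_iter_bound k)"
proof (induction k)
  case 0
  have "sqrt_iter p C (Suc 0) - sqrt_iter p C 0 = (1/2) \<cdot>\<^sub>m C"
    using op_boundedD(1)[OF C] by (intro eq_matI) auto
  then show ?case using op_bounded_smult[OF C, of "1/2"] by simp
next
  case (Suc k)
  define X where "X = sqrt_iter p C k"
  define X' where "X' = sqrt_iter p C (Suc k)"
  define r where "r = sqrt_iter_bound k"
  define r' where "r' = sqrt_iter_bound (Suc k)"
  have c: "X \<in> carrier_mat p p" "X' \<in> carrier_mat p p" by (simp_all only: X_def X'_def sqrt_iter_carrier)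
  have "X' * (X' - X) = X' * X' - X' * X" "(X' - X) * X = X' * X - X * X"
    using c by (simp_all add: mult_minus_distrib_mat[of _ p p] minus_mult_distrib_mat[of _ p p])
  \<comment> \<open>The intermediate matrix \<open>R\<close> is instantiated with
    \<open>X' * X\<close>; the summand \<open>C\<close> cancels.\<close>
  moreover have diff: "(1/2) \<cdot>\<^sub>m (C + P) - (1/2) \<cdot>\<^sub>m (C + Q) = (1/2) \<cdot>\<^sub>m ((P - R) + (R - Q))"
    if "P \<in> carrier_mat p p" "Q \<in> carrier_mat p p" "R \<in> carrier_mat p p" for P Q R :: "real mat"
    using that op_boundedD(1)[OF C] by (intro eq_matI) (auto simp: field_simps)
  ultimately have "sqrt_iter p C (Suc (Suc k)) - sqrt_iter p C (Suc k) = (1/2) \<cdot>\<^sub>m (X' * (X' - X) + (X' - X) * X)"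
    using diff[OF mult_carrier_mat[OF c(2,2)] mult_carrier_mat[OF c(1,1)] mult_carrier_mat[OF c(2,1)]]
    by (simp only: sqrt_iter.simps(2) X_def X'_def)
  moreover have "op_bounded p ((1/2) \<cdot>\<^sub>m (X' * (X' - X) + (X' - X) * X))
      (norm (1/2::real) * (r' * (r' - r) + (r' - r) * r))"
    unfolding X_def X'_def r_def r'_def
    by (intro op_bounded_smult op_bounded_add op_bounded_mult Suc sqrt_iter_op_bounded)
  moreover have "norm (1/2::real) * (r' * (r' - r) + (r' - r) * r) = sqrt_iter_bound (Suc (Suc k)) - sqrt_iter_bound (Suc k)"
    unfolding sqrt_iter_bound.simps(2)[of "Suc k"] r'_def[symmetric]
    by (simp add: r'_def r_def power2_eq_square field_simps)
  ultimately show ?case by (simp only:)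
qed

text \<open>The increments of an entry are dominated by those of a convergent monotone scalar
  sequence, whose sum telescopes.\<close>

lemma sqrt_iter_convergent:
  assumes "i < p" "j < p"
  shows "convergent (\<lambda>k. sqrt_iter p C k $$ (i, j))"
proof -
  define d where "d k = sqrt_iter_bound (Suc k) - sqrt_iter_bound k" for k
  have "convergent sqrt_iter_bound"
    by (rule Bseq_monoseq_convergent[OF BseqI'[of _ 1]])
       (auto simp: sqrt_iter_bound_le sqrt_iter_bound_mono monoseq_Suc simp del: sqrt_iter_bound.simps)
  then obtain l where "sqrt_iter_bound \<longlonglongrightarrow> l" by (auto simp: convergent_def)
  then have sd: "summable d" unfolding d_def by (rule telescope_summable)
  have "norm (sqrt_iter p C (Suc k) $$ (i, j) - sqrt_iter p C k $$ (i, j)) \<le> d k" for k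
    using op_bounded_entry[OF sqrt_iter_diff_op_bounded assms, of k] assms
      carrier_matD[OF sqrt_iter_carrier[of k]]
    by (auto simp: d_def simp del: sqrt_iter.simps sqrt_iter_bound.simps)
  then have "summable (\<lambda>k. sqrt_iter p C (Suc k) $$ (i, j) - sqrt_iter p C k $$ (i, j))"
    by (intro summable_comparison_test'[OF sd, of 0]) auto
  then have "convergent (\<lambda>n. \<Sum>k<n. sqrt_iter p C (Suc k) $$ (i, j) - sqrt_iter p C k $$ (i, j))"
    by (simp add: summable_iff_convergent)
  then have "convergent (\<lambda>n. sqrt_iter p C n $$ (i, j) - sqrt_iter p C 0 $$ (i, j))"
    unfolding sum_lessThan_telescope[of "\<lambda>k. sqrt_iter p C k $$ (i, j)"] .
  then show ?thesis using assms by (simp add: convergent_diff_const_right_iff)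
qed

lemma sqrt_lim_carrier [simp]: "sqrt_lim p C \<in> carrier_mat p p"
  by (simp add: sqrt_lim_def)

lemma sqrt_lim_tendsto:
  "i < p \<Longrightarrow> j < p \<Longrightarrow> (\<lambda>k. sqrt_iter p C k $$ (i, j)) \<longlonglongrightarrow> sqrt_lim p C $$ (i, j)"
  using sqrt_iter_convergent[of i j] by (simp add: sqrt_lim_def convergent_LIMSEQ_iff)

lemma sqrt_lim_sym: "transpose_mat (sqrt_lim p C) = sqrt_lim p C"
proof (rule transpose_eqI[of _ p])
  fix i j assume ij: "i < p" "j < p"
  have "sqrt_iter p C k $$ (i, j) = sqrt_iter p C k $$ (j, i)" for k
    by (rule transpose_eqD[OF sqrt_iter_sym sqrt_iter_carrier ij])
  then show "sqrt_lim p C $$ (i, j) = sqrt_lim p C $$ (j, i)" using ij by (simp add: sqrt_lim_def)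
qed simp

lemma sqrt_lim_fixpoint: "2 \<cdot>\<^sub>m sqrt_lim p C = C + sqrt_lim p C * sqrt_lim p C"
proof (rule eq_matI)
  fix i j assume "i < dim_row (C + sqrt_lim p C * sqrt_lim p C)" "j < dim_col (C + sqrt_lim p C * sqrt_lim p C)"
  then have ij: "i < p" "j < p" by (auto simp: sqrt_lim_def)
  have "(\<lambda>k. 1/2 * (C $$ (i, j) + (\<Sum>l<p. sqrt_iter p C k $$ (i, l) * sqrt_iter p C k $$ (l, j))))
      \<longlonglongrightarrow> 1/2 * (C $$ (i, j) + (\<Sum>l<p. sqrt_lim p C $$ (i, l) * sqrt_lim p C $$ (l, j)))"
    using ij by (intro tendsto_intros sqrt_lim_tendsto) auto
  moreover have "1/2 * (C $$ (i, j) + (\<Sum>l<p. sqrt_iter p C k $$ (i, l) * sqrt_iter p C k $$ (l, j)))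
       = sqrt_iter p C (Suc k) $$ (i, j)" for k
    using ij carrier_matD[OF sqrt_iter_carrier[of k]] carrier_matD[OF op_boundedD(1)[OF C]]
    by (simp add: scalar_prod_def atLeast0LessThan)
  ultimately have "(\<lambda>k. sqrt_iter p C (Suc k) $$ (i, j)) \<longlonglongrightarrow>
      1/2 * (C $$ (i, j) + (\<Sum>l<p. sqrt_lim p C $$ (i, l) * sqrt_lim p C $$ (l, j)))"
    by simp
  with sqrt_lim_tendsto[OF ij, THEN LIMSEQ_Suc]
  have "sqrt_lim p C $$ (i, j) = 1/2 * (C $$ (i, j) + (\<Sum>l<p. sqrt_lim p C $$ (i, l) * sqrt_lim p C $$ (l, j)))"
    by (rule LIMSEQ_unique)
  then show "(2 \<cdot>\<^sub>m sqrt_lim p C) $$ (i, j) = (C + sqrt_lim p C * sqrt_lim p C) $$ (i, j)"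
    using ij carrier_matD[OF sqrt_lim_carrier] carrier_matD[OF op_boundedD(1)[OF C]]
    by (simp add: scalar_prod_def atLeast0LessThan)
qed (use op_boundedD(1)[OF C] in \<open>auto simp: sqrt_lim_def\<close>)

text \<open>All iterates have operator norm at most 1, and the form depends continuously on the
  entries. This is what makes \<open>1 - X\<close> positive semi-definite, so that the iteration
  finds the principal root among all roots of \<open>1 - C\<close>.\<close>

lemma sqrt_lim_form_le:
  assumes v: "v \<in> carrier_vec p"
  shows "v \<bullet> (sqrt_lim p C *\<^sub>v v) \<le> v \<bullet> v"
proof (rule LIMSEQ_le_const2)
  show "(\<lambda>k. v \<bullet> (sqrt_iter p C k *\<^sub>v v)) \<longlonglongrightarrow> v \<bullet> (sqrt_lim p C *\<^sub>v v)"
    using v unfolding scalar_prod_mat_sum[OF sqrt_lim_carrier v v] scalar_prod_mat_sum[OF sqrt_iter_carrier v v]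
    by (intro tendsto_intros sqrt_lim_tendsto) auto
  have "v \<bullet> (sqrt_iter p C k *\<^sub>v v) \<le> v \<bullet> v" for k
  proof -
    have "v \<bullet> (sqrt_iter p C k *\<^sub>v v) \<le> vnorm v * vnorm (sqrt_iter p C k *\<^sub>v v)"
      using norm_scalar_prod_le[of v p "sqrt_iter p C k *\<^sub>v v"] sqrt_iter_carrier[of k] v by auto
    also have "\<dots> \<le> vnorm v * (1 * vnorm v)"
      using op_bounded_mono[OF sqrt_iter_op_bounded, of k 1] v sqrt_iter_bound_le[of k]
      by (intro mult_left_mono) (auto simp: op_bounded_def)
    finally show ?thesis using vnorm_square_real[OF v] by (simp add: power2_eq_square)
  qed
  then show "\<exists>N. \<forall>n\<ge>N. v \<bullet> (sqrt_iter p C n *\<^sub>v v) \<le> v \<bullet> v" by blast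
qed

lemma one_minus_sqrt_lim:
  shows "sym_psd_mat p (1\<^sub>m p - sqrt_lim p C)" "(1\<^sub>m p - sqrt_lim p C) * (1\<^sub>m p - sqrt_lim p C) = 1\<^sub>m p - C"
proof -
  have "v \<bullet> ((1\<^sub>m p - sqrt_lim p C) *\<^sub>v v) = v \<bullet> v - v \<bullet> (sqrt_lim p C *\<^sub>v v)" if "v \<in> carrier_vec p" for v
    using that mult_mat_vec_carrier[OF sqrt_lim_carrier that]
    by (simp add: minus_mult_distrib_mat_vec[of _ p p] scalar_prod_minus_distrib[of _ p])
  then show "sym_psd_mat p (1\<^sub>m p - sqrt_lim p C)"
    using sqrt_lim_form_le sqrt_lim_sym minus_carrier_mat[OF sqrt_lim_carrier, of "1\<^sub>m p"]
    by (auto simp: sym_psd_mat_def transpose_minus[of _ p p])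
  have "(1\<^sub>m p - sqrt_lim p C) * (1\<^sub>m p - sqrt_lim p C) = 1\<^sub>m p * (1\<^sub>m p - sqrt_lim p C) - sqrt_lim p C * (1\<^sub>m p - sqrt_lim p C)"
    by (intro minus_mult_distrib_mat[of _ p p _ _ p] minus_carrier_mat) auto
  also have "\<dots> = 1\<^sub>m p - sqrt_lim p C - (sqrt_lim p C - sqrt_lim p C * sqrt_lim p C)"
    using minus_carrier_mat[OF sqrt_lim_carrier, of "1\<^sub>m p"]
      mult_minus_distrib_mat[OF sqrt_lim_carrier one_carrier_mat sqrt_lim_carrier]
    by (simp add: right_mult_one_mat[OF sqrt_lim_carrier] left_mult_one_mat)
  also have "sqrt_lim p C * sqrt_lim p C = 2 \<cdot>\<^sub>m sqrt_lim p C - C"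
    unfolding sqrt_lim_fixpoint using op_boundedD(1)[OF C] carrier_matD[OF sqrt_lim_carrier]
    by (intro eq_matI) auto
  also have "1\<^sub>m p - sqrt_lim p C - (sqrt_lim p C - (2 \<cdot>\<^sub>m sqrt_lim p C - C)) = 1\<^sub>m p - C"
    using op_boundedD(1)[OF C] carrier_matD[OF sqrt_lim_carrier] by (intro eq_matI) auto
  finally show "(1\<^sub>m p - sqrt_lim p C) * (1\<^sub>m p - sqrt_lim p C) = 1\<^sub>m p - C" .
qed

end

text \<open>The Frobenius norm plus 1: it dominates the operator norm, is strictly positive and
  depends measurably on the entries. Dividing \<open>S\<close> by it brings the matrix into the
  range where the iteration converges, applied to the complement
  \<open>C = 1 - S / f\<close>.\<close>

definition sqrt_scale :: "nat \<Rightarrow> real mat \<Rightarrow> real" where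
  "sqrt_scale p S = sqrt (\<Sum>i<p. \<Sum>j<p. (norm (S $$ (i, j)))\<^sup>2) + 1"

definition sqrt_compl :: "nat \<Rightarrow> real mat \<Rightarrow> real mat" where
  "sqrt_compl p S = 1\<^sub>m p - (1 / sqrt_scale p S) \<cdot>\<^sub>m S"

lemma sqrt_scale_pos: "0 < sqrt_scale p S"
  by (simp add: sqrt_scale_def sum_nonneg add_nonneg_pos)

lemma sym_psd_mat_smult: "sym_psd_mat p S \<Longrightarrow> 0 \<le> a \<Longrightarrow> sym_psd_mat p (a \<cdot>\<^sub>m S)"
  unfolding sym_psd_mat_def
  by (auto simp: smult_mat_mult_vec[of _ p p] transpose_smult)

text \<open>For \<open>T = S / f\<close> the squared norm of \<open>(1 - T) v\<close> is
  \<open>v \<bullet> v - 2 (v \<bullet> T v) + T v \<bullet> T v\<close>. The last term is at most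
  \<open>v \<bullet> T v\<close> by \<open>psd_vnorm_le\<close> with bound 1, and
  \<open>v \<bullet> T v\<close> is non-negative.\<close>

lemma sqrt_compl:
  assumes S: "sym_psd_mat p S"
  shows "op_bounded p (sqrt_compl p S) 1" "transpose_mat (sqrt_compl p S) = sqrt_compl p S"
proof -
  define T where "T = (1 / sqrt_scale p S) \<cdot>\<^sub>m S"
  have T: "sym_psd_mat p T" unfolding T_def using S sqrt_scale_pos[of p S] by (intro sym_psd_mat_smult) auto
  note Tc = sym_psd_matD[OF T]
  have "op_bounded p S (sqrt_scale p S)"
    by (rule op_bounded_mono[OF op_bounded_frobenius]) (use sym_psd_matD[OF S] in \<open>auto simp: sqrt_scale_def\<close>)
  from op_bounded_smult[OF this, of "1 / sqrt_scale p S"] have T1: "op_bounded p T 1"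
    using sqrt_scale_pos[of p S] by (simp add: T_def)
  show "transpose_mat (sqrt_compl p S) = sqrt_compl p S"
    using Tc by (simp add: sqrt_compl_def T_def[symmetric] transpose_minus[of _ p p])
  have "vnorm ((1\<^sub>m p - T) *\<^sub>v v) \<le> 1 * vnorm v" if v: "v \<in> carrier_vec p" for v
  proof -
    have u: "T *\<^sub>v v \<in> carrier_vec p" using Tc v by auto
    have "(vnorm ((1\<^sub>m p - T) *\<^sub>v v))\<^sup>2 = (v - T *\<^sub>v v) \<bullet> (v - T *\<^sub>v v)"
      using v u Tc by (subst vnorm_square_real[of _ p]) (auto simp: minus_mult_distrib_mat_vec[of _ p p])
    also have "\<dots> = v \<bullet> v - 2 * (v \<bullet> (T *\<^sub>v v)) + (T *\<^sub>v v) \<bullet> (T *\<^sub>v v)"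
      using v u comm_scalar_prod[OF u v]
      by (simp add: minus_scalar_prod_distrib[of _ p] scalar_prod_minus_distrib[of _ p])
    also have "\<dots> \<le> v \<bullet> v - v \<bullet> (T *\<^sub>v v)"
      using psd_vnorm_le[OF T T1 _ v] vnorm_square_real[OF u] by simp
    also have "\<dots> \<le> (vnorm v)\<^sup>2" using Tc(3)[OF v] vnorm_square_real[OF v] by simp
    finally show ?thesis by (simp add: power2_le_iff_abs_le)
  qed
  then show "op_bounded p (sqrt_compl p S) 1"
    using Tc(1) by (auto simp: op_bounded_def sqrt_compl_def T_def[symmetric])
qed

text \<open>The rescaled limit is a positive semi-definite root, and \<open>psd_square_inj\<close>
  makes it the only one, so the description denotes it. The closed formula is kept for
  measurability.\<close>

lemma psd_sqrt_eq:
  assumes S: "sym_psd_mat p S"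
  shows "psd_sqrt S = sqrt (sqrt_scale p S) \<cdot>\<^sub>m (1\<^sub>m p - sqrt_lim p (sqrt_compl p S))"
    and "sym_psd_mat p (psd_sqrt S)" and "psd_sqrt S * psd_sqrt S = S"
proof -
  define f where "f = sqrt_scale p S"
  define B where "B = 1\<^sub>m p - sqrt_lim p (sqrt_compl p S)"
  have f: "0 < f" by (simp add: f_def sqrt_scale_pos)
  note Sc = sym_psd_matD[OF S]
  note B = one_minus_sqrt_lim[OF sqrt_compl[OF S], folded B_def]
  have 1: "sym_psd_mat p (sqrt f \<cdot>\<^sub>m B)" using B f by (intro sym_psd_mat_smult) auto
  have "(sqrt f \<cdot>\<^sub>m B) * (sqrt f \<cdot>\<^sub>m B) = f \<cdot>\<^sub>m (B * B)"
    using sym_psd_matD(1)[OF B(1)] f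
    by (intro eq_matI) (auto)
  also have "\<dots> = S"
    unfolding B(2) sqrt_compl_def f_def[symmetric] using Sc f by (intro eq_matI) auto
  finally have 2: "(sqrt f \<cdot>\<^sub>m B) * (sqrt f \<cdot>\<^sub>m B) = S" .
  have "psd_sqrt S = sqrt f \<cdot>\<^sub>m B"
    unfolding psd_sqrt_def
  proof (rule the_equality)
    show "sym_psd_mat (dim_row S) (sqrt f \<cdot>\<^sub>m B) \<and> (sqrt f \<cdot>\<^sub>m B) * (sqrt f \<cdot>\<^sub>m B) = S"
      using 1 2 Sc by auto
    show "A = sqrt f \<cdot>\<^sub>m B" if "sym_psd_mat (dim_row S) A \<and> A * A = S" for A
    proof (rule psd_square_inj)
      show "sym_psd_mat p A" using that carrier_matD(1)[OF Sc(1)] by simp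
      show "A * A = (sqrt f \<cdot>\<^sub>m B) * (sqrt f \<cdot>\<^sub>m B)" using that 2 by metis
    qed (rule 1)
  qed
  then show "psd_sqrt S = sqrt (sqrt_scale p S) \<cdot>\<^sub>m (1\<^sub>m p - sqrt_lim p (sqrt_compl p S))"
     "sym_psd_mat p (psd_sqrt S)" "psd_sqrt S * psd_sqrt S = S"
    using 1 2 by (simp_all add: f_def B_def)
qed

section \<open>Resolvents and rank one updates\<close>

abbreviation cmat :: "real mat \<Rightarrow> complex mat" where "cmat \<equiv> map_mat complex_of_real"
abbreviation cvec :: "real vec \<Rightarrow> complex vec" where "cvec \<equiv> map_vec complex_of_real"

definition shifted :: "nat \<Rightarrow> real mat \<Rightarrow> complex \<Rightarrow> complex mat" where
  "shifted p A z = cmat A - z \<cdot>\<^sub>m 1\<^sub>m p"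

definition resolvent :: "nat \<Rightarrow> real mat \<Rightarrow> complex \<Rightarrow> complex mat" where
  "resolvent p A z = the (mat_inverse (shifted p A z))"

text \<open>The product \<open>\<bullet>\<close> is bilinear also over the complex numbers;
  conjugating one factor turns it into the Hermitian product, which controls the norm.\<close>

definition vcnj :: "complex vec \<Rightarrow> complex vec" where "vcnj = map_vec cnj"

lemma vcnj_carrier [simp]: "v \<in> carrier_vec p \<Longrightarrow> vcnj v \<in> carrier_vec p"
  by (simp add: vcnj_def)

lemma vnorm_vcnj [simp]: "vnorm (vcnj v) = vnorm v"
  unfolding vnorm_def vcnj_def by (auto intro: L2_set_cong)

lemma vnorm_cvec [simp]: "vnorm (cvec v) = vnorm v"
  unfolding vnorm_def by (auto intro: L2_set_cong)

lemma scalar_prod_vcnj: "v \<in> carrier_vec p \<Longrightarrow> v \<bullet> vcnj v = complex_of_real ((vnorm v)\<^sup>2)"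
  by (subst vnorm_square) (auto simp: scalar_prod_def vcnj_def atLeast0LessThan
      complex_mult_cnj cmod_power2 intro!: sum.cong)

lemma shifted_carrier [simp]: "A \<in> carrier_mat p p \<Longrightarrow> shifted p A z \<in> carrier_mat p p"
  unfolding shifted_def by (intro minus_carrier_mat) simp

lemma shifted_mult_vec:
  assumes "A \<in> carrier_mat p p" "u \<in> carrier_vec p"
  shows "shifted p A z *\<^sub>v u = cmat A *\<^sub>v u - z \<cdot>\<^sub>v u"
  using assms unfolding shifted_def
  by (subst minus_mult_distrib_mat_vec[of _ p p]) (auto simp: smult_mat_mult_vec[of _ p p])

text \<open>With \<open>u = x + i y\<close>, symmetry of \<open>A\<close> cancels the mixed terms
  and leaves \<open>x \<bullet> A x + y \<bullet> A y\<close>.\<close>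

lemma cmat_form_nonneg:
  assumes A: "sym_psd_mat p A" and u: "u \<in> carrier_vec p"
  shows "Im ((cmat A *\<^sub>v u) \<bullet> vcnj u) = 0" "0 \<le> Re ((cmat A *\<^sub>v u) \<bullet> vcnj u)"
proof -
  note Ac = sym_psd_matD[OF A]
  have eq: "(cmat A *\<^sub>v u) \<bullet> vcnj u = (\<Sum>i<p. \<Sum>j<p. of_real (A $$ (i, j)) * u $ j * cnj (u $ i))"
    using Ac(1) u by (auto simp: scalar_prod_def vcnj_def atLeast0LessThan sum_distrib_right intro!: sum.cong)
  have "Im ((cmat A *\<^sub>v u) \<bullet> vcnj u) = (\<Sum>i<p. \<Sum>j<p. A $$ (i, j) * (Im (u $ j) * Re (u $ i)))
      - (\<Sum>i<p. \<Sum>j<p. A $$ (i, j) * (Re (u $ j) * Im (u $ i)))"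
    unfolding eq by (simp add: sum_subtractf[symmetric] algebra_simps)
  also have "(\<Sum>i<p. \<Sum>j<p. A $$ (i, j) * (Re (u $ j) * Im (u $ i)))
      = (\<Sum>i<p. \<Sum>j<p. A $$ (i, j) * (Im (u $ j) * Re (u $ i)))"
    by (subst sum.swap) (auto intro!: sum.cong simp: transpose_eqD[OF Ac(2,1)])
  finally show "Im ((cmat A *\<^sub>v u) \<bullet> vcnj u) = 0" by simp
  define x where "x = map_vec Re u"
  define y where "y = map_vec Im u"
  have c: "x \<in> carrier_vec p" "y \<in> carrier_vec p" using u by (auto simp: x_def y_def)
  have "Re ((cmat A *\<^sub>v u) \<bullet> vcnj u) = (\<Sum>i<p. \<Sum>j<p. A $$ (i, j) * (Re (u $ j) * Re (u $ i)))
      + (\<Sum>i<p. \<Sum>j<p. A $$ (i, j) * (Im (u $ j) * Im (u $ i)))"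
    unfolding eq by (simp add: sum.distrib[symmetric] algebra_simps)
  also have "\<dots> = x \<bullet> (A *\<^sub>v x) + y \<bullet> (A *\<^sub>v y)"
    using Ac(1) c u
    by (auto simp: scalar_prod_def atLeast0LessThan sum_distrib_left x_def y_def mult_ac intro!: sum.cong arg_cong2[where f="(+)"])
  finally show "0 \<le> Re ((cmat A *\<^sub>v u) \<bullet> vcnj u)" using Ac(3)[OF c(1)] Ac(3)[OF c(2)] by simp
qed

text \<open>No conjugate appears, since \<open>x\<close> is real. The factor \<open>1 / n\<close> is
  kept outside, as the parameter \<open>h\<close> of the later statements.\<close>

definition res_form :: "nat \<Rightarrow> real mat \<Rightarrow> complex \<Rightarrow> real vec \<Rightarrow> complex" where
  "res_form p A z x = cvec x \<bullet> (resolvent p A z *\<^sub>v cvec x)"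

definition res_form2 :: "nat \<Rightarrow> real mat \<Rightarrow> complex \<Rightarrow> real vec \<Rightarrow> complex" where
  "res_form2 p A z x = cvec x \<bullet> ((resolvent p A z * resolvent p A z) *\<^sub>v cvec x)"

context
  fixes p :: nat and A :: "real mat" and z :: complex
  assumes A: "sym_psd_mat p A" and z: "0 < Im z"
begin

lemma shifted_form:
  assumes u: "u \<in> carrier_vec p"
  shows "(shifted p A z *\<^sub>v u) \<bullet> vcnj u =
    of_real (Re ((cmat A *\<^sub>v u) \<bullet> vcnj u)) - z * of_real ((vnorm u)\<^sup>2)"
proof -
  have c: "cmat A *\<^sub>v u \<in> carrier_vec p" using sym_psd_matD(1)[OF A] u by (intro mult_mat_vec_carrier) auto
  have "(shifted p A z *\<^sub>v u) \<bullet> vcnj u = (cmat A *\<^sub>v u) \<bullet> vcnj u - z * (u \<bullet> vcnj u)"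
    using u c vcnj_carrier[OF u] unfolding shifted_mult_vec[OF sym_psd_matD(1)[OF A] u]
    by (subst minus_scalar_prod_distrib[of _ p]) auto
  then show ?thesis
    using cmat_form_nonneg[OF A u] unfolding scalar_prod_vcnj[OF u]
    by (simp add: complex_eq_iff)
qed

text \<open>The form of \<open>A\<close> is real, so the imaginary part of the form of
  \<open>A - z\<close> is \<open>- Im z\<close> times the squared norm of \<open>u\<close>;
  Cauchy-Schwarz concludes. The one estimate yields both the invertibility of \<open>A - z\<close>
  and the norm bound of its inverse.\<close>

lemma vnorm_shifted_ge:
  assumes u: "u \<in> carrier_vec p"
  shows "Im z * vnorm u \<le> vnorm (shifted p A z *\<^sub>v u)"
proof -
  let ?x = "shifted p A z *\<^sub>v u"
  have x: "?x \<in> carrier_vec p" using sym_psd_matD(1)[OF A] u by (intro mult_mat_vec_carrier) auto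
  have "Im z * (vnorm u)\<^sup>2 = \<bar>Im (?x \<bullet> vcnj u)\<bar>"
    using z unfolding shifted_form[OF u] by simp
  also have "\<dots> \<le> cmod (?x \<bullet> vcnj u)" by (rule abs_Im_le_cmod)
  also have "\<dots> \<le> vnorm ?x * vnorm u" using norm_scalar_prod_le[OF x vcnj_carrier[OF u]] by simp
  finally have *: "(Im z * vnorm u) * vnorm u \<le> vnorm ?x * vnorm u" by (simp add: power2_eq_square)
  show ?thesis
  proof (cases "vnorm u = 0")
    case False
    with vnorm_nonneg[of u] have "0 < vnorm u" by linarith
    with * show ?thesis by simp
  qed simp
qed

lemma resolvent:
  "resolvent p A z \<in> carrier_mat p p"
  "shifted p A z * resolvent p A z = 1\<^sub>m p" "resolvent p A z * shifted p A z = 1\<^sub>m p"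
  "Determinant.det (shifted p A z) \<noteq> 0"
proof -
  have c: "shifted p A z \<in> carrier_mat p p" using sym_psd_matD(1)[OF A] by simp
  show d: "Determinant.det (shifted p A z) \<noteq> 0"
  proof
    assume "Determinant.det (shifted p A z) = 0"
    then obtain v where v: "v \<in> carrier_vec p" "v \<noteq> 0\<^sub>v p" "shifted p A z *\<^sub>v v = 0\<^sub>v p"
      using det_0_iff_vec_prod_zero_field[OF c] by blast
    have "vnorm (0\<^sub>v p :: complex vec) = 0" by (simp add: vnorm_def L2_set_def)
    then have "Im z * vnorm v \<le> 0" using vnorm_shifted_ge[OF v(1)] v(3) by simp
    then have "vnorm v = 0" using z vnorm_nonneg[of v] by (simp add: mult_le_0_iff)
    then have "norm (v $ i) \<le> 0" if "i < p" for i
      using norm_vec_index_le[of i v] that v(1) by auto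
    then have "v = 0\<^sub>v p" using v(1) by (intro eq_vecI) auto
    with v(2) show False by simp
  qed
  obtain B where "mat_inverse (shifted p A z) = Some B"
    using mat_inverse(1)[OF c, of "()"] det_non_zero_imp_unit[OF c d, of "()"]
    by (cases "mat_inverse (shifted p A z)") blast+
  with mat_inverse(2)[OF c this]
  show "resolvent p A z \<in> carrier_mat p p"
  "shifted p A z * resolvent p A z = 1\<^sub>m p" "resolvent p A z * shifted p A z = 1\<^sub>m p"
    by (auto simp: resolvent_def)
qed

lemma resolvent_mult_vec:
  assumes "x \<in> carrier_vec p"
  shows "shifted p A z *\<^sub>v (resolvent p A z *\<^sub>v x) = x" "resolvent p A z *\<^sub>v (shifted p A z *\<^sub>v x) = x"
  using assms sym_psd_matD(1)[OF A] resolvent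
  by (simp_all add: assoc_mult_mat_vec[of _ p p _ p, symmetric] del: assoc_mult_mat_vec)

lemma resolvent_op_bounded: "op_bounded p (resolvent p A z) (1 / Im z)"
  unfolding op_bounded_def
proof (intro conjI ballI)
  fix x :: "complex vec" assume x: "x \<in> carrier_vec p"
  then have "resolvent p A z *\<^sub>v x \<in> carrier_vec p" using resolvent(1) by auto
  from vnorm_shifted_ge[OF this] show "vnorm (resolvent p A z *\<^sub>v x) \<le> 1 / Im z * vnorm x"
    using z unfolding resolvent_mult_vec[OF x] by (simp add: field_simps)
qed (use z resolvent in auto)

text \<open>Symmetric under plain transposition, though in general not Hermitian. Its real and
  imaginary parts are therefore real symmetric matrices, to which concentration of quadratic forms
  applies.\<close>

lemma resolvent_sym: "transpose_mat (resolvent p A z) = resolvent p A z"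
proof -
  let ?R = "resolvent p A z" and ?S = "shifted p A z"
  have S: "?S \<in> carrier_mat p p" "transpose_mat ?S = ?S"
    using sym_psd_matD(1)[OF A] transpose_eqD[OF sym_psd_matD(2)[OF A] sym_psd_matD(1)[OF A]]
    by (auto simp: shifted_def intro!: transpose_eqI)
  note R = resolvent
  have "transpose_mat ?R * ?S = 1\<^sub>m p"
    using transpose_mult[OF S(1) R(1)] R(2) S by simp
  then have "(transpose_mat ?R * ?S) * ?R = ?R" using R(1) by simp
  then show ?thesis using R S assoc_mult_mat[of "transpose_mat ?R" p p ?S p ?R p] by simp
qed

lemma res_form2_eq:
  assumes x: "x \<in> carrier_vec p"
  shows "res_form2 p A z x = (resolvent p A z *\<^sub>v cvec x) \<bullet> (resolvent p A z *\<^sub>v cvec x)"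
proof -
  let ?R = "resolvent p A z"
  have "res_form2 p A z x = cvec x \<bullet> (?R *\<^sub>v (?R *\<^sub>v cvec x))"
    using resolvent(1) x by (simp add: res_form2_def assoc_mult_mat_vec[of _ p p _ p])
  also have "\<dots> = (?R *\<^sub>v cvec x) \<bullet> (?R *\<^sub>v cvec x)"
    using resolvent(1) x by (intro scalar_prod_sym_mat[of _ p] resolvent_sym) auto
  finally show ?thesis .
qed

text \<open>Put \<open>u = R x\<close>, so \<open>x = (A - z) u\<close>, and let
  \<open>q \<ge> 0\<close> be the form of \<open>A\<close> at \<open>u\<close>. Then
  \<open>res_form\<close> equals \<open>q - cnj z * (vnorm u)\<^sup>2\<close>. Its imaginary part is
  \<open>Im z * (vnorm u)\<^sup>2\<close>, which dominates \<open>u \<bullet> u\<close>; multiplied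
  by \<open>z\<close> it has imaginary part \<open>Im z * q\<close>.\<close>

lemma res_form_bounds:
  assumes x: "x \<in> carrier_vec p"
  shows "cmod (res_form2 p A z x) \<le> Im (res_form p A z x) / Im z" "0 \<le> Im (z * res_form p A z x)"
proof -
  let ?R = "resolvent p A z"
  define u where "u = ?R *\<^sub>v cvec x"
  have u: "u \<in> carrier_vec p" using resolvent(1) x unfolding u_def by (intro mult_mat_vec_carrier) auto
  define q where "q = Re ((cmat A *\<^sub>v u) \<bullet> vcnj u)"
  have q: "0 \<le> q" using cmat_form_nonneg[OF A u] by (simp add: q_def)
  have "cnj (res_form p A z x) = cvec x \<bullet> vcnj u"
    using x u by (auto simp: res_form_def u_def[symmetric] scalar_prod_def vcnj_def cnj_sum)
  also have "\<dots> = of_real q - z * of_real ((vnorm u)\<^sup>2)"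
    using shifted_form[OF u] resolvent_mult_vec[of "cvec x"] x by (simp add: u_def[symmetric] q_def)
  finally have "res_form p A z x = of_real q - cnj z * of_real ((vnorm u)\<^sup>2)"
    by (metis complex_cnj_cnj complex_cnj_complex_of_real complex_cnj_diff complex_cnj_mult)
  then have re: "Re (res_form p A z x) = q - Re z * (vnorm u)\<^sup>2" and im: "Im (res_form p A z x) = Im z * (vnorm u)\<^sup>2"
    by (simp_all del: of_real_power)
  have "Im (z * res_form p A z x) = Im z * q"
    unfolding times_complex.sel re im by (simp add: algebra_simps)
  with im have *: "Im (res_form p A z x) = Im z * (vnorm u)\<^sup>2" "Im (z * res_form p A z x) = Im z * q" by auto
  then show "0 \<le> Im (z * res_form p A z x)" using z q by simp
  have "cmod (res_form2 p A z x) \<le> vnorm u * vnorm u"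
    unfolding res_form2_eq[OF x] u_def[symmetric] by (rule norm_scalar_prod_le[OF u u])
  then show "cmod (res_form2 p A z x) \<le> Im (res_form p A z x) / Im z"
    using * z by (simp add: power2_eq_square)
qed

end

section \<open>Rank one updates and the Sherman-Morrison formula\<close>

definition rank1_update :: "nat \<Rightarrow> real mat \<Rightarrow> real \<Rightarrow> real vec \<Rightarrow> real mat" where
  "rank1_update p A h x = mat p p (\<lambda>(i, j). A $$ (i, j) + h * (x $ i * x $ j))"

lemma rank1_update_mult_vec:
  assumes "A \<in> carrier_mat p p" "x \<in> carrier_vec p" "v \<in> carrier_vec p"
  shows "rank1_update p A h x *\<^sub>v v = A *\<^sub>v v + (h * (x \<bullet> v)) \<cdot>\<^sub>v x"
  using assms
  by (intro eq_vecI)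
     (auto simp: rank1_update_def scalar_prod_def atLeast0LessThan sum.distrib sum_distrib_left
       sum_distrib_right algebra_simps)

lemma rank1_update_psd:
  assumes A: "sym_psd_mat p A" and x: "x \<in> carrier_vec p" and h: "0 \<le> h"
  shows "sym_psd_mat p (rank1_update p A h x)"
  unfolding sym_psd_mat_def
proof (intro conjI ballI)
  note Ac = sym_psd_matD[OF A]
  show "rank1_update p A h x \<in> carrier_mat p p" by (simp add: rank1_update_def)
  show "transpose_mat (rank1_update p A h x) = rank1_update p A h x"
    using transpose_eqD[OF Ac(2,1)]
    by (intro transpose_eqI[of _ p]) (auto simp: rank1_update_def)
  fix v :: "real vec" assume v: "v \<in> carrier_vec p"
  have "v \<bullet> (rank1_update p A h x *\<^sub>v v) = v \<bullet> (A *\<^sub>v v) + h * (x \<bullet> v) * (v \<bullet> x)"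
    unfolding rank1_update_mult_vec[OF Ac(1) x v]
    using Ac(1) x v by (subst scalar_prod_add_distrib[of _ p]) auto
  also have "\<dots> = v \<bullet> (A *\<^sub>v v) + h * (x \<bullet> v)\<^sup>2"
    using comm_scalar_prod[OF x v] by (simp add: power2_eq_square)
  finally show "0 \<le> v \<bullet> (rank1_update p A h x *\<^sub>v v)" using Ac(3)[OF v] h by simp
qed

text \<open>Multiplication by \<open>z\<close> bounds the Sherman-Morrison denominator from below, as
  \<open>Im (z (1 + a)) \<ge> Im z\<close>.\<close>

lemma cmod_one_plus_ge:
  assumes z: "0 < Im z" and "0 \<le> Im (z * a)"
  shows "Im z / cmod z \<le> cmod (1 + a)"
proof -
  have "Im z \<le> Im (z * (1 + a))" using assms by (simp add: distrib_left)
  also have "\<dots> \<le> cmod (z * (1 + a))" using abs_Im_le_cmod order_trans abs_ge_self by blast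
  finally have "Im z \<le> cmod z * cmod (1 + a)" by (simp only: norm_mult)
  moreover have "0 < cmod z" using z by auto
  ultimately show ?thesis by (simp add: field_simps)
qed

lemma one_plus_nonzero: "0 < Im z \<Longrightarrow> 0 \<le> Im (z * a) \<Longrightarrow> 1 + a \<noteq> 0"
  using cmod_one_plus_ge[of z a] divide_pos_pos[of "Im z" "cmod z"] by fastforce

text \<open>With \<open>u = R x\<close> and \<open>u' = R' x\<close>, the resolvent identity reads:
  \<open>R - R'\<close> is \<open>h\<close> times the outer product of \<open>u'\<close> and
  \<open>u\<close>. Applied to \<open>x\<close> it gives \<open>u = (1 + h a) u'\<close>, and its
  trace then gives the formula.\<close>

lemma trace_resolvent_rank1:
  assumes A: "sym_psd_mat p A" and z: "0 < Im z" and x: "x \<in> carrier_vec p" and h: "0 \<le> h"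
  shows "mat_trace (resolvent p (rank1_update p A h x) z) =
    mat_trace (resolvent p A z) - of_real h * res_form2 p A z x / (1 + of_real h * res_form p A z x)"
proof -
  define B where "B = rank1_update p A h x"
  have B: "sym_psd_mat p B" unfolding B_def by (rule rank1_update_psd[OF A x h])
  note Ac = sym_psd_matD(1)[OF A] and Bc = sym_psd_matD(1)[OF B]
  define R where "R = resolvent p A z"
  define R' where "R' = resolvent p B z"
  note R = resolvent[OF A z, folded R_def] and R' = resolvent[OF B z, folded R'_def]
  let ?x = "cvec x"
  define u where "u = R *\<^sub>v ?x"
  define u' where "u' = R' *\<^sub>v ?x"
  have xc: "?x \<in> carrier_vec p" using x by simp
  have uc: "u \<in> carrier_vec p" "u' \<in> carrier_vec p"
    using R(1) R'(1) xc unfolding u_def u'_def by (auto intro: mult_mat_vec_carrier)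
  have Rsym: "R $$ (i, j) = R $$ (j, i)" if "i < p" "j < p" for i j
    using transpose_eqD[OF resolvent_sym[OF A z, folded R_def] R(1) that] .
  have BA: "shifted p B z = shifted p A z + mat p p (\<lambda>(i, j). of_real h * (?x $ i * ?x $ j))"
    using Ac x by (intro eq_matI) (auto simp: shifted_def B_def rank1_update_def)
  let ?X = "mat p p (\<lambda>(i, j). of_real h * (?x $ i * ?x $ j))"
  \<comment> \<open>The product \<open>shifted p B z * R\<close> is the identity plus the rank one
    matrix times \<open>R\<close>, because \<open>shifted p A z * R\<close> is the identity.\<close>
  have "R = R' * (shifted p B z * R)"
    using R R' Bc by (simp add: assoc_mult_mat[of R' p p "shifted p B z" p R p, symmetric] del: assoc_mult_mat)
  also have "shifted p B z * R = 1\<^sub>m p + ?X * R"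
    unfolding BA using R Ac by (simp add: add_mult_distrib_mat[of _ p p])
  also have "R' * (1\<^sub>m p + ?X * R) = R' + R' * (?X * R)"
    using R R' by (subst mult_add_distrib_mat[of _ p p]) auto
  finally have RR: "R = R' + R' * (?X * R)" .
  have XR: "(?X * R) $$ (l, j) = of_real h * ?x $ l * u $ j" if "l < p" "j < p" for l j
  proof -
    have "(?X * R) $$ (l, j) = (\<Sum>k<p. of_real h * (?x $ l * ?x $ k) * R $$ (k, j))"
      using R(1) that by (auto simp: scalar_prod_def atLeast0LessThan)
    also have "\<dots> = of_real h * ?x $ l * (\<Sum>k<p. R $$ (j, k) * ?x $ k)"
      using that by (auto simp: sum_distrib_left Rsym[of _ j] mult_ac intro!: sum.cong)
    also have "(\<Sum>k<p. R $$ (j, k) * ?x $ k) = u $ j"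
      using R(1) xc that by (auto simp: u_def scalar_prod_def atLeast0LessThan)
    finally show ?thesis .
  qed
  have entry: "R $$ (i, j) = R' $$ (i, j) + of_real h * u' $ i * u $ j" if "i < p" "j < p" for i j
  proof -
    have "R $$ (i, j) = (R' + R' * (?X * R)) $$ (i, j)" using RR by metis
    also have "\<dots> = R' $$ (i, j) + (\<Sum>l<p. R' $$ (i, l) * (?X * R) $$ (l, j))"
      using R(1) R'(1) that by (auto simp: scalar_prod_def atLeast0LessThan simp del: index_mult_mat(1))
         (auto simp: scalar_prod_def atLeast0LessThan)
    also have "(\<Sum>l<p. R' $$ (i, l) * (?X * R) $$ (l, j)) = of_real h * (\<Sum>l<p. R' $$ (i, l) * ?x $ l) * u $ j"
      using that XR by (auto simp: sum_distrib_left sum_distrib_right mult_ac simp del: index_mult_mat(1) intro!: sum.cong)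
    also have "(\<Sum>l<p. R' $$ (i, l) * ?x $ l) = u' $ i"
      using R'(1) xc that by (auto simp: u'_def scalar_prod_def atLeast0LessThan)
    finally show ?thesis .
  qed
  define a where "a = res_form p A z x"
  define b where "b = res_form2 p A z x"
  have a: "a = (\<Sum>j<p. u $ j * ?x $ j)"
    using xc uc unfolding a_def res_form_def R_def[symmetric] u_def[symmetric]
    by (auto simp: scalar_prod_def atLeast0LessThan mult_ac)
  have b: "b = (\<Sum>j<p. u $ j * u $ j)"
    using uc unfolding b_def res_form2_eq[OF A z x] R_def[symmetric] u_def[symmetric]
    by (auto simp: scalar_prod_def atLeast0LessThan)
  have u'_eq: "u $ i = u' $ i * (1 + of_real h * a)" if "i < p" for i
  proof -
    have "u $ i = (\<Sum>j<p. R $$ (i, j) * ?x $ j)"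
      using R(1) xc that by (auto simp: u_def scalar_prod_def atLeast0LessThan)
    also have "\<dots> = (\<Sum>j<p. R' $$ (i, j) * ?x $ j) + of_real h * u' $ i * (\<Sum>j<p. u $ j * ?x $ j)"
      using that entry by (auto simp: sum_distrib_left sum.distrib[symmetric] algebra_simps intro!: sum.cong)
    also have "(\<Sum>j<p. R' $$ (i, j) * ?x $ j) = u' $ i"
      using R'(1) xc that by (auto simp: u'_def scalar_prod_def atLeast0LessThan)
    finally show ?thesis by (simp add: a algebra_simps)
  qed
  have "0 \<le> Im (z * (of_real h * a))"
  proof -
    have "Im (z * (of_real h * a)) = h * Im (z * a)" by (simp add: algebra_simps)
    then show ?thesis using res_form_bounds(2)[OF A z x] h by (simp add: a_def)
  qed
  from one_plus_nonzero[OF z this] have ne: "1 + of_real h * a \<noteq> 0" .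
  have "mat_trace R = mat_trace R' + of_real h * (\<Sum>i<p. u' $ i * u $ i)"
    using R(1) R'(1) entry by (simp add: mat_trace_sum sum.distrib sum_distrib_left mult.assoc)
  also have "(\<Sum>i<p. u' $ i * u $ i) = (\<Sum>i<p. u $ i * u $ i / (1 + of_real h * a))"
    using ne by (intro sum.cong) (auto simp: u'_eq)
  also have "\<dots> = b / (1 + of_real h * a)" by (simp add: b sum_divide_distrib)
  finally show ?thesis by (simp add: R_def R'_def B_def a_def b_def)
qed

text \<open>For real \<open>x\<close> the parts of the complex form are forms of the real matrices
  of parts, which is how complex resolvents come within the reach of (A1).\<close>

lemma Re_form:
  assumes "R \<in> carrier_mat p p" "x \<in> carrier_vec p"
  shows "Re (cvec x \<bullet> (R *\<^sub>v cvec x)) = x \<bullet> (map_mat Re R *\<^sub>v x)"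
    "Im (cvec x \<bullet> (R *\<^sub>v cvec x)) = x \<bullet> (map_mat Im R *\<^sub>v x)"
  using assms by (auto simp: scalar_prod_def atLeast0LessThan intro!: sum.cong)

lemma op_bounded_Re_Im:
  assumes "op_bounded p R K"
  shows "op_bounded p (map_mat Re R) K" "op_bounded p (map_mat Im R) K"
proof -
  note R = op_boundedD[OF assms]
  have *: "vnorm (map_mat Re R *\<^sub>v v) \<le> K * vnorm v \<and> vnorm (map_mat Im R *\<^sub>v v) \<le> K * vnorm v"
    if v: "v \<in> carrier_vec p" for v :: "real vec"
  proof -
    have "(map_mat Re R *\<^sub>v v) $ i = Re ((R *\<^sub>v cvec v) $ i) \<and> (map_mat Im R *\<^sub>v v) $ i = Im ((R *\<^sub>v cvec v) $ i)"
      if "i < p" for i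
      using that v R(1) by (auto simp: scalar_prod_def atLeast0LessThan)
    then have "vnorm (map_mat Re R *\<^sub>v v) \<le> vnorm (R *\<^sub>v cvec v) \<and> vnorm (map_mat Im R *\<^sub>v v) \<le> vnorm (R *\<^sub>v cvec v)"
      using R(1) unfolding vnorm_def
      by (auto intro!: L2_set_mono simp: abs_Re_le_cmod abs_Im_le_cmod simp del: index_mult_mat_vec)
    moreover have "vnorm (R *\<^sub>v cvec v) \<le> K * vnorm v" using R(3)[of "cvec v"] v by simp
    ultimately show ?thesis by linarith
  qed
  then show "op_bounded p (map_mat Re R) K" "op_bounded p (map_mat Im R) K"
    using R by (auto simp: op_bounded_def)
qed

text \<open>\<open>a\<close>, \<open>b\<close> stand for \<open>x\<^sup>T R x / n\<close> and \<open>x\<^sup>T R\<^sup>2 x / n\<close>, or for the traces against \<open>\<Sigma>\<close> replacing them.\<close>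

definition sm_admissible :: "complex \<Rightarrow> complex \<Rightarrow> complex \<Rightarrow> bool" where
  "sm_admissible z a b \<longleftrightarrow> cmod b \<le> Im a / Im z \<and> 0 \<le> Im (z * a)"

text \<open>Adding 1 does not change the imaginary part, so
  \<open>cmod b \<le> Im (1 + a) / Im z \<le> cmod (1 + a) / Im z\<close>. The bound is free of
  \<open>a\<close> and \<open>b\<close>, hence of the length of the column.\<close>

lemma sm_admissible_bound:
  assumes z: "0 < Im z" and "sm_admissible z a b"
  shows "cmod (b / (1 + a)) \<le> 1 / Im z"
proof -
  have "cmod b \<le> Im (1 + a) / Im z" using assms by (simp add: sm_admissible_def)
  also have "\<dots> \<le> cmod (1 + a) / Im z"
    using z abs_Im_le_cmod[of "1 + a"] by (intro divide_right_mono) auto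
  finally have "cmod b \<le> cmod (1 + a) / Im z" .
  moreover have "0 < cmod (1 + a)"
    using one_plus_nonzero[OF z, of a] assms by (simp add: sm_admissible_def)
  ultimately show ?thesis using z by (simp add: norm_divide field_simps)
qed

text \<open>The difference is written as
  \<open>inverse (1 + a) * ((b - b') + b' / (1 + a') * (a' - a))\<close>. The first factor is at
  most \<open>cmod z / Im z\<close>, and the quotient inside is already bounded by
  \<open>1 / Im z\<close>; together they make up the constant.\<close>

lemma sm_admissible_diff:
  assumes z: "0 < Im z" and 1: "sm_admissible z a b" and 2: "sm_admissible z a' b'"
    and e: "cmod (a - a') \<le> e" "cmod (b - b') \<le> e"
  shows "cmod (b / (1 + a) - b' / (1 + a')) \<le> e * (cmod z / Im z * (1 + 1 / Im z))"
proof -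
  have zp: "0 < cmod z" using z by auto
  have g: "Im z / cmod z \<le> cmod (1 + a)" "Im z / cmod z \<le> cmod (1 + a')"
    using 1 2 cmod_one_plus_ge[OF z] by (auto simp: sm_admissible_def)
  have g0: "0 < Im z / cmod z" using z zp by simp
  have ne: "1 + a \<noteq> 0" "1 + a' \<noteq> 0" using g g0 by auto
  have inv: "cmod (inverse (1 + a)) \<le> cmod z / Im z"
    using le_imp_inverse_le[OF g(1) g0] by (simp add: norm_inverse)
  have e0: "0 \<le> e" using e(1) norm_ge_zero order_trans by blast
  have "b / (1 + a) - b' / (1 + a') = inverse (1 + a) * ((b - b') + b' / (1 + a') * (a' - a))"
    using ne by (simp add: field_simps)
  also have "cmod \<dots> \<le> cmod z / Im z * (e + 1 / Im z * e)"
    unfolding norm_mult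
  proof (intro mult_mono inv)
    have "cmod ((b - b') + b' / (1 + a') * (a' - a)) \<le> cmod (b - b') + cmod (b' / (1 + a')) * cmod (a' - a)"
      by (metis norm_mult norm_triangle_ineq)
    also have "\<dots> \<le> e + 1 / Im z * e"
      using e sm_admissible_bound[OF z 2] z by (intro add_mono mult_mono) (auto simp: norm_minus_commute)
    finally show "cmod ((b - b') + b' / (1 + a') * (a' - a)) \<le> e + 1 / Im z * e" .
  qed (use z in auto)
  finally show ?thesis by (simp add: algebra_simps)
qed

section \<open>The contribution of one column and its approximation\<close>

definition sm_term :: "nat \<Rightarrow> real mat \<Rightarrow> complex \<Rightarrow> real \<Rightarrow> real vec \<Rightarrow> complex" where
  "sm_term p A z h x = of_real h * res_form2 p A z x / (1 + of_real h * res_form p A z x)"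

text \<open>The trace of \<open>S * R\<close>, assembled from traces of real matrices because (A1)
  and \<open>S\<close> are real.\<close>

definition res_trace :: "complex mat \<Rightarrow> real mat \<Rightarrow> complex" where
  "res_trace R S = Complex (mat_trace (S * map_mat Re R)) (mat_trace (S * map_mat Im R))"

text \<open>\<open>sm_term\<close> with the forms replaced by traces. It depends on the sample only
  through \<open>S\<close>, and is therefore the common value for the two kinds of columns.\<close>

definition sm_limit :: "nat \<Rightarrow> real mat \<Rightarrow> complex \<Rightarrow> real \<Rightarrow> real mat \<Rightarrow> complex" where
  "sm_limit p A z h S = (let R = resolvent p A z in
     of_real h * res_trace (R * R) S / (1 + of_real h * res_trace R S))"

text \<open>The matrices for which a quadratic form has to be close to its trace: two forms, each
  with a real and an imaginary part. Their number enters a union bound.\<close>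

definition res_parts :: "nat \<Rightarrow> real mat \<Rightarrow> complex \<Rightarrow> real mat set" where
  "res_parts p A z = (let R = resolvent p A z in
     {map_mat Re R, map_mat Im R, map_mat Re (R * R), map_mat Im (R * R)})"

lemma finite_res_parts [simp]: "finite (res_parts p A z)"
  by (simp add: res_parts_def Let_def)

lemma card_res_parts: "card (res_parts p A z) \<le> 4"
  unfolding res_parts_def Let_def by (simp add: card_insert_le_m1)

text \<open>The sum dominates the bounds of \<open>R\<close> and of \<open>R * R\<close> at once, so
  a single \<open>K\<close> serves all four parts.\<close>

definition res_bound :: "complex \<Rightarrow> real" where
  "res_bound z = 1 / Im z + 1 / Im z * (1 / Im z)"

lemma transpose_map_mat: "transpose_mat R = R \<Longrightarrow> transpose_mat (map_mat f R) = map_mat f R"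
  by (metis map_mat_transpose)

lemma res_parts:
  assumes A: "sym_psd_mat p A" and z: "0 < Im z" and B: "B \<in> res_parts p A z"
  shows "transpose_mat B = B" "op_bounded p B (res_bound z)"
proof -
  let ?R = "resolvent p A z"
  note R = resolvent_op_bounded[OF A z]
  have RR: "op_bounded p (?R * ?R) (1 / Im z * (1 / Im z))" by (rule op_bounded_mult[OF R R])
  have "op_bounded p ?R (res_bound z)" "op_bounded p (?R * ?R) (res_bound z)"
    using z by (auto simp: res_bound_def intro: op_bounded_mono[OF R] op_bounded_mono[OF RR])
  then show "op_bounded p B (res_bound z)"
    using B by (auto simp: res_parts_def Let_def intro: op_bounded_Re_Im)
  have "transpose_mat ?R = ?R" "transpose_mat (?R * ?R) = ?R * ?R"
    using resolvent_sym[OF A z] resolvent(1)[OF A z] by (simp_all add: transpose_mult[of _ p p _ p])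
  then show "transpose_mat B = B"
    using B by (auto simp: res_parts_def Let_def transpose_map_mat)
qed

context
  fixes p :: nat and A :: "real mat" and z :: complex and h :: real
  assumes A: "sym_psd_mat p A" and z: "0 < Im z" and h: "0 \<le> h"
begin

lemma res_form_admissible:
  assumes x: "x \<in> carrier_vec p"
  shows "sm_admissible z (of_real h * res_form p A z x) (of_real h * res_form2 p A z x)"
proof -
  note b = res_form_bounds[OF A z x]
  have "h * cmod (res_form2 p A z x) \<le> h * (Im (res_form p A z x) / Im z)"
    by (intro mult_left_mono b h)
  moreover have "0 \<le> h * Im (z * res_form p A z x)" using b h by simp
  ultimately show ?thesis
    using h by (simp add: sm_admissible_def norm_mult algebra_simps)
qed

lemma res_form_complex:
  assumes x: "x \<in> carrier_vec p"
  shows "res_form p A z x = Complex (x \<bullet> (map_mat Re (resolvent p A z) *\<^sub>v x)) (x \<bullet> (map_mat Im (resolvent p A z) *\<^sub>v x))"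
    and "res_form2 p A z x = Complex (x \<bullet> (map_mat Re (resolvent p A z * resolvent p A z) *\<^sub>v x))
      (x \<bullet> (map_mat Im (resolvent p A z * resolvent p A z) *\<^sub>v x))"
  using Re_form[OF resolvent(1)[OF A z] x] Re_form[OF mult_carrier_mat[OF resolvent(1)[OF A z] resolvent(1)[OF A z]] x]
  by (simp_all add: res_form_def res_form2_def complex_eq_iff)

text \<open>Writing \<open>S = Q * Q\<close> turns the traces into sums of \<open>res_form\<close>
  and \<open>res_form2\<close> over the columns of \<open>Q\<close>. The inequalities of
  admissibility survive summation, as the triangle inequality bounds the sum of the \<open>b\<close>
  and the other terms are linear.\<close>

lemma res_trace_admissible:
  assumes S: "sym_psd_mat p S"
  shows "sm_admissible z (of_real h * res_trace (resolvent p A z) S)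
    (of_real h * res_trace (resolvent p A z * resolvent p A z) S)"
proof -
  define Q where "Q = psd_sqrt S"
  note Q = psd_sqrt_eq(2,3)[OF S, folded Q_def]
  note Qc = sym_psd_matD(1,2)[OF Q(1)]
  define R where "R = resolvent p A z"
  have R: "R \<in> carrier_mat p p" "R * R \<in> carrier_mat p p" using resolvent(1)[OF A z] by (auto simp: R_def)
  have col: "col Q k \<in> carrier_vec p" for k using Qc by auto
  have tr: "mat_trace (S * map_mat f T) = (\<Sum>k<p. col Q k \<bullet> (map_mat f T *\<^sub>v col Q k))"
    if "T \<in> carrier_mat p p" for f :: "complex \<Rightarrow> real" and T
    using mat_trace_sandwich[OF Qc, of "map_mat f T"] Q(2) that by simp
  have a: "res_trace R S = (\<Sum>k<p. res_form p A z (col Q k))"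
    by (simp add: res_trace_def tr[OF R(1)] res_form_complex(1)[OF col] R_def[symmetric] complex_eq_iff)
  have b: "res_trace (R * R) S = (\<Sum>k<p. res_form2 p A z (col Q k))"
    by (simp add: res_trace_def tr[OF R(2)] res_form_complex(2)[OF col] R_def[symmetric] complex_eq_iff)
  have "cmod (res_trace (R * R) S) \<le> (\<Sum>k<p. Im (res_form p A z (col Q k)) / Im z)"
    unfolding b by (rule order_trans[OF norm_sum]) (intro sum_mono res_form_bounds[OF A z col])
  also have "\<dots> = Im (res_trace R S) / Im z" unfolding a by (simp add: sum_divide_distrib)
  finally have 1: "h * cmod (res_trace (R * R) S) \<le> h * (Im (res_trace R S) / Im z)"
    by (intro mult_left_mono h)
  have "Im (z * res_trace R S) = (\<Sum>k<p. Im (z * res_form p A z (col Q k)))"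
    unfolding a by (simp only: sum_distrib_left Im_sum)
  also have "0 \<le> \<dots>" by (intro sum_nonneg res_form_bounds[OF A z col])
  finally have "0 \<le> h * Im (z * res_trace R S)" using h by simp
  with 1 h show ?thesis
    unfolding R_def[symmetric] by (simp add: sm_admissible_def norm_mult algebra_simps)
qed

lemma cmod_sm_term_le: "x \<in> carrier_vec p \<Longrightarrow> cmod (sm_term p A z h x) \<le> 1 / Im z"
  unfolding sm_term_def by (intro sm_admissible_bound[OF z] res_form_admissible)

lemma cmod_sm_limit_le: "sym_psd_mat p S \<Longrightarrow> cmod (sm_limit p A z h S) \<le> 1 / Im z"
  unfolding sm_limit_def Let_def by (intro sm_admissible_bound[OF z] res_trace_admissible)

text \<open>The modulus is at most the sum of the absolute values of the parts, whence
  \<open>2 * e\<close>, scaled by \<open>h\<close>. Both pairs being admissible,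
  \<open>sm_admissible_diff\<close> applies.\<close>

lemma sm_term_close:
  assumes x: "x \<in> carrier_vec p" and S: "sym_psd_mat p S"
    and e: "\<And>B. B \<in> res_parts p A z \<Longrightarrow> \<bar>x \<bullet> (B *\<^sub>v x) - mat_trace (S * B)\<bar> \<le> e"
  shows "cmod (sm_term p A z h x - sm_limit p A z h S) \<le> 2 * h * e * (cmod z / Im z * (1 + 1 / Im z))"
proof -
  let ?R = "resolvent p A z"
  have "cmod (res_form p A z x - res_trace ?R S) \<le> 2 * e"
    unfolding res_form_complex[OF x] res_trace_def
    using e[of "map_mat Re ?R"] e[of "map_mat Im ?R"]
    by (intro order_trans[OF cmod_le]) (simp add: res_parts_def Let_def)
  from mult_left_mono[OF this h]
  have a: "cmod (of_real h * res_form p A z x - of_real h * res_trace ?R S) \<le> 2 * h * e"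
    using h by (simp add: right_diff_distrib[symmetric] norm_mult)
  have "cmod (res_form2 p A z x - res_trace (?R * ?R) S) \<le> 2 * e"
    unfolding res_form_complex[OF x] res_trace_def
    using e[of "map_mat Re (?R * ?R)"] e[of "map_mat Im (?R * ?R)"]
    by (intro order_trans[OF cmod_le]) (simp add: res_parts_def Let_def)
  from mult_left_mono[OF this h]
  have b: "cmod (of_real h * res_form2 p A z x - of_real h * res_trace (?R * ?R) S) \<le> 2 * h * e"
    using h by (simp add: right_diff_distrib[symmetric] norm_mult)
  show ?thesis
    unfolding sm_term_def sm_limit_def Let_def
    by (rule sm_admissible_diff[OF z res_form_admissible[OF x] res_trace_admissible[OF S] a b])
qed

end

section \<open>Measurability\<close>

lemma space_vec_borel [simp]: "space (vec_borel p) = carrier_vec p"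
  by (simp add: vec_borel_def)

lemma space_mat_borel [simp]: "space (mat_borel r c) = carrier_mat r c"
  by (simp add: mat_borel_def)

lemma measurable_vec_index [measurable]: "i < p \<Longrightarrow> (\<lambda>v. v $ i) \<in> borel_measurable (vec_borel p)"
proof -
  assume i: "i < p"
  have "(\<lambda>v. restrict (\<lambda>i. v $ i) {..<p}) \<in> measurable (vec_borel p) (PiM {..<p} (\<lambda>_. borel))"
    unfolding vec_borel_def by (rule measurable_vimage_algebra1) (auto simp: space_PiM)
  from measurable_compose[OF this measurable_component_singleton[of i]]
  show ?thesis using i by simp
qed

lemma measurable_mat_index [measurable]:
  "i < r \<Longrightarrow> j < c \<Longrightarrow> (\<lambda>A. A $$ (i, j)) \<in> borel_measurable (mat_borel r c)"
proof -
  assume i: "i < r" "j < c"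
  have "(\<lambda>A. restrict (\<lambda>ij. A $$ ij) ({..<r} \<times> {..<c})) \<in> measurable (mat_borel r c) (PiM ({..<r} \<times> {..<c}) (\<lambda>_. borel))"
    unfolding mat_borel_def by (rule measurable_vimage_algebra1) (auto simp: space_PiM)
  from measurable_compose[OF this measurable_component_singleton[of "(i, j)"]]
  show ?thesis using i by simp
qed

lemma measurable_vec_borelI:
  assumes "\<And>\<omega>. \<omega> \<in> space N \<Longrightarrow> f \<omega> \<in> carrier_vec p"
    and "\<And>i. i < p \<Longrightarrow> (\<lambda>\<omega>. f \<omega> $ i) \<in> borel_measurable N"
  shows "f \<in> measurable N (vec_borel p)"
  unfolding vec_borel_def
  by (rule measurable_vimage_algebra2) (use assms in \<open>auto intro!: measurable_restrict\<close>)

lemma measurable_vec_borelD: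
  assumes "f \<in> measurable N (vec_borel p)"
  shows "\<omega> \<in> space N \<Longrightarrow> f \<omega> \<in> carrier_vec p" "i < p \<Longrightarrow> (\<lambda>\<omega>. f \<omega> $ i) \<in> borel_measurable N"
  using measurable_space[OF assms] measurable_compose[OF assms measurable_vec_index] by auto

lemma measurable_mat_borelD:
  assumes "f \<in> measurable N (mat_borel r c)"
  shows "\<omega> \<in> space N \<Longrightarrow> f \<omega> \<in> carrier_mat r c"
    "i < r \<Longrightarrow> j < c \<Longrightarrow> (\<lambda>\<omega>. f \<omega> $$ (i, j)) \<in> borel_measurable N"
  using measurable_space[OF assms] measurable_compose[OF assms measurable_mat_index] by auto

lemma measurable_col:
  assumes f: "f \<in> measurable N (mat_borel r c)" and j: "j < c"
  shows "(\<lambda>\<omega>. col (f \<omega>) j) \<in> measurable N (vec_borel r)"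
proof (rule measurable_vec_borelI)
  show "col (f \<omega>) j \<in> carrier_vec r" if "\<omega> \<in> space N" for \<omega>
    using measurable_mat_borelD(1)[OF f that] by auto
  show "(\<lambda>\<omega>. col (f \<omega>) j $ i) \<in> borel_measurable N" if i: "i < r" for i
    using measurable_mat_borelD(2)[OF f i j]
    by (rule measurable_cong[THEN iffD1, rotated]) (use measurable_mat_borelD(1)[OF f] i j in \<open>fastforce simp: index_col\<close>)
qed

lemma measurable_quad_form:
  assumes x: "x \<in> measurable N (vec_borel p)" and B: "B \<in> carrier_mat p p"
  shows "(\<lambda>\<omega>. x \<omega> \<bullet> (B *\<^sub>v x \<omega>)) \<in> borel_measurable N"
proof -
  have "(\<lambda>\<omega>. \<Sum>i<p. \<Sum>j<p. x \<omega> $ i * (B $$ (i, j) * x \<omega> $ j)) \<in> borel_measurable N"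
    by (intro borel_measurable_sum borel_measurable_times borel_measurable_const)
       (auto intro: measurable_vec_borelD(2)[OF x])
  then show ?thesis
    by (rule measurable_cong[THEN iffD1, rotated])
       (use measurable_vec_borelD(1)[OF x] in \<open>simp add: scalar_prod_mat_sum[OF B]\<close>)
qed

lemma measurable_trace_mult:
  fixes S :: "_ \<Rightarrow> real mat"
  assumes S: "S \<in> measurable N (mat_borel p p)" and B: "B \<in> carrier_mat p p"
  shows "(\<lambda>\<omega>. mat_trace (S \<omega> * B)) \<in> borel_measurable N"
proof -
  have "(\<lambda>\<omega>. \<Sum>i<p. \<Sum>j<p. S \<omega> $$ (i, j) * B $$ (j, i)) \<in> borel_measurable N"
    by (intro borel_measurable_sum borel_measurable_times borel_measurable_const)
       (auto intro: measurable_mat_borelD(2)[OF S])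
  then show ?thesis
    by (rule measurable_cong[THEN iffD1, rotated])
       (use measurable_mat_borelD(1)[OF S] B in \<open>auto simp: mat_trace_mult[of _ p p]\<close>)
qed

section \<open>Measurability of resolvents and square roots\<close>

lemma measurable_det:
  fixes X :: "'a \<Rightarrow> complex mat"
  assumes "\<And>\<omega>. \<omega> \<in> space N \<Longrightarrow> X \<omega> \<in> carrier_mat n n"
    and "\<And>i j. i < n \<Longrightarrow> j < n \<Longrightarrow> (\<lambda>\<omega>. X \<omega> $$ (i, j)) \<in> borel_measurable N"
  shows "(\<lambda>\<omega>. Determinant.det (X \<omega>)) \<in> borel_measurable N"
proof -
  have "(\<lambda>\<omega>. \<Sum>q | q permutes {0..<n}. signof q * (\<Prod>i = 0..<n. X \<omega> $$ (i, q i))) \<in> borel_measurable N"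
    by (intro borel_measurable_sum borel_measurable_times borel_measurable_prod assms(2) borel_measurable_const)
       (auto simp: permutes_in_image dest: permutes_in_image)
  then show ?thesis
    by (rule measurable_cong[THEN iffD1, rotated]) (use det_def'[OF assms(1)] in auto)
qed

text \<open>Cramer's rule. It makes the entries of the inverse rational in those of
  \<open>S\<close>, whereas the elimination behind \<open>mat_inverse\<close> branches on the
  entries.\<close>

lemma inverse_eq_adj_mat:
  fixes S :: "complex mat"
  assumes S: "S \<in> carrier_mat p p" and R: "R \<in> carrier_mat p p" "R * S = 1\<^sub>m p"
    and ij: "i < p" "j < p" and d: "Determinant.det S \<noteq> 0"
  shows "R $$ (i, j) = adj_mat S $$ (i, j) / Determinant.det S"
proof -
  note adj = adj_mat[OF S]
  have "adj_mat S = R * S * adj_mat S" using R adj(1) by simp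
  also have "\<dots> = R * (Determinant.det S \<cdot>\<^sub>m 1\<^sub>m p)"
    using R(1) S adj by simp
  also have "\<dots> = Determinant.det S \<cdot>\<^sub>m R"
    using R(1) by (simp add: mult_smult_distrib[of _ p p _ p])
  finally have "adj_mat S $$ (i, j) = Determinant.det S * R $$ (i, j)"
    using R(1) ij by simp
  then show ?thesis using d by simp
qed

lemma measurable_trace_resolvent:
  assumes psd: "\<And>\<omega>. \<omega> \<in> space N \<Longrightarrow> sym_psd_mat p (A \<omega>)" and z: "0 < Im z"
    and A: "\<And>i j. i < p \<Longrightarrow> j < p \<Longrightarrow> (\<lambda>\<omega>. A \<omega> $$ (i, j)) \<in> borel_measurable N"
  shows "(\<lambda>\<omega>. mat_trace (resolvent p (A \<omega>) z)) \<in> borel_measurable N"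
proof -
  have c: "A \<omega> \<in> carrier_mat p p" if "\<omega> \<in> space N" for \<omega> using sym_psd_matD(1)[OF psd[OF that]] .
  have S: "(\<lambda>\<omega>. shifted p (A \<omega>) z $$ (i, j)) \<in> borel_measurable N" if "i < p" "j < p" for i j
  proof -
    have "(\<lambda>\<omega>. complex_of_real (A \<omega> $$ (i, j)) - z * (1\<^sub>m p $$ (i, j))) \<in> borel_measurable N"
      using A[OF that] by measurable
    then show ?thesis
      by (rule measurable_cong[THEN iffD1, rotated])
         (use c that in \<open>auto simp: shifted_def carrier_matD[OF c] index_map_mat\<close>)
  qed
  have adj: "(\<lambda>\<omega>. adj_mat (shifted p (A \<omega>) z) $$ (i, i)) \<in> borel_measurable N" if i: "i < p" for i
  proof -
    have "(\<lambda>\<omega>. Determinant.det (mat_delete (shifted p (A \<omega>) z) i i)) \<in> borel_measurable N"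
    proof (rule measurable_det)
      show "mat_delete (shifted p (A \<omega>) z) i i \<in> carrier_mat (p - 1) (p - 1)" if "\<omega> \<in> space N" for \<omega>
        using c[OF that] by (intro mat_delete_carrier) simp
      fix k l assume kl: "k < p - 1" "l < p - 1"
      \<comment> \<open>The indices in the full matrix, shifted past the deleted row and column
        \<open>i\<close>.\<close>
      define k' where "k' = (if k < i then k else Suc k)"
      define l' where "l' = (if l < i then l else Suc l)"
      have "k' < p" "l' < p" using kl by (auto simp: k'_def l'_def)
      from S[OF this] show "(\<lambda>\<omega>. mat_delete (shifted p (A \<omega>) z) i i $$ (k, l)) \<in> borel_measurable N"
        by (rule measurable_cong[THEN iffD1, rotated])
           (use c kl in \<open>fastforce simp: mat_delete_def k'_def l'_def dest: shifted_carrier[of _ _ z]\<close>)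
    qed
    then have "(\<lambda>\<omega>. (-1) ^ (i + i) * Determinant.det (mat_delete (shifted p (A \<omega>) z) i i)) \<in> borel_measurable N"
      by (intro borel_measurable_times borel_measurable_const)
    then show ?thesis
      by (rule measurable_cong[THEN iffD1, rotated])
         (use c i in \<open>fastforce simp: adj_mat_def cofactor_def dest: shifted_carrier[of _ _ z]\<close>)
  qed
  have det: "(\<lambda>\<omega>. Determinant.det (shifted p (A \<omega>) z)) \<in> borel_measurable N"
    using S c by (intro measurable_det[of _ _ p]) auto
  have "(\<lambda>\<omega>. \<Sum>i<p. adj_mat (shifted p (A \<omega>) z) $$ (i, i) / Determinant.det (shifted p (A \<omega>) z)) \<in> borel_measurable N"
    by (intro borel_measurable_sum borel_measurable_divide adj det) auto
  then show ?thesis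
  proof (rule measurable_cong[THEN iffD1, rotated])
    fix \<omega> assume w: "\<omega> \<in> space N"
    note R = resolvent[OF psd[OF w] z]
    show "(\<Sum>i<p. adj_mat (shifted p (A \<omega>) z) $$ (i, i) / Determinant.det (shifted p (A \<omega>) z)) = mat_trace (resolvent p (A \<omega>) z)"
      unfolding mat_trace_sum[OF R(1)]
      using inverse_eq_adj_mat[OF shifted_carrier[OF c[OF w]] R(1,3) _ _ R(4)] by simp
  qed
qed

lemma measurable_sqrt_iter:
  assumes "\<And>\<omega>. \<omega> \<in> space N \<Longrightarrow> op_bounded p (C \<omega>) 1"
    and "\<And>i j. i < p \<Longrightarrow> j < p \<Longrightarrow> (\<lambda>\<omega>. C \<omega> $$ (i, j)) \<in> borel_measurable N"
  shows "i < p \<Longrightarrow> j < p \<Longrightarrow> (\<lambda>\<omega>. sqrt_iter p (C \<omega>) k $$ (i, j)) \<in> borel_measurable N"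
proof (induction k arbitrary: i j)
  case (Suc k)
  have c: "C \<omega> \<in> carrier_mat p p" "sqrt_iter p (C \<omega>) k \<in> carrier_mat p p" if "\<omega> \<in> space N" for \<omega>
  proof -
    show C: "C \<omega> \<in> carrier_mat p p" using op_boundedD(1)[OF assms(1)[OF that]] .
    show "sqrt_iter p (C \<omega>) k \<in> carrier_mat p p" by (induction k) (use C in auto)
  qed
  have "(\<lambda>\<omega>. 1 / 2 * (C \<omega> $$ (i, j) + (\<Sum>l<p. sqrt_iter p (C \<omega>) k $$ (i, l) * sqrt_iter p (C \<omega>) k $$ (l, j))))
      \<in> borel_measurable N"
    using Suc by (intro borel_measurable_sum borel_measurable_times borel_measurable_add assms borel_measurable_const Suc.IH) auto
  then show ?case
  proof (rule measurable_cong[THEN iffD1, rotated])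
    fix \<omega> assume "\<omega> \<in> space N"
    from c(1)[OF this] c(2)[OF this]
    show "1 / 2 * (C \<omega> $$ (i, j) + (\<Sum>l<p. sqrt_iter p (C \<omega>) k $$ (i, l) * sqrt_iter p (C \<omega>) k $$ (l, j)))
       = sqrt_iter p (C \<omega>) (Suc k) $$ (i, j)"
      using Suc.prems by (auto simp: scalar_prod_def atLeast0LessThan)
  qed
qed simp

text \<open>The closed formula of \<open>psd_sqrt_eq\<close> presents each entry as a measurable
  scale times a limit of iterates that are polynomial in a measurable matrix.\<close>

lemma measurable_psd_sqrt:
  assumes S: "S \<in> measurable N (mat_borel p p)" and psd: "\<And>\<omega>. \<omega> \<in> space N \<Longrightarrow> sym_psd_mat p (S \<omega>)"
    and ij: "i < p" "j < p"
  shows "(\<lambda>\<omega>. psd_sqrt (S \<omega>) $$ (i, j)) \<in> borel_measurable N"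
proof -
  note Sij [measurable] = measurable_mat_borelD(2)[OF S]
  have scale [measurable]: "(\<lambda>\<omega>. sqrt_scale p (S \<omega>)) \<in> borel_measurable N"
    unfolding sqrt_scale_def
    by (intro borel_measurable_add borel_measurable_const borel_measurable_sqrt borel_measurable_sum
         borel_measurable_power borel_measurable_norm[unfolded comp_def] measurable_compose[OF Sij borel_measurable_norm]) auto
  have compl: "(\<lambda>\<omega>. sqrt_compl p (S \<omega>) $$ (k, l)) \<in> borel_measurable N" if "k < p" "l < p" for k l
  proof -
    have "(\<lambda>\<omega>. 1\<^sub>m p $$ (k, l) - 1 / sqrt_scale p (S \<omega>) * S \<omega> $$ (k, l)) \<in> borel_measurable N"
      using Sij[OF that] by measurable
    then show ?thesis
    proof (rule measurable_cong[THEN iffD1, rotated])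
      fix \<omega> assume "\<omega> \<in> space N"
      from measurable_mat_borelD(1)[OF S this]
      show "1\<^sub>m p $$ (k, l) - 1 / sqrt_scale p (S \<omega>) * S \<omega> $$ (k, l) = sqrt_compl p (S \<omega>) $$ (k, l)"
        using that by (auto simp: sqrt_compl_def)
    qed
  qed
  have "(\<lambda>\<omega>. sqrt (sqrt_scale p (S \<omega>)) *
      (1\<^sub>m p $$ (i, j) - lim (\<lambda>k. sqrt_iter p (sqrt_compl p (S \<omega>)) k $$ (i, j)))) \<in> borel_measurable N"
    by (intro borel_measurable_times borel_measurable_diff borel_measurable_const borel_measurable_lim_metric
        measurable_sqrt_iter ij compl measurable_compose[OF scale borel_measurable_sqrt]
        sqrt_compl(1) psd measurable_compose[OF scale]) auto
  then show ?thesis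
  proof (rule measurable_cong[THEN iffD1, rotated])
    fix \<omega> assume w: "\<omega> \<in> space N"
    show "sqrt (sqrt_scale p (S \<omega>)) * (1\<^sub>m p $$ (i, j) - lim (\<lambda>k. sqrt_iter p (sqrt_compl p (S \<omega>)) k $$ (i, j)))
      = psd_sqrt (S \<omega>) $$ (i, j)"
      unfolding psd_sqrt_eq(1)[OF psd[OF w]] sqrt_lim_def using ij by simp
  qed
qed

lemma measurable_psd_sqrt_mult_vec:
  assumes S: "S \<in> measurable N (mat_borel p p)" and psd: "\<And>\<omega>. \<omega> \<in> space N \<Longrightarrow> sym_psd_mat p (S \<omega>)"
    and w: "w \<in> measurable N (vec_borel p)"
  shows "(\<lambda>\<omega>. psd_sqrt (S \<omega>) *\<^sub>v w \<omega>) \<in> measurable N (vec_borel p)"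
proof (rule measurable_vec_borelI)
  have c: "psd_sqrt (S \<omega>) \<in> carrier_mat p p" if "\<omega> \<in> space N" for \<omega>
    using sym_psd_matD(1)[OF psd_sqrt_eq(2)[OF psd[OF that]]] .
  show "psd_sqrt (S \<omega>) *\<^sub>v w \<omega> \<in> carrier_vec p" if "\<omega> \<in> space N" for \<omega>
    using c[OF that] measurable_vec_borelD(1)[OF w that] by (rule mult_mat_vec_carrier)
  fix i assume i: "i < p"
  have "(\<lambda>\<omega>. \<Sum>j<p. psd_sqrt (S \<omega>) $$ (i, j) * w \<omega> $ j) \<in> borel_measurable N"
    by (intro borel_measurable_sum borel_measurable_times measurable_psd_sqrt[OF S psd i] measurable_vec_borelD(2)[OF w]) auto
  then show "(\<lambda>\<omega>. (psd_sqrt (S \<omega>) *\<^sub>v w \<omega>) $ i) \<in> borel_measurable N"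
    by (rule measurable_cong[THEN iffD1, rotated])
       (use c measurable_vec_borelD(1)[OF w] i in \<open>fastforce simp: scalar_prod_def atLeast0LessThan\<close>)
qed

section \<open>Bounded differences and replacement of coordinates\<close>

lemma fun_upd_in_space_PiM:
  "x \<in> space (PiM I M) \<Longrightarrow> a \<in> space (M i) \<Longrightarrow> x(i := a) \<in> space (PiM (insert i I) M)"
  by (auto simp: space_PiM PiE_iff extensional_def)

text \<open>McDiarmid's inequality: Hoeffding's lemma is applied to one coordinate after the other. The range
  of a function of one coordinate is put into an interval of length \<open>2 c\<close> rather than \<open>c\<close>, which only
  costs a constant.\<close>

lemma (in product_prob_space) bounded_differences_mgf:
  fixes f :: "('i \<Rightarrow> 'a) \<Rightarrow> real"
  assumes "finite J" and l: "0 < l" and c: "0 \<le> c"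
    and "f \<in> borel_measurable (PiM J M)"
    and "\<And>x. x \<in> space (PiM J M) \<Longrightarrow> \<bar>f x\<bar> \<le> B"
    and "\<And>x i a. x \<in> space (PiM J M) \<Longrightarrow> i \<in> J \<Longrightarrow> a \<in> space (M i) \<Longrightarrow> \<bar>f (x(i := a)) - f x\<bar> \<le> c"
  shows "(\<integral>\<^sup>+x. exp (l * (f x - (\<integral>x. f x \<partial>PiM J M))) \<partial>PiM J M)
    \<le> ennreal (exp (l\<^sup>2 * c\<^sup>2 / 2 * card J))"
  using assms(1,4-6)
proof (induction J arbitrary: f rule: finite_induct)
  case empty
  show ?case
    by (simp add: PiM_empty nn_integral_count_space_finite lebesgue_integral_count_space_finite)
next
  case (insert i J f)
  note fm [measurable] = insert.prems(1)
  note fB = insert.prems(2)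
  note fc = insert.prems(3)
  interpret J: prob_space "PiM J M" by (intro prob_space_PiM prob_space)
  interpret iJ: prob_space "PiM (insert i J) M" by (intro prob_space_PiM prob_space)
  have upd [measurable]: "(\<lambda>(x, a). x(i := a)) \<in> measurable (PiM J M \<Otimes>\<^sub>M M i) (PiM (insert i J) M)"
    by (rule measurable_add_dim)
  \<comment> \<open>The average over the new coordinate. The deviation of \<open>f\<close> splits
    into that of \<open>f\<close> from \<open>g\<close>, handled by Hoeffding's lemma for fixed
    \<open>x\<close>, and that of \<open>g\<close> from the mean, handled by the induction
    hypothesis.\<close>
  define g where "g x = (\<integral>a. f (x(i := a)) \<partial>M i)" for x
  have f2 [measurable]: "(\<lambda>(x, a). f (x(i := a))) \<in> borel_measurable (PiM J M \<Otimes>\<^sub>M M i)"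
    using measurable_compose[OF upd fm] by (simp add: split_beta')
  have gm [measurable]: "g \<in> borel_measurable (PiM J M)"
    unfolding g_def using f2 by (rule M.borel_measurable_lebesgue_integral)
  have sec [measurable]: "(\<lambda>a. f (x(i := a))) \<in> borel_measurable (M i)" if "x \<in> space (PiM J M)" for x
    using measurable_Pair2[OF f2 that] by simp
  have secB: "\<bar>f (x(i := a))\<bar> \<le> B" if "x \<in> space (PiM J M)" "a \<in> space (M i)" for x a
    using fB fun_upd_in_space_PiM[OF that] by blast
  have seci: "integrable (M i) (\<lambda>a. f (x(i := a)))" if "x \<in> space (PiM J M)" for x
    using sec[OF that] secB[OF that] by (intro M.integrable_const_bound[of _ B]) auto
  have gB: "\<bar>g x\<bar> \<le> B" if x: "x \<in> space (PiM J M)" for x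
  proof -
    have "\<bar>g x\<bar> \<le> (\<integral>a. B \<partial>M i)"
      unfolding g_def using seci[OF x] secB[OF x]
      by (intro order_trans[OF integral_abs_bound] integral_mono integrable_abs) auto
    then show ?thesis by (simp add: M.prob_space)
  qed
  \<comment> \<open>Averaging preserves the bounded differences with the same constant.\<close>
  have gc: "\<bar>g (x(j := b)) - g x\<bar> \<le> c" if x: "x \<in> space (PiM J M)" and j: "j \<in> J" and b: "b \<in> space (M j)" for x j b
  proof -
    have xb: "x(j := b) \<in> space (PiM J M)"
      using fun_upd_in_space_PiM[OF x b] j by (simp add: insert_absorb)
    have ne: "i \<noteq> j" using j insert.hyps by auto
    have "\<bar>g (x(j := b)) - g x\<bar> = \<bar>\<integral>a. f (x(j := b, i := a)) - f (x(i := a)) \<partial>M i\<bar>"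
      unfolding g_def by (subst Bochner_Integration.integral_diff) (auto intro: seci x xb)
    also have "\<dots> \<le> (\<integral>a. c \<partial>M i)"
    proof (intro order_trans[OF integral_abs_bound] integral_mono integrable_abs)
      show "\<bar>f (x(j := b, i := a)) - f (x(i := a))\<bar> \<le> c" if "a \<in> space (M i)" for a
        using fc[OF fun_upd_in_space_PiM[OF x that], of j b] j b fun_upd_twist[OF ne[symmetric], of x b a]
        by (simp only: insertI2)
    qed (auto intro!: Bochner_Integration.integrable_diff seci x xb)
    finally show ?thesis by (simp add: M.prob_space)
  qed
  have fi: "integrable (PiM (insert i J) M) f"
    using fB by (intro iJ.integrable_const_bound[of _ B]) auto
  have Ef: "(\<integral>x. f x \<partial>PiM (insert i J) M) = (\<integral>x. g x \<partial>PiM J M)" (is "?E = _")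
    unfolding g_def using insert.hyps fi by (intro product_integral_insert) auto
  have inner: "(\<integral>\<^sup>+a. exp (l * (f (x(i := a)) - ?E)) \<partial>M i) \<le> ennreal (exp (l\<^sup>2 * c\<^sup>2 / 2)) * ennreal (exp (l * (g x - ?E)))"
    if x: "x \<in> space (PiM J M)" for x
  proof -
    \<comment> \<open>An arbitrary reference value: all other values of the section lie within
      \<open>c\<close> of it. The interval has length \<open>2 * c\<close>, so the constant of
      Hoeffding's lemma is a quarter of \<open>2 * l\<^sup>2 * c\<^sup>2\<close>, which is the
      summand \<open>l\<^sup>2 * c\<^sup>2 / 2\<close> per coordinate.\<close>
    obtain a0 where a0: "a0 \<in> space (M i)" using M.not_empty by blast
    let ?m = "f (x(i := a0))"
    interpret h: interval_bounded_random_variable "M i" "\<lambda>a. f (x(i := a))" "?m - c" "?m + c"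
    proof unfold_locales
      show "(\<lambda>a. f (x(i := a))) \<in> borel_measurable (M i)" by (rule sec[OF x])
      show "AE a in M i. f (x(i := a)) \<in> {?m - c..?m + c}"
      proof (rule AE_I2)
        fix a assume a: "a \<in> space (M i)"
        show "f (x(i := a)) \<in> {?m - c..?m + c}"
          using fc[OF fun_upd_in_space_PiM[OF x a0] insertI1 a]
          unfolding fun_upd_upd abs_le_iff atLeastAtMost_iff by linarith
      qed
    qed
    have "(\<integral>\<^sup>+a. exp (l * (f (x(i := a)) - ?E)) \<partial>M i)
        = (\<integral>\<^sup>+a. ennreal (exp (l * (g x - ?E))) * ennreal (exp (l * (f (x(i := a)) - g x))) \<partial>M i)"
      by (intro nn_integral_cong) (simp add: ennreal_mult[symmetric] exp_add[symmetric] algebra_simps)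
    also have "\<dots> = ennreal (exp (l * (g x - ?E))) * (\<integral>\<^sup>+a. ennreal (exp (l * (f (x(i := a)) - g x))) \<partial>M i)"
      using sec[OF x] by (intro nn_integral_cmult) measurable
    also have "\<dots> \<le> ennreal (exp (l * (g x - ?E))) * ennreal (exp (l\<^sup>2 * ((?m + c) - (?m - c))\<^sup>2 / 8))"
      unfolding g_def by (intro mult_left_mono h.Hoeffdings_lemma_nn_integral[OF l]) simp
    also have "l\<^sup>2 * ((?m + c) - (?m - c))\<^sup>2 / 8 = l\<^sup>2 * c\<^sup>2 / 2" by (simp add: power2_eq_square)
    finally show ?thesis by (simp only: mult.commute)
  qed
  have "(\<integral>\<^sup>+x. exp (l * (f x - ?E)) \<partial>PiM (insert i J) M)
      = (\<integral>\<^sup>+x. \<integral>\<^sup>+a. exp (l * (f (x(i := a)) - ?E)) \<partial>M i \<partial>PiM J M)"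
    using insert.hyps by (intro product_nn_integral_insert) auto
  also have "\<dots> \<le> (\<integral>\<^sup>+x. ennreal (exp (l\<^sup>2 * c\<^sup>2 / 2)) * ennreal (exp (l * (g x - ?E))) \<partial>PiM J M)"
    by (intro nn_integral_mono inner)
  also have "\<dots> = ennreal (exp (l\<^sup>2 * c\<^sup>2 / 2)) * (\<integral>\<^sup>+x. ennreal (exp (l * (g x - ?E))) \<partial>PiM J M)"
    by (intro nn_integral_cmult) measurable
  also have "\<dots> \<le> ennreal (exp (l\<^sup>2 * c\<^sup>2 / 2)) * ennreal (exp (l\<^sup>2 * c\<^sup>2 / 2 * card J))"
    unfolding Ef by (intro mult_left_mono insert.IH gm gB gc) auto
  also have "\<dots> = ennreal (exp (l\<^sup>2 * c\<^sup>2 / 2 * card (insert i J)))"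
    using insert.hyps by (simp add: ennreal_mult[symmetric] exp_add[symmetric] algebra_simps)
  finally show ?case .
qed

lemma (in product_prob_space) bounded_differences_upper_tail:
  fixes f :: "('i \<Rightarrow> 'a) \<Rightarrow> real"
  assumes J: "finite J" and c: "0 < c" and e: "0 < e" and ne: "J \<noteq> {}"
    and f [measurable]: "f \<in> borel_measurable (PiM J M)"
    and B: "\<And>x. x \<in> space (PiM J M) \<Longrightarrow> \<bar>f x\<bar> \<le> B"
    and d: "\<And>x i a. x \<in> space (PiM J M) \<Longrightarrow> i \<in> J \<Longrightarrow> a \<in> space (M i) \<Longrightarrow> \<bar>f (x(i := a)) - f x\<bar> \<le> c"
  shows "measure (PiM J M) {x \<in> space (PiM J M). e \<le> f x - (\<integral>x. f x \<partial>PiM J M)}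
    \<le> exp (- (e\<^sup>2 / (2 * c\<^sup>2 * card J)))"
proof -
  interpret J: prob_space "PiM J M" by (intro prob_space_PiM prob_space)
  let ?E = "\<integral>x. f x \<partial>PiM J M"
  \<comment> \<open>The minimiser of the Chernoff exponent
    \<open>- l * e + l\<^sup>2 * c\<^sup>2 / 2 * card J\<close>.\<close>
  define l where "l = e / (c\<^sup>2 * card J)"
  have cJ: "0 < real (card J)" using J ne by (simp add: card_gt_0_iff)
  have l: "0 < l" using cJ c e by (simp add: l_def)
  have "emeasure (PiM J M) {x \<in> space (PiM J M). e \<le> f x - ?E}
      = emeasure (PiM J M) {x \<in> space (PiM J M). 1 \<le> ennreal (exp (- l * e)) * ennreal (exp (l * (f x - ?E)))}"
  proof (intro arg_cong[of _ _ "emeasure _"] Collect_cong conj_cong refl)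
    fix x
    have "1 \<le> ennreal (exp (- l * e)) * ennreal (exp (l * (f x - ?E))) \<longleftrightarrow> 0 \<le> - l * e + l * (f x - ?E)"
      by (simp only: ennreal_mult[symmetric] exp_ge_zero exp_add[symmetric] ennreal_ge_1 one_le_exp_iff)
    moreover have "- l * e + l * (f x - ?E) = l * (f x - ?E - e)" by (simp add: right_diff_distrib)
    moreover have "0 \<le> l * (f x - ?E - e) \<longleftrightarrow> e \<le> f x - ?E" using l by (simp add: zero_le_mult_iff)
    ultimately show "e \<le> f x - ?E \<longleftrightarrow> 1 \<le> ennreal (exp (- l * e)) * ennreal (exp (l * (f x - ?E)))"
      by (simp only:)
  qed
  also have "\<dots> \<le> ennreal (exp (- l * e)) * (\<integral>\<^sup>+x. ennreal (exp (l * (f x - ?E))) * indicator (space (PiM J M)) x \<partial>PiM J M)"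
    using nn_integral_Markov_inequality[of "\<lambda>x. ennreal (exp (l * (f x - ?E)))" "space (PiM J M)" "PiM J M" "ennreal (exp (- l * e))"]
    by simp
  also have "(\<integral>\<^sup>+x. ennreal (exp (l * (f x - ?E))) * indicator (space (PiM J M)) x \<partial>PiM J M)
      = (\<integral>\<^sup>+x. ennreal (exp (l * (f x - ?E))) \<partial>PiM J M)"
    by (intro nn_integral_cong) simp
  also have "ennreal (exp (- l * e)) * \<dots> \<le> ennreal (exp (- l * e)) * ennreal (exp (l\<^sup>2 * c\<^sup>2 / 2 * card J))"
    by (intro mult_left_mono bounded_differences_mgf[OF J l _ f B d]) (use c in auto)
  also have "\<dots> = ennreal (exp (- l * e + l\<^sup>2 * c\<^sup>2 / 2 * card J))"
    by (simp add: ennreal_mult[symmetric] exp_add[symmetric])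
  also have "- l * e + l\<^sup>2 * c\<^sup>2 / 2 * card J = - (e\<^sup>2 / (2 * c\<^sup>2 * card J))"
    using cJ c by (simp add: l_def power2_eq_square field_simps)
  finally show ?thesis by (simp add: J.emeasure_eq_measure)
qed

lemma (in product_prob_space) bounded_differences_tail:
  fixes f :: "('i \<Rightarrow> 'a) \<Rightarrow> real"
  assumes J: "finite J" and c: "0 < c" and e: "0 < e" and ne: "J \<noteq> {}"
    and f [measurable]: "f \<in> borel_measurable (PiM J M)"
    and B: "\<And>x. x \<in> space (PiM J M) \<Longrightarrow> \<bar>f x\<bar> \<le> B"
    and d: "\<And>x i a. x \<in> space (PiM J M) \<Longrightarrow> i \<in> J \<Longrightarrow> a \<in> space (M i) \<Longrightarrow> \<bar>f (x(i := a)) - f x\<bar> \<le> c"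
  shows "measure (PiM J M) {x \<in> space (PiM J M). e \<le> \<bar>f x - (\<integral>x. f x \<partial>PiM J M)\<bar>}
    \<le> 2 * exp (- (e\<^sup>2 / (2 * c\<^sup>2 * card J)))"
proof -
  interpret J: prob_space "PiM J M" by (intro prob_space_PiM prob_space)
  let ?P = "PiM J M" and ?E = "\<integral>x. f x \<partial>PiM J M"
  \<comment> \<open>The lower tail of \<open>f\<close> is the upper tail of \<open>- f\<close>,
    which has the same bounded differences.\<close>
  have "{x \<in> space ?P. e \<le> \<bar>f x - ?E\<bar>} =
      {x \<in> space ?P. e \<le> f x - ?E} \<union> {x \<in> space ?P. e \<le> - f x - (\<integral>x. - f x \<partial>?P)}"
    by auto
  also have "measure ?P \<dots> \<le> measure ?P {x \<in> space ?P. e \<le> f x - ?E}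
      + measure ?P {x \<in> space ?P. e \<le> - f x - (\<integral>x. - f x \<partial>?P)}"
    by (intro measure_Un_le) measurable
  also have "\<dots> \<le> exp (- (e\<^sup>2 / (2 * c\<^sup>2 * card J))) + exp (- (e\<^sup>2 / (2 * c\<^sup>2 * card J)))"
    using d B by (intro add_mono bounded_differences_upper_tail[OF J c e ne, where B = B])
      (auto simp: abs_minus_commute)
  finally show ?thesis by simp
qed

text \<open>Lindeberg's replacement scheme. Hybrid products, with \<open>\<nu>\<close> in the first
  \<open>k\<close> places, interpolate between the two powers. Neighbouring hybrids differ in one
  factor, and Fubini reduces their difference to integrals over that coordinate with the others
  frozen.\<close>

lemma integral_PiM_replace:
  fixes F :: "(nat \<Rightarrow> 'a) \<Rightarrow> 'c::{banach, second_countable_topology}"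
  assumes mu: "prob_space \<mu>" and nu: "prob_space \<nu>" and sets: "sets \<mu> = sets \<nu>"
    and F: "F \<in> borel_measurable (PiM {..<n} (\<lambda>_. \<mu>))"
    and B: "\<And>x. x \<in> space (PiM {..<n} (\<lambda>_. \<mu>)) \<Longrightarrow> norm (F x) \<le> B"
    and d: "\<And>k x. k < n \<Longrightarrow> x \<in> space (PiM ({..<n} - {k}) (\<lambda>_. \<mu>)) \<Longrightarrow>
      norm ((\<integral>a. F (x(k := a)) \<partial>\<mu>) - (\<integral>a. F (x(k := a)) \<partial>\<nu>)) \<le> d"
  shows "norm ((\<integral>x. F x \<partial>PiM {..<n} (\<lambda>_. \<mu>)) - (\<integral>x. F x \<partial>PiM {..<n} (\<lambda>_. \<nu>))) \<le> n * d"
proof -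
  define L where "L k j = (if j < k then \<nu> else \<mu>)" for k j :: nat
  have Lp: "prob_space (L k j)" for k j using mu nu by (simp add: L_def)
  have Ls: "sets (L k j) = sets \<mu>" for k j using sets by (simp add: L_def)
  have Psets: "sets (PiM I (L k)) = sets (PiM I (\<lambda>_. \<mu>))" for I k
    by (intro sets_PiM_cong refl Ls)
  have Psp: "space (PiM I (L k)) = space (PiM I (\<lambda>_. \<mu>))" for I k
    using sets_eq_imp_space_eq[OF Psets] .
  have FL: "F \<in> borel_measurable (PiM {..<n} (L k))" for k
    using F measurable_cong_sets[OF Psets refl] by blast
  have PP: "prob_space (PiM I (L k))" for I k by (intro prob_space_PiM Lp)
  have FI: "integrable (PiM {..<n} (L k)) F" for k
    using FL B Psp[of "{..<n}" k]
    by (intro finite_measure.integrable_const_bound[OF prob_space.finite_measure[OF PP], of _ B]) auto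
  define I where "I k = (\<integral>x. F x \<partial>PiM {..<n} (L k))" for k
  have split: "I k' = (\<integral>x. (\<integral>a. F (x(k := a)) \<partial>L k' k) \<partial>PiM ({..<n} - {k}) (L k'))" if "k < n" for k k'
  proof -
    interpret product_sigma_finite "L k'"
      by (rule product_sigma_finite.intro) (rule prob_space_imp_sigma_finite[OF Lp])
    have "insert k ({..<n} - {k}) = {..<n}" using that by auto
    then show ?thesis
      unfolding I_def using product_integral_insert[of "{..<n} - {k}" k F] FI[of k'] by simp
  qed
  have step: "norm (I k - I (Suc k)) \<le> d" if k: "k < n" for k
  proof -
    let ?Q = "PiM ({..<n} - {k}) (L k)"
    interpret Q: prob_space ?Q by (rule PP)
    \<comment> \<open>The families \<open>L k\<close> and \<open>L (Suc k)\<close> disagree at index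
      \<open>k\<close> only, which has been removed.\<close>
    have eqQ: "PiM ({..<n} - {k}) (L (Suc k)) = ?Q"
      by (intro PiM_cong) (auto simp: L_def)
    have upd: "(\<lambda>(x, a). F (x(k := a))) \<in> borel_measurable (?Q \<Otimes>\<^sub>M L k' k)" for k'
    proof -
      have "(\<lambda>(x, a). x(k := a)) \<in> measurable (PiM ({..<n} - {k}) (L k') \<Otimes>\<^sub>M L k' k) (PiM (insert k ({..<n} - {k})) (L k'))"
        by (rule measurable_add_dim)
      moreover have "insert k ({..<n} - {k}) = {..<n}" using k by auto
      ultimately have "(\<lambda>(x, a). F (x(k := a))) \<in> borel_measurable (PiM ({..<n} - {k}) (L k') \<Otimes>\<^sub>M L k' k)"
        using measurable_compose[OF _ FL] by (simp add: split_beta')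
      moreover have "sets (PiM ({..<n} - {k}) (L k') \<Otimes>\<^sub>M L k' k) = sets (?Q \<Otimes>\<^sub>M L k' k)"
        by (intro sets_pair_measure_cong refl) (simp add: Psets)
      ultimately show ?thesis using measurable_cong_sets by blast
    qed
    have int: "integrable ?Q (\<lambda>x. \<integral>a. F (x(k := a)) \<partial>L k' k)" for k'
    proof (rule Q.integrable_const_bound[of _ B])
      interpret k': prob_space "L k' k" by (rule Lp)
      show "(\<lambda>x. \<integral>a. F (x(k := a)) \<partial>L k' k) \<in> borel_measurable ?Q"
        using upd by (rule k'.borel_measurable_lebesgue_integral)
      show "AE x in ?Q. norm (\<integral>a. F (x(k := a)) \<partial>L k' k) \<le> B"
      proof (rule AE_I2)
        fix x assume x: "x \<in> space ?Q"
        have b: "norm (F (x(k := a))) \<le> B" if "a \<in> space (L k' k)" for a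
        proof -
          have "a \<in> space (L k k)" using that sets_eq_imp_space_eq[OF Ls, of k' k] sets_eq_imp_space_eq[OF Ls, of k k] by simp
          from fun_upd_in_space_PiM[OF x this] have "x(k := a) \<in> space (PiM {..<n} (L k))"
            using k by (simp add: insert_absorb)
          then show ?thesis using B Psp[of "{..<n}" k] by simp
        qed
        have "norm (\<integral>a. F (x(k := a)) \<partial>L k' k) \<le> (\<integral>a. norm (F (x(k := a))) \<partial>L k' k)"
          by (rule integral_norm_bound)
        also have "\<dots> \<le> B"
          by (rule k'.integral_le_const)
             (use measurable_Pair2[OF upd x, of k'] b in \<open>auto intro!: k'.integrable_const_bound[of _ B]\<close>)
        finally show "norm (\<integral>a. F (x(k := a)) \<partial>L k' k) \<le> B" .
      qed
    qed
    have eq: "I k - I (Suc k) = (\<integral>x. (\<integral>a. F (x(k := a)) \<partial>L k k) - (\<integral>a. F (x(k := a)) \<partial>L (Suc k) k) \<partial>?Q)"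
      unfolding split[OF k, of k] split[OF k, of "Suc k"] eqQ
      by (rule Bochner_Integration.integral_diff[symmetric]) (rule int)+
    have "norm (I k - I (Suc k)) \<le> (\<integral>x. norm ((\<integral>a. F (x(k := a)) \<partial>L k k) - (\<integral>a. F (x(k := a)) \<partial>L (Suc k) k)) \<partial>?Q)"
      unfolding eq by (rule integral_norm_bound)
    also have "\<dots> \<le> d"
    proof (rule Q.integral_le_const)
      show "integrable ?Q (\<lambda>x. norm ((\<integral>a. F (x(k := a)) \<partial>L k k) - (\<integral>a. F (x(k := a)) \<partial>L (Suc k) k)))"
        by (rule integrable_norm[OF Bochner_Integration.integrable_diff[OF int int]])
      show "AE x in ?Q. norm ((\<integral>a. F (x(k := a)) \<partial>L k k) - (\<integral>a. F (x(k := a)) \<partial>L (Suc k) k)) \<le> d"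
      proof (rule AE_I2)
        fix x assume x: "x \<in> space ?Q"
        have L: "L k k = \<mu>" "L (Suc k) k = \<nu>" by (simp_all add: L_def)
        show "norm ((\<integral>a. F (x(k := a)) \<partial>L k k) - (\<integral>a. F (x(k := a)) \<partial>L (Suc k) k)) \<le> d"
          unfolding L by (rule d[OF k x[unfolded Psp]])
      qed
    qed
    finally show ?thesis .
  qed
  have "norm (I 0 - I k) \<le> k * d" if "k \<le> n" for k
    using that
  proof (induction k)
    case (Suc k)
    have "norm (I 0 - I (Suc k)) \<le> norm (I 0 - I k) + norm (I k - I (Suc k))"
      using norm_triangle_ineq[of "I 0 - I k" "I k - I (Suc k)"] by simp
    also have "\<dots> \<le> k * d + d" using Suc step[of k] by (intro add_mono) auto
    finally show ?case by (simp add: algebra_simps)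
  qed simp
  moreover have "I 0 = (\<integral>x. F x \<partial>PiM {..<n} (\<lambda>_. \<mu>))"
    unfolding I_def by (intro arg_cong2[of _ _ _ _ "integral\<^sup>L"] PiM_cong) (auto simp: L_def)
  moreover have "I n = (\<integral>x. F x \<partial>PiM {..<n} (\<lambda>_. \<nu>))"
    unfolding I_def by (intro arg_cong2[of _ _ _ _ "integral\<^sup>L"] PiM_cong) (auto simp: L_def)
  ultimately show ?thesis by (metis order_refl)
qed

section \<open>Concentration of quadratic forms\<close>

definition std_normal_moment :: "nat \<Rightarrow> real" where
  "std_normal_moment k = (\<integral>x. std_normal_density x * x ^ k \<partial>lborel)"

lemma std_normal_moment_simps:
  "std_normal_moment 0 = 1" "std_normal_moment (Suc 0) = 0" "std_normal_moment 2 = 1"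
  "std_normal_moment 3 = 0" "std_normal_moment 4 = 3"
  using integral_std_normal_moment_even[of 0] integral_std_normal_moment_odd[of 0]
    integral_std_normal_moment_even[of 1] integral_std_normal_moment_odd[of 1]
    integral_std_normal_moment_even[of 2]
  by (simp_all add: std_normal_moment_def fact_numeral numeral_eq_Suc)

lemma std_normal_moment_Suc:
  "std_normal_moment (Suc (Suc 0)) = 1" "std_normal_moment (Suc (Suc (Suc (Suc 0)))) = 3"
  using std_normal_moment_simps by (simp_all add: numeral_eq_Suc)

locale gaussian_vector = prob_space M for M :: "'a measure" +
  fixes p :: nat and w :: "'a \<Rightarrow> real vec"
  assumes std_normal: "std_normal_vec M p w"
begin

lemma w_measurable: "w \<in> measurable M (vec_borel p)"
  using std_normal by (simp add: std_normal_vec_def)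

text \<open>Independence factorises the expectation once a monomial is written as a product of
  powers over all coordinates. Products of two or four coordinates take this form with exponents
  counting coincidences of indices.\<close>

lemma expectation_monomial:
  "integrable M (\<lambda>\<omega>. \<Prod>m<p. w \<omega> $ m ^ e m)"
  "expectation (\<lambda>\<omega>. \<Prod>m<p. w \<omega> $ m ^ e m) = (\<Prod>m<p. std_normal_moment (e m))"
proof -
  have ind: "indep_vars (\<lambda>_. borel) (\<lambda>m \<omega>. w \<omega> $ m ^ e m) {..<p}"
  proof (rule indep_vars_compose2[where X = "\<lambda>i \<omega>. w \<omega> $ i" and Y = "\<lambda>m x. x ^ e m"])
    show "indep_vars (\<lambda>_. borel) (\<lambda>i \<omega>. w \<omega> $ i) {..<p}"
      using std_normal by (simp add: std_normal_vec_def)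
  qed measurable
  have d: "distributed M lborel (\<lambda>\<omega>. w \<omega> $ m) std_normal_density" if "m < p" for m
    using std_normal that by (simp add: std_normal_vec_def)
  have int: "integrable M (\<lambda>\<omega>. w \<omega> $ m ^ e m)" if "m < p" for m
    using distributed_integrable[OF d[OF that], of "\<lambda>x. x ^ e m"] integrable_std_normal_moment[of "e m"]
    by simp
  have E: "expectation (\<lambda>\<omega>. w \<omega> $ m ^ e m) = std_normal_moment (e m)" if "m < p" for m
    using distributed_integral[OF d[OF that], of "\<lambda>x. x ^ e m"] by (simp add: std_normal_moment_def)
  show "integrable M (\<lambda>\<omega>. \<Prod>m<p. w \<omega> $ m ^ e m)"
    by (rule indep_vars_integrable[OF _ ind]) (use int in auto)
  have "expectation (\<lambda>\<omega>. \<Prod>m<p. w \<omega> $ m ^ e m) = (\<Prod>m<p. expectation (\<lambda>\<omega>. w \<omega> $ m ^ e m))"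
    by (rule indep_vars_lebesgue_integral[OF _ ind]) (use int in auto)
  then show "expectation (\<lambda>\<omega>. \<Prod>m<p. w \<omega> $ m ^ e m) = (\<Prod>m<p. std_normal_moment (e m))"
    using E by simp
qed

lemma prod_power_of_bool: "i < p \<Longrightarrow> (\<Prod>m<p. (x m :: real) ^ of_bool (m = i)) = x i"
proof -
  assume "i < p"
  have "(\<Prod>m<p. x m ^ of_bool (m = i)) = (\<Prod>m<p. if m = i then x m else 1)"
    by (intro prod.cong) auto
  then show ?thesis using \<open>i < p\<close> by simp
qed

lemma prod_moment_support:
  assumes "S \<subseteq> {..<p}" "\<And>m. m \<notin> S \<Longrightarrow> e m = 0"
  shows "(\<Prod>m<p. std_normal_moment (e m)) = (\<Prod>m\<in>S. std_normal_moment (e m))"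
  using assms by (intro prod.mono_neutral_right) (auto simp: std_normal_moment_simps)

lemma moment2:
  assumes ij: "i < p" "j < p"
  shows "integrable M (\<lambda>\<omega>. w \<omega> $ i * w \<omega> $ j)"
    "expectation (\<lambda>\<omega>. w \<omega> $ i * w \<omega> $ j) = of_bool (i = j)"
proof -
  define e where "e m = (of_bool (m = i) + of_bool (m = j) :: nat)" for m
  have eq: "w \<omega> $ i * w \<omega> $ j = (\<Prod>m<p. w \<omega> $ m ^ e m)" for \<omega>
    using ij by (simp add: e_def power_add prod.distrib prod_power_of_bool)
  show "integrable M (\<lambda>\<omega>. w \<omega> $ i * w \<omega> $ j)" unfolding eq by (rule expectation_monomial)
  have "expectation (\<lambda>\<omega>. w \<omega> $ i * w \<omega> $ j) = (\<Prod>m\<in>{i, j}. std_normal_moment (e m))"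
    unfolding eq expectation_monomial using ij by (intro prod_moment_support) (auto simp: e_def)
  also have "\<dots> = of_bool (i = j)"
    by (cases "i = j") (simp_all add: e_def std_normal_moment_simps numeral_2_eq_2[symmetric])
  finally show "expectation (\<lambda>\<omega>. w \<omega> $ i * w \<omega> $ j) = of_bool (i = j)" .
qed

text \<open>Wick's formula for four Gaussian factors. An index of odd multiplicity makes the moment
  vanish; two distinct pairs give 1, from a single pairing; four equal indices give 3, from all
  three pairings.\<close>

lemma moment4:
  assumes ij: "i < p" "j < p" "k < p" "l < p"
  shows "integrable M (\<lambda>\<omega>. w \<omega> $ i * w \<omega> $ j * (w \<omega> $ k * w \<omega> $ l))"
    "expectation (\<lambda>\<omega>. w \<omega> $ i * w \<omega> $ j * (w \<omega> $ k * w \<omega> $ l)) =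
      of_bool (i = j) * of_bool (k = l) + of_bool (i = k) * of_bool (j = l) + of_bool (i = l) * of_bool (j = k)"
proof -
  define e where "e m = (of_bool (m = i) + of_bool (m = j) + (of_bool (m = k) + of_bool (m = l)) :: nat)" for m
  have eq: "w \<omega> $ i * w \<omega> $ j * (w \<omega> $ k * w \<omega> $ l) = (\<Prod>m<p. w \<omega> $ m ^ e m)" for \<omega>
    using ij by (simp add: e_def power_add prod.distrib prod_power_of_bool)
  show "integrable M (\<lambda>\<omega>. w \<omega> $ i * w \<omega> $ j * (w \<omega> $ k * w \<omega> $ l))" unfolding eq by (rule expectation_monomial)
  have "expectation (\<lambda>\<omega>. w \<omega> $ i * w \<omega> $ j * (w \<omega> $ k * w \<omega> $ l)) = (\<Prod>m\<in>{i, j, k, l}. std_normal_moment (e m))"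
    unfolding eq expectation_monomial using ij by (intro prod_moment_support) (auto simp: e_def)
  also have "\<dots> = of_bool (i = j) * of_bool (k = l) + of_bool (i = k) * of_bool (j = l) + of_bool (i = l) * of_bool (j = k)"
    by (cases "i = j"; cases "i = k"; cases "i = l"; cases "j = k"; cases "j = l"; cases "k = l")
       (simp_all add: e_def std_normal_moment_simps std_normal_moment_Suc insert_absorb)
  finally show "expectation (\<lambda>\<omega>. w \<omega> $ i * w \<omega> $ j * (w \<omega> $ k * w \<omega> $ l)) =
      of_bool (i = j) * of_bool (k = l) + of_bool (i = k) * of_bool (j = l) + of_bool (i = l) * of_bool (j = k)" .
qed

lemma quad_form_second_moment:
  assumes B: "B \<in> carrier_mat p p" "transpose_mat B = B"
  shows "integrable M (\<lambda>\<omega>. (w \<omega> \<bullet> (B *\<^sub>v w \<omega>) - mat_trace B)\<^sup>2)"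
    "expectation (\<lambda>\<omega>. (w \<omega> \<bullet> (B *\<^sub>v w \<omega>) - mat_trace B)\<^sup>2) = 2 * (\<Sum>i<p. \<Sum>j<p. (B $$ (i, j))\<^sup>2)"
proof -
  \<comment> \<open>Centred products, so that the centred form is the sum of
    \<open>B $$ (i, j) * u i j\<close>. The centring removes one of the three pairings from the
    covariance of \<open>u i j\<close> and \<open>u k l\<close>; by symmetry of \<open>B\<close> the
    other two contribute equally, which is the factor 2.\<close>
  define u where "u i j \<omega> = w \<omega> $ i * w \<omega> $ j - of_bool (i = j)" for i j \<omega>
  have X: "(w \<omega> \<bullet> (B *\<^sub>v w \<omega>) - mat_trace B)\<^sup>2 =
      (\<Sum>i<p. \<Sum>j<p. \<Sum>k<p. \<Sum>l<p. B $$ (i, j) * B $$ (k, l) * (u i j \<omega> * u k l \<omega>))"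
    if "\<omega> \<in> space M" for \<omega>
  proof -
    have c: "w \<omega> \<in> carrier_vec p" using measurable_vec_borelD(1)[OF w_measurable that] .
    have "mat_trace B = (\<Sum>i<p. \<Sum>j<p. B $$ (i, j) * of_bool (i = j))"
      using B(1) by (simp add: mat_trace_sum)
    then have "w \<omega> \<bullet> (B *\<^sub>v w \<omega>) - mat_trace B = (\<Sum>i<p. \<Sum>j<p.
        w \<omega> $ i * (B $$ (i, j) * w \<omega> $ j) - B $$ (i, j) * of_bool (i = j))"
      by (simp only: scalar_prod_mat_sum[OF B(1) c c] sum_subtractf)
    also have "\<dots> = (\<Sum>i<p. \<Sum>j<p. B $$ (i, j) * u i j \<omega>)"
      by (intro sum.cong refl) (simp add: u_def algebra_simps)
    finally have eq: "w \<omega> \<bullet> (B *\<^sub>v w \<omega>) - mat_trace B = (\<Sum>i<p. \<Sum>j<p. B $$ (i, j) * u i j \<omega>)" (is "_ = ?X") .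
    have "?X * ?X = (\<Sum>i<p. \<Sum>j<p. B $$ (i, j) * u i j \<omega> * ?X)"
      by (simp only: sum_distrib_right)
    also have "\<dots> = (\<Sum>i<p. \<Sum>j<p. \<Sum>k<p. \<Sum>l<p. B $$ (i, j) * B $$ (k, l) * (u i j \<omega> * u k l \<omega>))"
      unfolding sum_distrib_left by (intro sum.cong refl) (simp only: mult_ac)
    finally show ?thesis unfolding eq power2_eq_square .
  qed
  have uu: "u i j \<omega> * u k l \<omega> = w \<omega> $ i * w \<omega> $ j * (w \<omega> $ k * w \<omega> $ l) - of_bool (i = j) * (w \<omega> $ k * w \<omega> $ l)
      - of_bool (k = l) * (w \<omega> $ i * w \<omega> $ j) + of_bool (i = j) * of_bool (k = l)" for i j k l \<omega>
    by (simp add: u_def algebra_simps)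
  have int: "integrable M (\<lambda>\<omega>. u i j \<omega> * u k l \<omega>)" if "i < p" "j < p" "k < p" "l < p" for i j k l
    unfolding uu using that
    by (intro Bochner_Integration.integrable_add Bochner_Integration.integrable_diff integrable_mult_right moment2 moment4) auto
  have E: "expectation (\<lambda>\<omega>. u i j \<omega> * u k l \<omega>) = of_bool (i = k) * of_bool (j = l) + of_bool (i = l) * of_bool (j = k)"
    if "i < p" "j < p" "k < p" "l < p" for i j k l
    unfolding uu using that moment2 moment4
    by (simp add: prob_space)
  have hb: "has_bochner_integral M (\<lambda>\<omega>. \<Sum>i<p. \<Sum>j<p. \<Sum>k<p. \<Sum>l<p. B $$ (i, j) * B $$ (k, l) * (u i j \<omega> * u k l \<omega>))
      (\<Sum>i<p. \<Sum>j<p. \<Sum>k<p. \<Sum>l<p. B $$ (i, j) * B $$ (k, l) *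
        (of_bool (i = k) * of_bool (j = l) + of_bool (i = l) * of_bool (j = k)))"
    by (intro has_bochner_integral_sum has_bochner_integral_mult_right)
       (auto simp: has_bochner_integral_iff int E)
  then have "integrable M (\<lambda>\<omega>. \<Sum>i<p. \<Sum>j<p. \<Sum>k<p. \<Sum>l<p. B $$ (i, j) * B $$ (k, l) * (u i j \<omega> * u k l \<omega>))"
    by (rule integrable.intros)
  then show "integrable M (\<lambda>\<omega>. (w \<omega> \<bullet> (B *\<^sub>v w \<omega>) - mat_trace B)\<^sup>2)"
    by (rule Bochner_Integration.integrable_cong[THEN iffD1, rotated -1]) (simp_all add: X)
  have "expectation (\<lambda>\<omega>. (w \<omega> \<bullet> (B *\<^sub>v w \<omega>) - mat_trace B)\<^sup>2)
     = expectation (\<lambda>\<omega>. \<Sum>i<p. \<Sum>j<p. \<Sum>k<p. \<Sum>l<p. B $$ (i, j) * B $$ (k, l) * (u i j \<omega> * u k l \<omega>))"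
    by (intro Bochner_Integration.integral_cong refl X)
  also have "\<dots> = (\<Sum>i<p. \<Sum>j<p. \<Sum>k<p. \<Sum>l<p. B $$ (i, j) * B $$ (k, l) *
      (of_bool (i = k) * of_bool (j = l) + of_bool (i = l) * of_bool (j = k)))"
    by (rule has_bochner_integral_integral_eq[OF hb])
  also have "\<dots> = (\<Sum>i<p. \<Sum>j<p. B $$ (i, j) * B $$ (i, j) + B $$ (i, j) * B $$ (j, i))"
  proof (intro sum.cong refl)
    fix i j assume ij: "i \<in> {..<p}" "j \<in> {..<p}"
    have "(\<Sum>k<p. \<Sum>l<p. B $$ (i, j) * B $$ (k, l) * (of_bool (i = k) * of_bool (j = l) + of_bool (i = l) * of_bool (j = k)))
       = (\<Sum>k<p. \<Sum>l<p. (if j = l then if i = k then B $$ (i, j) * B $$ (k, l) else 0 else 0)) +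
         (\<Sum>k<p. \<Sum>l<p. (if i = l then if j = k then B $$ (i, j) * B $$ (k, l) else 0 else 0))"
      unfolding sum.distrib[symmetric] by (intro sum.cong refl) (auto simp: algebra_simps)
    also have "\<dots> = B $$ (i, j) * B $$ (i, j) + B $$ (i, j) * B $$ (j, i)"
      using ij by simp
    finally show "(\<Sum>k<p. \<Sum>l<p. B $$ (i, j) * B $$ (k, l) * (of_bool (i = k) * of_bool (j = l) + of_bool (i = l) * of_bool (j = k)))
       = B $$ (i, j) * B $$ (i, j) + B $$ (i, j) * B $$ (j, i)" .
  qed
  also have "\<dots> = (\<Sum>i<p. \<Sum>j<p. 2 * (B $$ (i, j))\<^sup>2)"
    using transpose_eqD[OF B(2,1)] by (intro sum.cong refl) (auto simp: power2_eq_square)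
  finally show "expectation (\<lambda>\<omega>. (w \<omega> \<bullet> (B *\<^sub>v w \<omega>) - mat_trace B)\<^sup>2) = 2 * (\<Sum>i<p. \<Sum>j<p. (B $$ (i, j))\<^sup>2)"
    by (simp add: sum_distrib_left)
qed

lemma quad_form_tail:
  assumes B: "B \<in> carrier_mat p p" "transpose_mat B = B" and t: "0 < t"
  shows "prob {\<omega> \<in> space M. t < \<bar>w \<omega> \<bullet> (B *\<^sub>v w \<omega>) - mat_trace B\<bar>} \<le> 2 * (\<Sum>i<p. \<Sum>j<p. (B $$ (i, j))\<^sup>2) / t\<^sup>2"
proof -
  let ?X = "\<lambda>\<omega>. w \<omega> \<bullet> (B *\<^sub>v w \<omega>) - mat_trace B"
  have [measurable]: "?X \<in> borel_measurable M"
    using measurable_quad_form[OF w_measurable B(1)] by measurable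
  have "prob {\<omega> \<in> space M. t < \<bar>?X \<omega>\<bar>} \<le> prob {\<omega> \<in> space M. t\<^sup>2 \<le> (?X \<omega>)\<^sup>2}"
    using t by (intro finite_measure_mono) (auto simp: abs_le_square_iff[symmetric])
  also have "\<dots> \<le> expectation (\<lambda>\<omega>. (?X \<omega>)\<^sup>2) / t\<^sup>2"
    using integral_Markov_inequality_measure[OF quad_form_second_moment(1)[OF B], of "space M" "t\<^sup>2"] t by simp
  finally show ?thesis unfolding quad_form_second_moment(2)[OF B] .
qed

end

section \<open>Frobenius bounds for matrices multiplied by a square root\<close>

lemma trace_mult_self_le:
  fixes X :: "real mat"
  assumes X: "X \<in> carrier_mat p p"
  shows "mat_trace (X * X) \<le> (\<Sum>i<p. \<Sum>j<p. (X $$ (i, j))\<^sup>2)"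
proof -
  have "2 * mat_trace (X * X) = (\<Sum>i<p. \<Sum>j<p. 2 * X $$ (i, j) * X $$ (j, i))"
    by (simp add: mat_trace_mult[OF X X] sum_distrib_left mult.assoc)
  also have "\<dots> \<le> (\<Sum>i<p. \<Sum>j<p. (X $$ (i, j))\<^sup>2 + (X $$ (j, i))\<^sup>2)"
    by (intro sum_mono sum_squares_bound)
  also have "\<dots> = (\<Sum>i<p. \<Sum>j<p. (X $$ (i, j))\<^sup>2) + (\<Sum>i<p. \<Sum>j<p. (X $$ (j, i))\<^sup>2)"
    by (simp add: sum.distrib)
  also have "(\<Sum>i<p. \<Sum>j<p. (X $$ (j, i))\<^sup>2) = (\<Sum>i<p. \<Sum>j<p. (X $$ (i, j))\<^sup>2)"
    by (rule sum.swap)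
  finally show ?thesis by simp
qed

text \<open>The squared Frobenius norm is the sum of the squared norms of the columns, and
  \<open>B\<close> acts on each column separately.\<close>

lemma frobenius_op_bounded_mult:
  fixes B S :: "real mat"
  assumes B: "op_bounded p B K" and S: "S \<in> carrier_mat p p"
  shows "(\<Sum>i<p. \<Sum>j<p. ((B * S) $$ (i, j))\<^sup>2) \<le> K\<^sup>2 * (\<Sum>i<p. \<Sum>j<p. (S $$ (i, j))\<^sup>2)"
proof -
  note Bc = op_boundedD[OF B]
  have fro: "(\<Sum>i<p. \<Sum>j<p. (X $$ (i, j))\<^sup>2) = (\<Sum>j<p. (vnorm (col X j))\<^sup>2)" if "X \<in> carrier_mat p p" for X :: "real mat"
    using that by (subst sum.swap) (auto simp: vnorm_square[of _ p] intro!: sum.cong)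
  have "(\<Sum>i<p. \<Sum>j<p. ((B * S) $$ (i, j))\<^sup>2) = (\<Sum>j<p. (vnorm (B *\<^sub>v col S j))\<^sup>2)"
    using Bc(1) S by (subst fro) (auto intro!: sum.cong simp: col_mult2[of _ p p _ p])
  also have "\<dots> \<le> (\<Sum>j<p. (K * vnorm (col S j))\<^sup>2)"
    using S by (intro sum_mono power_mono Bc(3)) auto
  also have "\<dots> = K\<^sup>2 * (\<Sum>i<p. \<Sum>j<p. (S $$ (i, j))\<^sup>2)"
    by (simp add: fro[OF S] power_mult_distrib sum_distrib_left)
  finally show ?thesis .
qed

lemma frobenius_sym:
  fixes S :: "real mat"
  assumes "S \<in> carrier_mat p p" "transpose_mat S = S"
  shows "(\<Sum>i<p. \<Sum>j<p. (S $$ (i, j))\<^sup>2) = mat_trace (S * S)"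
  unfolding mat_trace_mult[OF assms(1,1)]
  by (intro sum.cong refl) (auto simp: power2_eq_square transpose_eqD[OF assms(2,1)])

text \<open>The form of \<open>B\<close> at \<open>Q v\<close> is the form of \<open>Q B Q\<close>
  at \<open>v\<close>, which reduces a Gaussian vector with covariance \<open>S\<close> to a
  standard one. By cyclicity the squared Frobenius norm of \<open>Q B Q\<close> is the trace of the
  square of \<open>B S\<close>. It is at most the squared Frobenius norm of \<open>B S\<close>,
  hence controlled by the trace of \<open>S * S\<close>, the quantity in (A2).\<close>

lemma sandwich_frobenius:
  assumes S: "sym_psd_mat p S" and B: "op_bounded p B K" "transpose_mat B = B"
  defines "Q \<equiv> psd_sqrt S"
  shows "Q * B * Q \<in> carrier_mat p p" "transpose_mat (Q * B * Q) = Q * B * Q"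
    "mat_trace (Q * B * Q) = mat_trace (S * B)"
    "(\<Sum>i<p. \<Sum>j<p. ((Q * B * Q) $$ (i, j))\<^sup>2) \<le> K\<^sup>2 * mat_trace (S * S)"
    "v \<in> carrier_vec p \<Longrightarrow> (Q *\<^sub>v v) \<bullet> (B *\<^sub>v (Q *\<^sub>v v)) = v \<bullet> ((Q * B * Q) *\<^sub>v v)"
proof -
  note Q = psd_sqrt_eq(2,3)[OF S, folded Q_def]
  note Qc = sym_psd_matD(1,2)[OF Q(1)] and Sc = sym_psd_matD(1,2)[OF S] and Bc = op_boundedD(1)[OF B(1)]
  show C: "Q * B * Q \<in> carrier_mat p p" using Qc Bc by simp
  show Csym: "transpose_mat (Q * B * Q) = Q * B * Q"
    using Qc Bc B(2) by (simp add: transpose_mult[of _ p p _ p])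
  have "mat_trace (Q * B * Q) = mat_trace (Q * (Q * B))"
    using Qc Bc by (intro mat_trace_mult_comm[of _ p p]) auto
  also have "Q * (Q * B) = S * B" using Qc Bc by (simp add: Q(2)[symmetric])
  finally show "mat_trace (Q * B * Q) = mat_trace (S * B)" .
  have "(\<Sum>i<p. \<Sum>j<p. ((Q * B * Q) $$ (i, j))\<^sup>2) = mat_trace ((Q * B * Q) * (Q * B * Q))"
    by (rule frobenius_sym[OF C Csym])
  also have "(Q * B * Q) * (Q * B * Q) = Q * (B * (Q * Q) * B * Q)"
    using Qc Bc by (simp add: assoc_mult_mat[of _ p p _ p _ p])
  also have "mat_trace \<dots> = mat_trace ((B * (Q * Q) * B * Q) * Q)"
    using Qc Bc by (intro mat_trace_mult_comm[of _ p p]) auto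
  also have "(B * (Q * Q) * B * Q) * Q = (B * (Q * Q)) * (B * (Q * Q))"
    using Qc Bc by (simp add: assoc_mult_mat[of _ p p _ p _ p])
  also have "\<dots> = (B * S) * (B * S)" by (simp only: Q(2))
  also have "mat_trace \<dots> \<le> (\<Sum>i<p. \<Sum>j<p. ((B * S) $$ (i, j))\<^sup>2)"
    using Bc Sc by (intro trace_mult_self_le) auto
  also have "\<dots> \<le> K\<^sup>2 * (\<Sum>i<p. \<Sum>j<p. (S $$ (i, j))\<^sup>2)"
    by (rule frobenius_op_bounded_mult[OF B(1) Sc(1)])
  also have "\<dots> = K\<^sup>2 * mat_trace (S * S)" by (simp only: frobenius_sym[OF Sc])
  finally show "(\<Sum>i<p. \<Sum>j<p. ((Q * B * Q) $$ (i, j))\<^sup>2) \<le> K\<^sup>2 * mat_trace (S * S)" .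
  assume v: "v \<in> carrier_vec p"
  then have u: "Q *\<^sub>v v \<in> carrier_vec p" "B *\<^sub>v (Q *\<^sub>v v) \<in> carrier_vec p"
    using Qc Bc by auto
  have "(Q *\<^sub>v v) \<bullet> (B *\<^sub>v (Q *\<^sub>v v)) = v \<bullet> (Q *\<^sub>v (B *\<^sub>v (Q *\<^sub>v v)))"
    using transpose_vec_mult_scalar[OF Qc(1) u(2) v] Qc by simp
  also have "Q *\<^sub>v (B *\<^sub>v (Q *\<^sub>v v)) = (Q * B * Q) *\<^sub>v v"
    using Qc Bc v by (simp add: assoc_mult_mat_vec[of _ p p _ p])
  finally show "(Q *\<^sub>v v) \<bullet> (B *\<^sub>v (Q *\<^sub>v v)) = v \<bullet> ((Q * B * Q) *\<^sub>v v)" .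
qed

text \<open>The quantifier over \<open>B\<close> stands inside the eventuality: the threshold for
  \<open>p\<close> is the same for all matrices of norm at most \<open>K\<close>. This permits
  \<open>B\<close> to be a part of the resolvent of any frozen family of other columns.\<close>

definition quad_concentrated :: "(nat \<Rightarrow> 'a measure) \<Rightarrow> (nat \<Rightarrow> 'a \<Rightarrow> real vec) \<Rightarrow> (nat \<Rightarrow> 'a \<Rightarrow> real mat) \<Rightarrow> bool" where
  "quad_concentrated M x \<Sigma> \<longleftrightarrow> (\<forall>K>0. \<forall>\<epsilon>>0. \<forall>\<delta>>0. \<forall>\<^sub>F p in sequentially.
     \<forall>B. transpose_mat B = B \<longrightarrow> op_bounded p B K \<longrightarrow>
       measure (M p) {\<omega> \<in> space (M p). \<epsilon> * real p < \<bar>x p \<omega> \<bullet> (B *\<^sub>v x p \<omega>) - mat_trace (\<Sigma> p \<omega> * B)\<bar>} \<le> \<delta>)"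

section \<open>Uniformity in (A1)\<close>

lemma spectral_norm_le:
  assumes B: "op_bounded p B K"
  shows "spectral_norm B \<le> K"
proof -
  note Bc = op_boundedD[OF B]
  have d: "dim_col B = p" using Bc(1) by auto
  show ?thesis
    unfolding spectral_norm_def d
  proof (rule cSUP_least)
    have "0\<^sub>v p \<in> carrier_vec p \<and> vec_norm2 (0\<^sub>v p) \<le> 1" by (simp add: vec_norm2_def)
    then show "{v \<in> carrier_vec p. vec_norm2 v \<le> 1} \<noteq> {}" by blast
    fix v assume v: "v \<in> {v \<in> carrier_vec p. vec_norm2 v \<le> 1}"
    then have "vnorm (B *\<^sub>v v) \<le> K * vnorm v" using Bc(3)[of v] by simp
    also have "\<dots> \<le> K * 1" using v Bc(2) by (intro mult_left_mono) (auto simp: vec_norm2_eq_vnorm)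
    finally show "vec_norm2 (B *\<^sub>v v) \<le> K" by (simp add: vec_norm2_eq_vnorm)
  qed
qed

text \<open>Cauchy-Schwarz gives
  \<open>\<bar>v \<bullet> B v\<bar> \<le> K * (v \<bullet> v)\<close>, so adding \<open>K\<close>
  times the identity makes the form non-negative at the cost of doubling the norm bound.\<close>

lemma shift_psd:
  assumes B: "op_bounded p B K" "transpose_mat B = B"
  shows "sym_psd_mat p (B + K \<cdot>\<^sub>m 1\<^sub>m p)" "spectral_norm (B + K \<cdot>\<^sub>m 1\<^sub>m p) \<le> 2 * K"
    "sym_psd_mat p (K \<cdot>\<^sub>m 1\<^sub>m p)" "spectral_norm (K \<cdot>\<^sub>m 1\<^sub>m p) \<le> K"
proof -
  note Bc = op_boundedD[OF B(1)]
  have 1: "op_bounded p (K \<cdot>\<^sub>m 1\<^sub>m p) K"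
    using op_bounded_smult[OF op_bounded_one, of p K] Bc(2) by simp
  then show "spectral_norm (K \<cdot>\<^sub>m 1\<^sub>m p) \<le> K" by (rule spectral_norm_le)
  show "spectral_norm (B + K \<cdot>\<^sub>m 1\<^sub>m p) \<le> 2 * K"
    using spectral_norm_le[OF op_bounded_add[OF B(1) 1]] by simp
  have I: "v \<bullet> ((K \<cdot>\<^sub>m 1\<^sub>m p) *\<^sub>v v) = K * (v \<bullet> v)" if "v \<in> carrier_vec p" for v
    using that by (simp add: smult_mat_mult_vec[of _ p p])
  have nn: "0 \<le> v \<bullet> v" for v :: "real vec"
    by (simp add: vnorm_square_real[of v "dim_vec v", symmetric])
  show "sym_psd_mat p (K \<cdot>\<^sub>m 1\<^sub>m p)"
    using I nn Bc(2) by (auto simp: sym_psd_mat_def transpose_smult)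
  have "0 \<le> v \<bullet> ((B + K \<cdot>\<^sub>m 1\<^sub>m p) *\<^sub>v v)" if v: "v \<in> carrier_vec p" for v
  proof -
    have c: "B *\<^sub>v v \<in> carrier_vec p" "(K \<cdot>\<^sub>m 1\<^sub>m p) *\<^sub>v v \<in> carrier_vec p"
      using Bc v by (auto intro!: mult_mat_vec_carrier)
    have "(B + K \<cdot>\<^sub>m 1\<^sub>m p) *\<^sub>v v = B *\<^sub>v v + (K \<cdot>\<^sub>m 1\<^sub>m p) *\<^sub>v v"
      using Bc v by (intro add_mult_distrib_mat_vec[of _ p p]) auto
    then have "v \<bullet> ((B + K \<cdot>\<^sub>m 1\<^sub>m p) *\<^sub>v v) = v \<bullet> (B *\<^sub>v v) + K * (v \<bullet> v)"
      using scalar_prod_add_distrib[OF v c] I[OF v] by simp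
    moreover have "\<bar>v \<bullet> (B *\<^sub>v v)\<bar> \<le> vnorm v * (K * vnorm v)"
      using norm_scalar_prod_le[OF v c(1)] mult_left_mono[OF Bc(3)[OF v] vnorm_nonneg[of v]] by simp
    ultimately show ?thesis using vnorm_square_real[OF v] by (simp add: power2_eq_square abs_le_iff algebra_simps)
  qed
  then show "sym_psd_mat p (B + K \<cdot>\<^sub>m 1\<^sub>m p)"
    using Bc B(2) by (auto simp: sym_psd_mat_def transpose_smult transpose_add[of _ p p])
qed

text \<open>The quantifier over sequences \<open>A p\<close> in (A1) yields uniformity: choose \<open>A p\<close> among the worst
  matrices. Symmetric matrices are differences of positive semi-definite ones.\<close>

lemma quad_form_uniform:
  fixes M :: "nat \<Rightarrow> 'a measure"
  assumes A1: "\<And>A :: nat \<Rightarrow> real mat.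
      (\<forall>p\<ge>1. sym_psd_mat p (A p)) \<Longrightarrow> (\<exists>C. \<forall>p\<ge>1. spectral_norm (A p) \<le> C) \<Longrightarrow>
      tendsto_0_in_prob M (\<lambda>p \<omega>. (y p \<omega> \<bullet> (A p *\<^sub>v y p \<omega>) - mat_trace (\<Sigma> p \<omega> * A p)) / real p)"
    and e: "0 < \<epsilon>" and d: "0 < \<delta>" and C: "0 \<le> C"
  shows "\<forall>\<^sub>F p in sequentially. \<forall>A. sym_psd_mat p A \<longrightarrow> spectral_norm A \<le> C \<longrightarrow>
     measure (M p) {\<omega> \<in> space (M p). \<bar>(y p \<omega> \<bullet> (A *\<^sub>v y p \<omega>) - mat_trace (\<Sigma> p \<omega> * A)) / real p\<bar> > \<epsilon>} < \<delta>"
proof -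
  define good where "good p A \<longleftrightarrow>
    measure (M p) {\<omega> \<in> space (M p). \<bar>(y p \<omega> \<bullet> (A *\<^sub>v y p \<omega>) - mat_trace (\<Sigma> p \<omega> * A)) / real p\<bar> > \<epsilon>} < \<delta>" for p A
  define adm where "adm p A \<longleftrightarrow> sym_psd_mat p A \<and> spectral_norm A \<le> C" for p A
  have adm0: "adm p (0\<^sub>m p p)" for p
  proof -
    have "0 \<le> v \<bullet> (0\<^sub>m p p *\<^sub>v v)" if "v \<in> carrier_vec p" for v :: "real vec"
      using that by (simp add: scalar_prod_mat_sum[of _ p])
    moreover have "spectral_norm (0\<^sub>m p p) \<le> C"
      using spectral_norm_le[OF op_bounded_zero, of p] C by simp
    ultimately show ?thesis by (simp add: adm_def sym_psd_mat_def)
  qed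
  \<comment> \<open>A counterexample at \<open>p\<close> if there is one, and otherwise the zero
    matrix as an admissible default. Thus if \<open>A p\<close> is good, so are all admissible
    matrices at \<open>p\<close>.\<close>
  define A where "A p = (if \<forall>A. adm p A \<longrightarrow> good p A then 0\<^sub>m p p else (SOME A. adm p A \<and> \<not> good p A))" for p
  have A: "adm p (A p) \<and> (good p (A p) \<longrightarrow> (\<forall>A. adm p A \<longrightarrow> good p A))" for p
  proof (cases "\<forall>A. adm p A \<longrightarrow> good p A")
    case False
    then have "\<exists>A. adm p A \<and> \<not> good p A" by blast
    moreover have "A p = (SOME A. adm p A \<and> \<not> good p A)"
      unfolding A_def using False by (rule if_not_P)
    ultimately have "adm p (A p) \<and> \<not> good p (A p)" using someI_ex by metis
    then show ?thesis by blast
  qed (simp add: A_def adm0)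
  have "tendsto_0_in_prob M (\<lambda>p \<omega>. (y p \<omega> \<bullet> (A p *\<^sub>v y p \<omega>) - mat_trace (\<Sigma> p \<omega> * A p)) / real p)"
    using A by (intro A1) (auto simp: adm_def)
  then have "(\<lambda>p. measure (M p) {\<omega> \<in> space (M p).
      \<bar>(y p \<omega> \<bullet> (A p *\<^sub>v y p \<omega>) - mat_trace (\<Sigma> p \<omega> * A p)) / real p\<bar> > \<epsilon>}) \<longlonglongrightarrow> 0"
    using e by (simp add: tendsto_0_in_prob_def)
  from order_tendstoD(2)[OF this d] have "\<forall>\<^sub>F p in sequentially. good p (A p)"
    by (simp add: good_def)
  then show ?thesis
    by (rule eventually_mono) (use A in \<open>auto simp: good_def adm_def\<close>)
qed

lemma quad_concentrated_of_psd:
  fixes M :: "nat \<Rightarrow> 'a measure"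
  assumes pr: "\<And>p. 1 \<le> p \<Longrightarrow> prob_space (M p)"
    and y: "\<And>p. 1 \<le> p \<Longrightarrow> y p \<in> measurable (M p) (vec_borel p)"
    and S: "\<And>p. 1 \<le> p \<Longrightarrow> \<Sigma> p \<in> measurable (M p) (mat_borel p p)"
    and A1: "\<And>A :: nat \<Rightarrow> real mat.
      (\<forall>p\<ge>1. sym_psd_mat p (A p)) \<Longrightarrow> (\<exists>C. \<forall>p\<ge>1. spectral_norm (A p) \<le> C) \<Longrightarrow>
      tendsto_0_in_prob M (\<lambda>p \<omega>. (y p \<omega> \<bullet> (A p *\<^sub>v y p \<omega>) - mat_trace (\<Sigma> p \<omega> * A p)) / real p)"
  shows "quad_concentrated M y \<Sigma>"
  unfolding quad_concentrated_def
proof (intro allI impI)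
  fix K \<epsilon> \<delta> :: real assume K: "0 < K" and e: "0 < \<epsilon>" and d: "0 < \<delta>"
  define D where "D p \<omega> A = y p \<omega> \<bullet> (A *\<^sub>v y p \<omega>) - mat_trace (\<Sigma> p \<omega> * A)" for p \<omega> A
  \<comment> \<open>The deviation for \<open>B\<close> is a difference of two deviations for
    positive semi-definite matrices, both of norm at most \<open>2 * K\<close>; each receives half
    of the tolerance and half of the probability.\<close>
  from e d have "0 < \<epsilon> / 2" "0 < \<delta> / 2" by auto
  from quad_form_uniform[OF A1 this, of "2 * K"] K
  have "\<forall>\<^sub>F p in sequentially. \<forall>A. sym_psd_mat p A \<longrightarrow> spectral_norm A \<le> 2 * K \<longrightarrow>
     measure (M p) {\<omega> \<in> space (M p). \<bar>D p \<omega> A / real p\<bar> > \<epsilon> / 2} < \<delta> / 2" (is "\<forall>\<^sub>F p in _. ?P p")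
    by (simp add: D_def)
  with eventually_ge_at_top[of 1]
  show "\<forall>\<^sub>F p in sequentially. \<forall>B. transpose_mat B = B \<longrightarrow> op_bounded p B K \<longrightarrow>
       measure (M p) {\<omega> \<in> space (M p). \<epsilon> * real p < \<bar>y p \<omega> \<bullet> (B *\<^sub>v y p \<omega>) - mat_trace (\<Sigma> p \<omega> * B)\<bar>} \<le> \<delta>"
    unfolding D_def[symmetric]
  proof eventually_elim
    case (elim p)
    interpret prob_space "M p" using pr elim by simp
    note yp = y[OF elim(1)] and Sp = S[OF elim(1)]
    show ?case
    proof (intro allI impI)
      fix B :: "real mat" assume B: "transpose_mat B = B" "op_bounded p B K"
      note Bc = op_boundedD(1)[OF B(2)]
      define I where "I = K \<cdot>\<^sub>m (1\<^sub>m p :: real mat)"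
      have I: "I \<in> carrier_mat p p" by (simp add: I_def)
      note sh = shift_psd[OF B(2,1), folded I_def]
      have split: "D p \<omega> B = D p \<omega> (B + I) - D p \<omega> I" if w: "\<omega> \<in> space (M p)" for \<omega>
      proof -
        have c: "y p \<omega> \<in> carrier_vec p" "\<Sigma> p \<omega> \<in> carrier_mat p p"
          using measurable_vec_borelD(1)[OF yp w] measurable_mat_borelD(1)[OF Sp w] by auto
        have "(B + I) *\<^sub>v y p \<omega> = B *\<^sub>v y p \<omega> + I *\<^sub>v y p \<omega>" "\<Sigma> p \<omega> * (B + I) = \<Sigma> p \<omega> * B + \<Sigma> p \<omega> * I"
          using c Bc I by (simp_all add: add_mult_distrib_mat_vec[of _ p p] mult_add_distrib_mat[of _ p p _ p])
        moreover have "y p \<omega> \<bullet> (B *\<^sub>v y p \<omega> + I *\<^sub>v y p \<omega>) = y p \<omega> \<bullet> (B *\<^sub>v y p \<omega>) + y p \<omega> \<bullet> (I *\<^sub>v y p \<omega>)"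
          using c Bc I by (intro scalar_prod_add_distrib[of _ p]) auto
        moreover have "mat_trace (\<Sigma> p \<omega> * B + \<Sigma> p \<omega> * I) = mat_trace (\<Sigma> p \<omega> * B) + mat_trace (\<Sigma> p \<omega> * I)"
          using c Bc I by (intro mat_trace_add[of _ p]) auto
        ultimately show ?thesis by (simp add: D_def)
      qed
      have Dm [measurable]: "(\<lambda>\<omega>. D p \<omega> A) \<in> borel_measurable (M p)" if "A \<in> carrier_mat p p" for A
        unfolding D_def using measurable_quad_form[OF yp that] measurable_trace_mult[OF Sp that] by measurable
      let ?E = "\<lambda>A. {\<omega> \<in> space (M p). \<bar>D p \<omega> A / real p\<bar> > \<epsilon> / 2}"
      have E: "?E (B + I) \<in> events" "?E I \<in> events"
        using Dm[of "B + I"] Dm[OF I] Bc I by auto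
      have sub: "{\<omega> \<in> space (M p). \<epsilon> * real p < \<bar>D p \<omega> B\<bar>} \<subseteq> ?E (B + I) \<union> ?E I"
      proof (rule subsetI, rule ccontr)
        fix \<omega> assume w: "\<omega> \<in> {\<omega> \<in> space (M p). \<epsilon> * real p < \<bar>D p \<omega> B\<bar>}" and "\<omega> \<notin> ?E (B + I) \<union> ?E I"
        then have "\<bar>D p \<omega> (B + I)\<bar> \<le> \<epsilon> / 2 * real p" "\<bar>D p \<omega> I\<bar> \<le> \<epsilon> / 2 * real p"
          using elim(1) by (auto simp: field_simps)
        with split[of \<omega>] w show False by auto
      qed
      have "prob {\<omega> \<in> space (M p). \<epsilon> * real p < \<bar>D p \<omega> B\<bar>} \<le> prob (?E (B + I) \<union> ?E I)"
        using E by (intro finite_measure_mono sub) auto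
      also have "\<dots> \<le> prob (?E (B + I)) + prob (?E I)" using E by (rule measure_Un_le)
      also have "\<dots> \<le> \<delta> / 2 + \<delta> / 2"
        using elim(2) sh K by (intro add_mono less_imp_le) auto
      finally show "prob {\<omega> \<in> space (M p). \<epsilon> * real p < \<bar>D p \<omega> B\<bar>} \<le> \<delta>" by simp
    qed
  qed
qed

text \<open>The first component is \<open>\<omega>\<close>, observed through the \<open>\<sigma>\<close>-algebra generated by \<open>S\<close>, instead of \<open>S \<omega>\<close>:
  \<^const>\<open>psd_sqrt\<close> is unspecified, hence not known to be measurable, on matrices that are not positive
  semi-definite.\<close>

lemma (in prob_space) indep_rv_joint:
  assumes ind: "indep_rv M SS S T w"
  defines "F \<equiv> vimage_algebra (space M) S SS"
  shows "distr M (F \<Otimes>\<^sub>M T) (\<lambda>\<omega>. (\<omega>, w \<omega>)) = distr M F (\<lambda>\<omega>. \<omega>) \<Otimes>\<^sub>M distr M T w"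
proof -
  have Sm: "S \<in> measurable M SS" and wm: "w \<in> measurable M T"
    and si: "indep_set {S -` A \<inter> space M | A. A \<in> sets SS} {w -` B \<inter> space M | B. B \<in> sets T}"
    using ind by (auto simp: indep_rv_def)
  have idm: "(\<lambda>\<omega>. \<omega>) \<in> measurable M F"
    unfolding F_def using Sm by (intro measurable_vimage_algebra2) auto
  interpret A: prob_space "distr M F (\<lambda>\<omega>. \<omega>)" by (rule prob_space_distr[OF idm])
  interpret B: prob_space "distr M T w" by (rule prob_space_distr[OF wm])
  have pm: "(\<lambda>\<omega>. (\<omega>, w \<omega>)) \<in> measurable M (F \<Otimes>\<^sub>M T)" using idm wm by measurable
  show ?thesis
  proof (rule pair_measure_eqI[symmetric])
    show "sigma_finite_measure (distr M F (\<lambda>\<omega>. \<omega>))" "sigma_finite_measure (distr M T w)" by unfold_locales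
    show "sets (distr M F (\<lambda>\<omega>. \<omega>) \<Otimes>\<^sub>M distr M T w) = sets (distr M (F \<Otimes>\<^sub>M T) (\<lambda>\<omega>. (\<omega>, w \<omega>)))"
      by (simp cong: sets_pair_measure_cong)
    fix A B assume AB: "A \<in> sets (distr M F (\<lambda>\<omega>. \<omega>))" "B \<in> sets (distr M T w)"
    then have AF: "A \<in> sets F" and BT: "B \<in> sets T" by auto
    obtain A' where A': "A' \<in> sets SS" "A = S -` A' \<inter> space M"
      using AF Sm unfolding F_def by (subst (asm) sets_vimage_algebra2) (auto simp: measurable_space)
    have "emeasure (distr M F (\<lambda>\<omega>. \<omega>)) A * emeasure (distr M T w) B = ennreal (prob A * prob (w -` B \<inter> space M))"
      using AF BT A' emeasure_eq_measure
      by (simp add: emeasure_distr[OF idm] emeasure_distr[OF wm] ennreal_mult Int_absorb2)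
    also have "prob A * prob (w -` B \<inter> space M) = prob (A \<inter> (w -` B \<inter> space M))"
    proof (rule indep_setD[OF si, symmetric])
      show "A \<in> {S -` A \<inter> space M |A. A \<in> sets SS}" using A' by blast
      show "w -` B \<inter> space M \<in> {w -` B \<inter> space M |B. B \<in> sets T}" using BT by blast
    qed
    also have "A \<inter> (w -` B \<inter> space M) = (\<lambda>\<omega>. (\<omega>, w \<omega>)) -` (A \<times> B) \<inter> space M" by auto
    also have "ennreal (prob \<dots>) = emeasure (distr M (F \<Otimes>\<^sub>M T) (\<lambda>\<omega>. (\<omega>, w \<omega>))) (A \<times> B)"
      using AF BT by (simp add: emeasure_distr[OF pm] emeasure_eq_measure)
    finally show "emeasure (distr M F (\<lambda>\<omega>. \<omega>)) A * emeasure (distr M T w) B =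
        emeasure (distr M (F \<Otimes>\<^sub>M T) (\<lambda>\<omega>. (\<omega>, w \<omega>))) (A \<times> B)" .
  qed
qed

text \<open>Conditioning on \<open>S\<close>, carried out as Fubini for the product law of
  \<open>\<omega>\<close> and \<open>w\<close>. For a frozen \<open>\<omega>\<close> where the trace
  of \<open>S * S\<close> is at most \<open>s\<close>, Chebyshev's inequality applies to the form of
  \<open>Q B Q\<close> at the standard normal vector. All other \<open>\<omega>\<close> are counted
  with their full probability.\<close>

lemma (in gaussian_vector) mixture_quad_form_tail:
  assumes Sm: "S \<in> measurable M (mat_borel p p)"
    and psd: "\<And>\<omega>. \<omega> \<in> space M \<Longrightarrow> sym_psd_mat p (S \<omega>)"
    and ind: "indep_rv M (mat_borel p p) S (vec_borel p) w"
    and B: "op_bounded p B K" "transpose_mat B = B" and t: "0 < t" and s: "0 \<le> s"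
  shows "prob {\<omega> \<in> space M. t < \<bar>(psd_sqrt (S \<omega>) *\<^sub>v w \<omega>) \<bullet> (B *\<^sub>v (psd_sqrt (S \<omega>) *\<^sub>v w \<omega>)) - mat_trace (S \<omega> * B)\<bar>}
    \<le> prob {\<omega> \<in> space M. s < mat_trace (S \<omega> * S \<omega>)} + 2 * K\<^sup>2 * s / t\<^sup>2"
proof -
  define F where "F = vimage_algebra (space M) S (mat_borel p p)"
  note wm = w_measurable
  have spF [simp]: "space F = space M" by (simp add: F_def)
  have idm: "(\<lambda>\<omega>. \<omega>) \<in> measurable M F"
    unfolding F_def using Sm by (intro measurable_vimage_algebra2) auto
  have SF: "S \<in> measurable F (mat_borel p p)"
    unfolding F_def using measurable_space[OF Sm] by (intro measurable_vimage_algebra1) auto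
  let ?N = "distr M F (\<lambda>\<omega>. \<omega>)" and ?W = "distr M (vec_borel p) w"
  interpret N: prob_space ?N by (rule prob_space_distr[OF idm])
  interpret W: prob_space ?W by (rule prob_space_distr[OF wm])
  define Q where "Q \<omega> = psd_sqrt (S \<omega>)" for \<omega>
  define X where "X \<omega> v = (Q \<omega> *\<^sub>v v) \<bullet> (B *\<^sub>v (Q \<omega> *\<^sub>v v)) - mat_trace (S \<omega> * B)" for \<omega> v
  let ?P = "F \<Otimes>\<^sub>M vec_borel p"
  have SP: "(\<lambda>x. S (fst x)) \<in> measurable ?P (mat_borel p p)"
    using measurable_compose[OF measurable_fst SF] .
  have Xm [measurable]: "(\<lambda>x. X (fst x) (snd x)) \<in> borel_measurable ?P"
    unfolding X_def Q_def
  proof (intro borel_measurable_diff)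
    have "(\<lambda>x. psd_sqrt (S (fst x)) *\<^sub>v snd x) \<in> measurable ?P (vec_borel p)"
      using psd by (intro measurable_psd_sqrt_mult_vec[OF SP] measurable_snd) (auto simp: space_pair_measure)
    from measurable_quad_form[OF this op_boundedD(1)[OF B(1)]]
    show "(\<lambda>x. (psd_sqrt (S (fst x)) *\<^sub>v snd x) \<bullet> (B *\<^sub>v (psd_sqrt (S (fst x)) *\<^sub>v snd x))) \<in> borel_measurable ?P" .
    show "(\<lambda>x. mat_trace (S (fst x) * B)) \<in> borel_measurable ?P"
      by (rule measurable_trace_mult[OF SP op_boundedD(1)[OF B(1)]])
  qed
  define D where "D = {x \<in> space ?P. t < \<bar>X (fst x) (snd x)\<bar>}"
  have D: "D \<in> sets ?P" unfolding D_def by measurable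
  define G where "G = {\<omega> \<in> space M. s < mat_trace (S \<omega> * S \<omega>)}"
  have trm: "(\<lambda>\<omega>. mat_trace (S \<omega> * S \<omega>)) \<in> borel_measurable N'" if N': "S \<in> measurable N' (mat_borel p p)" for N'
  proof -
    have "(\<lambda>\<omega>. \<Sum>i<p. \<Sum>j<p. S \<omega> $$ (i, j) * S \<omega> $$ (j, i)) \<in> borel_measurable N'"
      by (intro borel_measurable_sum borel_measurable_times) (auto intro: measurable_mat_borelD(2)[OF N'])
    then show ?thesis
      by (rule measurable_cong[THEN iffD1, rotated])
         (use measurable_mat_borelD(1)[OF N'] in \<open>auto simp: mat_trace_mult[of _ p p]\<close>)
  qed
  have G: "G \<in> sets F" unfolding G_def using trm[OF SF] by (simp flip: spF)
  have cond: "emeasure ?W (Pair \<omega> -` D) \<le> indicator G \<omega> + ennreal (2 * K\<^sup>2 * s / t\<^sup>2)" if w: "\<omega> \<in> space M" for \<omega>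
  proof (cases "\<omega> \<in> G")
    case True
    then show ?thesis using W.emeasure_le_1[of "Pair \<omega> -` D"] by (auto intro: order_trans)
  next
    case False
    then have sw: "mat_trace (S \<omega> * S \<omega>) \<le> s" using w by (auto simp: G_def)
    note C = sandwich_frobenius[OF psd[OF w] B, folded Q_def]
    let ?C = "Q \<omega> * B * Q \<omega>"
    have "emeasure ?W (Pair \<omega> -` D) = emeasure M (w -` (Pair \<omega> -` D) \<inter> space M)"
      using sets_Pair1[OF D] by (simp add: emeasure_distr[OF wm])
    also have "w -` (Pair \<omega> -` D) \<inter> space M = {\<omega>' \<in> space M. t < \<bar>w \<omega>' \<bullet> (?C *\<^sub>v w \<omega>') - mat_trace ?C\<bar>}"
      using measurable_vec_borelD(1)[OF wm] w
      by (auto simp: D_def X_def space_pair_measure C(3) C(5))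
    also have "emeasure M \<dots> \<le> ennreal (2 * (\<Sum>i<p. \<Sum>j<p. (?C $$ (i, j))\<^sup>2) / t\<^sup>2)"
      unfolding emeasure_eq_measure by (rule ennreal_leI[OF quad_form_tail[OF C(1,2) t]])
    also have "\<dots> \<le> ennreal (2 * K\<^sup>2 * s / t\<^sup>2)"
    proof (intro ennreal_leI divide_right_mono)
      have "K\<^sup>2 * mat_trace (S \<omega> * S \<omega>) \<le> K\<^sup>2 * s" using sw by (intro mult_left_mono) auto
      then show "2 * (\<Sum>i<p. \<Sum>j<p. (?C $$ (i, j))\<^sup>2) \<le> 2 * K\<^sup>2 * s" using C(4) by linarith
    qed simp
    finally show ?thesis using False by simp
  qed
  have pm: "(\<lambda>\<omega>. (\<omega>, w \<omega>)) \<in> measurable M ?P" using idm wm by measurable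
  have "emeasure M ((\<lambda>\<omega>. (\<omega>, w \<omega>)) -` D \<inter> space M) = emeasure (?N \<Otimes>\<^sub>M ?W) D"
    unfolding indep_rv_joint[OF ind, folded F_def, symmetric] using D by (simp add: emeasure_distr[OF pm])
  also have "\<dots> = (\<integral>\<^sup>+\<omega>. emeasure ?W (Pair \<omega> -` D) \<partial>?N)"
  proof (rule W.emeasure_pair_measure_alt)
    show "D \<in> sets (?N \<Otimes>\<^sub>M ?W)" using D by (simp cong: sets_pair_measure_cong)
  qed
  also have "\<dots> \<le> (\<integral>\<^sup>+\<omega>. indicator G \<omega> + ennreal (2 * K\<^sup>2 * s / t\<^sup>2) \<partial>?N)"
    by (intro nn_integral_mono cond) simp
  also have "\<dots> = emeasure ?N G + ennreal (2 * K\<^sup>2 * s / t\<^sup>2)"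
    using G by (subst nn_integral_add) (auto simp: N.emeasure_space_1[simplified])
  also have "emeasure ?N G = ennreal (prob G)"
    using G by (simp add: emeasure_distr[OF idm] emeasure_eq_measure Int_absorb2 G_def)
  also have "ennreal (prob G) + ennreal (2 * K\<^sup>2 * s / t\<^sup>2) = ennreal (prob G + 2 * K\<^sup>2 * s / t\<^sup>2)"
    using s by (intro ennreal_plus[symmetric]) auto
  also have "(\<lambda>\<omega>. (\<omega>, w \<omega>)) -` D \<inter> space M = {\<omega> \<in> space M. t < \<bar>X \<omega> (w \<omega>)\<bar>}"
    using measurable_vec_borelD(1)[OF wm] by (auto simp: D_def space_pair_measure)
  finally have "prob {\<omega> \<in> space M. t < \<bar>X \<omega> (w \<omega>)\<bar>} \<le> prob G + 2 * K\<^sup>2 * s / t\<^sup>2"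
    unfolding emeasure_eq_measure by (subst (asm) ennreal_le_iff) (use s in auto)
  then show ?thesis by (simp add: X_def Q_def G_def)
qed

lemma quad_concentrated_gaussian:
  fixes M :: "nat \<Rightarrow> 'a measure"
  assumes pr: "\<And>p. 1 \<le> p \<Longrightarrow> prob_space (M p)"
    and S: "\<And>p. 1 \<le> p \<Longrightarrow> \<Sigma> p \<in> measurable (M p) (mat_borel p p)"
    and psd: "\<And>p \<omega>. 1 \<le> p \<Longrightarrow> \<omega> \<in> space (M p) \<Longrightarrow> sym_psd_mat p (\<Sigma> p \<omega>)"
    and w: "\<And>p. 1 \<le> p \<Longrightarrow> std_normal_vec (M p) p (w p)"
    and ind: "\<And>p. 1 \<le> p \<Longrightarrow> indep_rv (M p) (mat_borel p p) (\<Sigma> p) (vec_borel p) (w p)"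
    and A2: "tendsto_0_in_prob M (\<lambda>p \<omega>. mat_trace (\<Sigma> p \<omega> * \<Sigma> p \<omega>) / (real p)\<^sup>2)"
  shows "quad_concentrated M (\<lambda>p \<omega>. psd_sqrt (\<Sigma> p \<omega>) *\<^sub>v w p \<omega>) \<Sigma>"
  unfolding quad_concentrated_def
proof (intro allI impI)
  fix K \<epsilon> \<delta> :: real assume K: "0 < K" and e: "0 < \<epsilon>" and d: "0 < \<delta>"
  \<comment> \<open>With \<open>t = \<epsilon> * p\<close> and \<open>s = \<eta> * p\<^sup>2\<close>
    the Chebyshev term \<open>2 * K\<^sup>2 * s / t\<^sup>2\<close> is independent of
    \<open>p\<close> and equals \<open>\<delta> / 2\<close>.\<close>
  define \<eta> where "\<eta> = \<delta> * \<epsilon>\<^sup>2 / (4 * K\<^sup>2)"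
  have eta: "0 < \<eta>" using K e d by (simp add: \<eta>_def)
  have "(\<lambda>p. measure (M p) {\<omega> \<in> space (M p). \<bar>mat_trace (\<Sigma> p \<omega> * \<Sigma> p \<omega>) / (real p)\<^sup>2\<bar> > \<eta>}) \<longlonglongrightarrow> 0"
    using A2 eta by (simp add: tendsto_0_in_prob_def)
  from order_tendstoD(2)[OF this, of "\<delta> / 2"] d
  have "\<forall>\<^sub>F p in sequentially. measure (M p) {\<omega> \<in> space (M p). \<bar>mat_trace (\<Sigma> p \<omega> * \<Sigma> p \<omega>) / (real p)\<^sup>2\<bar> > \<eta>} < \<delta> / 2"
    by simp
  with eventually_ge_at_top[of 1]
  show "\<forall>\<^sub>F p in sequentially. \<forall>B. transpose_mat B = B \<longrightarrow> op_bounded p B K \<longrightarrow>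
       measure (M p) {\<omega> \<in> space (M p). \<epsilon> * real p < \<bar>(psd_sqrt (\<Sigma> p \<omega>) *\<^sub>v w p \<omega>) \<bullet>
         (B *\<^sub>v (psd_sqrt (\<Sigma> p \<omega>) *\<^sub>v w p \<omega>)) - mat_trace (\<Sigma> p \<omega> * B)\<bar>} \<le> \<delta>"
  proof eventually_elim
    case (elim p)
    interpret gaussian_vector "M p" p "w p"
      using pr w elim(1) by (simp add: gaussian_vector_def gaussian_vector_axioms_def)
    have p: "0 < real p" using elim(1) by simp
    have nn: "0 \<le> mat_trace (\<Sigma> p \<omega> * \<Sigma> p \<omega>)" if "\<omega> \<in> space (M p)" for \<omega>
      using frobenius_sym[OF sym_psd_matD(1,2)[OF psd[OF elim(1) that]], symmetric] by (simp add: sum_nonneg)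
    have ev: "{\<omega> \<in> space (M p). \<eta> * (real p)\<^sup>2 < mat_trace (\<Sigma> p \<omega> * \<Sigma> p \<omega>)} =
        {\<omega> \<in> space (M p). \<bar>mat_trace (\<Sigma> p \<omega> * \<Sigma> p \<omega>) / (real p)\<^sup>2\<bar> > \<eta>}"
      using p nn by (auto simp: field_simps)
    show ?case
    proof (intro allI impI)
      fix B :: "real mat" assume B: "transpose_mat B = B" "op_bounded p B K"
      have "prob {\<omega> \<in> space (M p). \<epsilon> * real p < \<bar>(psd_sqrt (\<Sigma> p \<omega>) *\<^sub>v w p \<omega>) \<bullet>
          (B *\<^sub>v (psd_sqrt (\<Sigma> p \<omega>) *\<^sub>v w p \<omega>)) - mat_trace (\<Sigma> p \<omega> * B)\<bar>}
        \<le> prob {\<omega> \<in> space (M p). \<eta> * (real p)\<^sup>2 < mat_trace (\<Sigma> p \<omega> * \<Sigma> p \<omega>)}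
          + 2 * K\<^sup>2 * (\<eta> * (real p)\<^sup>2) / (\<epsilon> * real p)\<^sup>2"
        using e p eta
        by (intro mixture_quad_form_tail[OF S[OF elim(1)] psd[OF elim(1)] ind[OF elim(1)] B(2,1)]) auto
      also have "2 * K\<^sup>2 * (\<eta> * (real p)\<^sup>2) / (\<epsilon> * real p)\<^sup>2 = \<delta> / 2"
        using K e p by (simp add: \<eta>_def power_mult_distrib field_simps)
      finally show "prob {\<omega> \<in> space (M p). \<epsilon> * real p < \<bar>(psd_sqrt (\<Sigma> p \<omega>) *\<^sub>v w p \<omega>) \<bullet>
          (B *\<^sub>v (psd_sqrt (\<Sigma> p \<omega>) *\<^sub>v w p \<omega>)) - mat_trace (\<Sigma> p \<omega> * B)\<bar>} \<le> \<delta>"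
        using elim(2) unfolding ev by simp
    qed
  qed
qed

section \<open>Comparison of the Stieltjes transforms\<close>

lemma measurable_Complex:
  assumes "f \<in> borel_measurable N" "g \<in> borel_measurable N"
  shows "(\<lambda>x. Complex (f x) (g x)) \<in> borel_measurable N"
  unfolding Complex_eq using assms by measurable

lemma measurable_sm_term:
  assumes A: "sym_psd_mat p A" and z: "0 < Im z" and h: "0 \<le> h" and x: "x \<in> measurable N (vec_borel p)"
  shows "(\<lambda>\<omega>. sm_term p A z h (x \<omega>)) \<in> borel_measurable N"
proof -
  let ?R = "resolvent p A z"
  have c: "map_mat f ?R \<in> carrier_mat p p" "map_mat f (?R * ?R) \<in> carrier_mat p p" for f :: "complex \<Rightarrow> real"
    using resolvent(1)[OF A z] by auto
  have "(\<lambda>\<omega>. of_real h * Complex (x \<omega> \<bullet> (map_mat Re (?R * ?R) *\<^sub>v x \<omega>)) (x \<omega> \<bullet> (map_mat Im (?R * ?R) *\<^sub>v x \<omega>)) /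
      (1 + of_real h * Complex (x \<omega> \<bullet> (map_mat Re ?R *\<^sub>v x \<omega>)) (x \<omega> \<bullet> (map_mat Im ?R *\<^sub>v x \<omega>)))) \<in> borel_measurable N"
    by (intro borel_measurable_divide borel_measurable_times borel_measurable_add borel_measurable_const
        measurable_Complex measurable_quad_form[OF x c(1)] measurable_quad_form[OF x c(2)])
  then show ?thesis
    by (rule measurable_cong[THEN iffD1, rotated])
       (use measurable_vec_borelD(1)[OF x] in \<open>simp add: sm_term_def res_form_complex[OF A z h]\<close>)
qed

lemma measurable_sm_limit:
  assumes A: "sym_psd_mat p A" and z: "0 < Im z" and S: "S \<in> measurable N (mat_borel p p)"
  shows "(\<lambda>\<omega>. sm_limit p A z h (S \<omega>)) \<in> borel_measurable N"
proof -
  let ?R = "resolvent p A z"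
  have c: "map_mat f ?R \<in> carrier_mat p p" "map_mat f (?R * ?R) \<in> carrier_mat p p" for f :: "complex \<Rightarrow> real"
    using resolvent(1)[OF A z] by auto
  show ?thesis
    unfolding sm_limit_def Let_def res_trace_def
    by (intro borel_measurable_divide borel_measurable_times borel_measurable_add borel_measurable_const
        measurable_Complex measurable_trace_mult[OF S c(1)] measurable_trace_mult[OF S c(2)])
qed

text \<open>Where all four forms are within \<open>e\<close> of their traces, the integrands are
  close. On the exceptional event, of probability at most \<open>4 * d\<close>, each integrand is at
  most \<open>1 / Im z\<close> in modulus, which costs \<open>8 * d / Im z\<close>.\<close>

lemma expectation_sm_term_close:
  fixes M0 :: "'a measure"
  assumes pr: "prob_space M0" and xm: "x \<in> measurable M0 (vec_borel p)" and Sm: "S \<in> measurable M0 (mat_borel p p)"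
    and psd: "\<And>\<omega>. \<omega> \<in> space M0 \<Longrightarrow> sym_psd_mat p (S \<omega>)"
    and A: "sym_psd_mat p A" and z: "0 < Im z" and h: "0 \<le> h" and e: "0 \<le> e"
    and conc: "\<And>B. B \<in> res_parts p A z \<Longrightarrow>
      measure M0 {\<omega> \<in> space M0. e < \<bar>x \<omega> \<bullet> (B *\<^sub>v x \<omega>) - mat_trace (S \<omega> * B)\<bar>} \<le> d"
    and d: "0 \<le> d"
  shows "cmod ((\<integral>\<omega>. sm_term p A z h (x \<omega>) \<partial>M0) - (\<integral>\<omega>. sm_limit p A z h (S \<omega>) \<partial>M0))
    \<le> 2 * h * e * (cmod z / Im z * (1 + 1 / Im z)) + 8 * d / Im z"
proof -
  interpret prob_space M0 by (rule pr)
  let ?t = "\<lambda>\<omega>. sm_term p A z h (x \<omega>)" and ?l = "\<lambda>\<omega>. sm_limit p A z h (S \<omega>)"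
  let ?C = "2 * h * e * (cmod z / Im z * (1 + 1 / Im z))"
  have tb: "cmod (?t \<omega>) \<le> 1 / Im z" "cmod (?l \<omega>) \<le> 1 / Im z" if "\<omega> \<in> space M0" for \<omega>
    using cmod_sm_term_le[OF A z h measurable_vec_borelD(1)[OF xm that]] cmod_sm_limit_le[OF A z h psd[OF that]] by auto
  have it: "integrable M0 ?t" "integrable M0 ?l"
    using tb measurable_sm_term[OF A z h xm] measurable_sm_limit[OF A z Sm]
    by (auto intro!: integrable_const_bound[of _ "1 / Im z"])
  define E where "E B = {\<omega> \<in> space M0. e < \<bar>x \<omega> \<bullet> (B *\<^sub>v x \<omega>) - mat_trace (S \<omega> * B)\<bar>}" for B
  have Em: "E B \<in> events" if "B \<in> res_parts p A z" for B
  proof -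
    have "B \<in> carrier_mat p p" using op_boundedD(1)[OF res_parts(2)[OF A z that]] .
    from measurable_quad_form[OF xm this] measurable_trace_mult[OF Sm this]
    show ?thesis unfolding E_def by measurable
  qed
  define G where "G = (\<Union>B\<in>res_parts p A z. E B)"
  have G: "G \<in> events" unfolding G_def using Em by (intro sets.finite_UN) auto
  have "prob G \<le> (\<Sum>B\<in>res_parts p A z. prob (E B))"
    unfolding G_def using Em by (intro finite_measure_subadditive_finite) auto
  also have "\<dots> \<le> (\<Sum>B\<in>res_parts p A z. d)" using conc by (intro sum_mono) (simp add: E_def)
  also have "\<dots> \<le> 4 * d" using card_res_parts[of p A z] d by (simp add: mult_right_mono)
  finally have pG: "prob G \<le> 4 * d" .
  have iG: "integrable M0 (indicator G :: 'a \<Rightarrow> real)"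
    using G by (rule integrable_real_indicator) (simp add: emeasure_eq_measure)
  have C0: "0 \<le> ?C" using z h e by simp
  have pt: "cmod (?t \<omega> - ?l \<omega>) \<le> ?C + 2 / Im z * indicator G \<omega>" if w: "\<omega> \<in> space M0" for \<omega>
  proof (cases "\<omega> \<in> G")
    case True
    have "cmod (?t \<omega> - ?l \<omega>) \<le> cmod (?t \<omega>) + cmod (?l \<omega>)" by (rule norm_triangle_ineq4)
    also have "\<dots> \<le> 1 / Im z + 1 / Im z" by (intro add_mono tb w)
    finally show ?thesis using True C0 by simp
  next
    case False
    then have "\<bar>x \<omega> \<bullet> (B *\<^sub>v x \<omega>) - mat_trace (S \<omega> * B)\<bar> \<le> e" if "B \<in> res_parts p A z" for B
      using that w by (auto simp: G_def E_def not_less)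
    from sm_term_close[OF A z h measurable_vec_borelD(1)[OF xm w] psd[OF w] this]
    show ?thesis using False by simp
  qed
  have "(\<integral>\<omega>. ?t \<omega> \<partial>M0) - (\<integral>\<omega>. ?l \<omega> \<partial>M0) = (\<integral>\<omega>. ?t \<omega> - ?l \<omega> \<partial>M0)"
    using it by simp
  then have "cmod ((\<integral>\<omega>. ?t \<omega> \<partial>M0) - (\<integral>\<omega>. ?l \<omega> \<partial>M0)) \<le> (\<integral>\<omega>. cmod (?t \<omega> - ?l \<omega>) \<partial>M0)"
    by (simp only: integral_norm_bound)
  also have "\<dots> \<le> (\<integral>\<omega>. ?C + 2 / Im z * indicator G \<omega> \<partial>M0)"
  proof (intro integral_mono pt)
    show "integrable M0 (\<lambda>\<omega>. cmod (?t \<omega> - ?l \<omega>))" using it by (intro integrable_norm Bochner_Integration.integrable_diff)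
    show "integrable M0 (\<lambda>\<omega>. ?C + 2 / Im z * indicator G \<omega>)"
      using iG by (intro Bochner_Integration.integrable_add integrable_mult_right) auto
  qed
  also have "\<dots> = ?C + 2 / Im z * prob G"
    using iG G by (subst Bochner_Integration.integral_add) (auto simp: prob_space sets.Int_space_eq1)
  also have "\<dots> \<le> ?C + 2 / Im z * (4 * d)"
    using pG z by (intro add_left_mono mult_left_mono) auto
  finally show ?thesis by simp
qed

lemma eventually_sm_term_close:
  fixes M :: "nat \<Rightarrow> 'a measure" and p :: "nat \<Rightarrow> nat"
  assumes pr: "\<And>p. 1 \<le> p \<Longrightarrow> prob_space (M p)"
    and xm: "\<And>p. 1 \<le> p \<Longrightarrow> x p \<in> measurable (M p) (vec_borel p)"
    and Sm: "\<And>p. 1 \<le> p \<Longrightarrow> \<Sigma> p \<in> measurable (M p) (mat_borel p p)"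
    and psd: "\<And>p \<omega>. 1 \<le> p \<Longrightarrow> \<omega> \<in> space (M p) \<Longrightarrow> sym_psd_mat p (\<Sigma> p \<omega>)"
    and conc: "quad_concentrated M x \<Sigma>" and z: "0 < Im z"
    and p: "filterlim p at_top sequentially" and ratio: "(\<lambda>n. real (p n) / real n) \<longlonglongrightarrow> c"
    and c: "0 < c" and d: "0 < \<delta>"
  shows "\<forall>\<^sub>F n in sequentially. \<forall>A. sym_psd_mat (p n) A \<longrightarrow>
    cmod ((\<integral>\<omega>. sm_term (p n) A z (1 / real n) (x (p n) \<omega>) \<partial>M (p n)) -
      (\<integral>\<omega>. sm_limit (p n) A z (1 / real n) (\<Sigma> (p n) \<omega>) \<partial>M (p n))) \<le> \<delta>"
proof -
  define L where "L = cmod z / Im z * (1 + 1 / Im z)"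
  have zp: "0 < cmod z" using z by auto
  have L: "0 < L" unfolding L_def using z zp by (intro mult_pos_pos divide_pos_pos add_pos_pos) auto
  \<comment> \<open>Eventually \<open>p / n < c + 1\<close>, so the error on the good event is at
    most \<open>2 * \<epsilon> * L * (c + 1) = \<delta> / 2\<close>. The choice of
    \<open>\<eta>\<close> makes the exceptional part \<open>8 * \<eta> / Im z\<close> the other
    half.\<close>
  define \<epsilon> where "\<epsilon> = \<delta> / (4 * (c + 1) * L)"
  define \<eta> where "\<eta> = \<delta> * Im z / 16"
  have e: "0 < \<epsilon>" and h: "0 < \<eta>" using L c d z by (simp_all add: \<epsilon>_def \<eta>_def)
  have K: "0 < res_bound z" using z by (simp add: res_bound_def add_pos_pos)
  have ev: "\<forall>\<^sub>F q in sequentially. \<forall>B. transpose_mat B = B \<longrightarrow> op_bounded q B (res_bound z) \<longrightarrow>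
      measure (M q) {\<omega> \<in> space (M q). \<epsilon> * real q < \<bar>x q \<omega> \<bullet> (B *\<^sub>v x q \<omega>) - mat_trace (\<Sigma> q \<omega> * B)\<bar>} \<le> \<eta>"
    using conc K e h by (simp add: quad_concentrated_def)
  have "\<forall>\<^sub>F n in sequentially. real (p n) / real n < c + 1"
    by (rule order_tendstoD(2)[OF ratio]) simp
  moreover have "\<forall>\<^sub>F n in sequentially. 1 \<le> p n" using p by (simp add: filterlim_at_top)
  moreover note eventually_compose_filterlim[OF ev p] eventually_gt_at_top[of 0]
  ultimately show ?thesis
  proof eventually_elim
    case (elim n)
    show ?case
    proof (intro allI impI)
      fix A assume A: "sym_psd_mat (p n) A"
      have "cmod ((\<integral>\<omega>. sm_term (p n) A z (1 / real n) (x (p n) \<omega>) \<partial>M (p n)) -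
          (\<integral>\<omega>. sm_limit (p n) A z (1 / real n) (\<Sigma> (p n) \<omega>) \<partial>M (p n)))
         \<le> 2 * (1 / real n) * (\<epsilon> * real (p n)) * L + 8 * \<eta> / Im z"
        unfolding L_def using elim e h res_parts[OF A z]
        by (intro expectation_sm_term_close pr xm Sm psd A z) auto
      also have "2 * (1 / real n) * (\<epsilon> * real (p n)) * L = 2 * \<epsilon> * L * (real (p n) / real n)" by simp
      also have "\<dots> \<le> 2 * \<epsilon> * L * (c + 1)"
        using elim(1) e L by (intro mult_left_mono) auto
      also have "2 * \<epsilon> * L * (c + 1) = \<delta> / 2"
      proof -
        have "2 * (\<delta> / (4 * k * L)) * L * k = \<delta> / 2" if "0 < k" for k
          using L that by (simp add: field_simps)
        from this[of "c + 1"] show ?thesis using c by (simp add: \<epsilon>_def)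
      qed
      also have "8 * \<eta> / Im z = \<delta> / 2" using z by (simp add: \<eta>_def)
      finally show "cmod ((\<integral>\<omega>. sm_term (p n) A z (1 / real n) (x (p n) \<omega>) \<partial>M (p n)) -
          (\<integral>\<omega>. sm_limit (p n) A z (1 / real n) (\<Sigma> (p n) \<omega>) \<partial>M (p n))) \<le> \<delta>" by simp
    qed
  qed
qed

section \<open>The normalised trace as a function of the columns\<close>

definition gram :: "nat \<Rightarrow> real \<Rightarrow> nat set \<Rightarrow> (nat \<Rightarrow> real vec) \<Rightarrow> real mat" where
  "gram p h J x = mat p p (\<lambda>(r, s). \<Sum>j\<in>J. h * (x j $ r * x j $ s))"

lemma gram_carrier [simp]: "gram p h J x \<in> carrier_mat p p"
  by (simp add: gram_def)

lemma gram_cong: "(\<And>j. j \<in> J \<Longrightarrow> x j = x' j) \<Longrightarrow> gram p h J x = gram p h J x'"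
  unfolding gram_def by (intro cong_mat) auto

text \<open>The Gram matrix is taken over an arbitrary index set so that one column can be split
  off; that column then enters as a rank one update of the matrix of the others.\<close>

lemma gram_insert:
  "finite J \<Longrightarrow> k \<notin> J \<Longrightarrow> gram p h (insert k J) x = rank1_update p (gram p h J x) h (x k)"
  unfolding gram_def rank1_update_def by (intro cong_mat) (auto simp: add.commute)

lemma gram_psd:
  assumes "finite J" "0 \<le> h" "\<And>j. j \<in> J \<Longrightarrow> x j \<in> carrier_vec p"
  shows "sym_psd_mat p (gram p h J x)"
  using assms(1,3)
proof (induction J rule: finite_induct)
  case empty
  show ?case
    by (auto simp: sym_psd_mat_def gram_def scalar_prod_mat_sum[of _ p] intro!: transpose_eqI[of _ p])
next
  case (insert k J)
  then show ?case using assms(2) by (simp add: gram_insert rank1_update_psd)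
qed

text \<open>A function of the family of columns rather than of a matrix: it can be integrated over a
  product measure, and exchanging a column is a function update.\<close>

definition col_stieltjes :: "nat \<Rightarrow> nat \<Rightarrow> complex \<Rightarrow> (nat \<Rightarrow> real vec) \<Rightarrow> complex" where
  "col_stieltjes p n z x = mat_trace (resolvent p (gram p (1 / real n) {..<n} x) z) / of_nat p"

text \<open>The family is restricted to \<open>{..<n}\<close> because points of the product space
  are undefined outside the index set.\<close>

lemma stieltjes_trace_eq:
  assumes "Y \<in> carrier_mat p n"
  shows "stieltjes_trace p n Y z = col_stieltjes p n z (\<lambda>j\<in>{..<n}. col Y j)"
proof -
  have "(1 / real n) \<cdot>\<^sub>m (Y * transpose_mat Y) = gram p (1 / real n) {..<n} (\<lambda>j\<in>{..<n}. col Y j)"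
    using assms
    by (intro eq_matI) (auto simp: gram_def scalar_prod_def atLeast0LessThan sum_divide_distrib)
  then show ?thesis
    by (simp add: stieltjes_trace_def col_stieltjes_def resolvent_def shifted_def)
qed

lemma cmod_mat_trace_resolvent_le:
  assumes A: "sym_psd_mat p A" and z: "0 < Im z"
  shows "cmod (mat_trace (resolvent p A z)) \<le> p * (1 / Im z)"
proof -
  have "cmod (mat_trace (resolvent p A z)) \<le> (\<Sum>i<p. cmod (resolvent p A z $$ (i, i)))"
    unfolding mat_trace_sum[OF resolvent(1)[OF A z]] by (rule norm_sum)
  also have "\<dots> \<le> (\<Sum>i<p. 1 / Im z)"
    by (intro sum_mono op_bounded_entry[OF resolvent_op_bounded[OF A z]]) auto
  finally show ?thesis by simp
qed

context
  fixes p n :: nat and z :: complex and \<mu> :: "real vec measure"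
  assumes p: "1 \<le> p" and n: "1 \<le> n" and z: "0 < Im z"
    and mu: "prob_space \<mu>" and sets_mu: "sets \<mu> = sets (vec_borel p)"
begin

lemma space_mu: "space \<mu> = carrier_vec p"
  using sets_eq_imp_space_eq[OF sets_mu] by simp

lemma space_PiM_carrier: "x \<in> space (PiM J (\<lambda>_. \<mu>)) \<Longrightarrow> j \<in> J \<Longrightarrow> x j \<in> carrier_vec p"
  by (auto simp: space_PiM space_mu)

lemma cmod_col_stieltjes_le:
  assumes "x \<in> space (PiM {..<n} (\<lambda>_. \<mu>))"
  shows "cmod (col_stieltjes p n z x) \<le> 1 / Im z"
proof -
  have "sym_psd_mat p (gram p (1 / real n) {..<n} x)"
    using space_PiM_carrier[OF assms] by (intro gram_psd) auto
  from cmod_mat_trace_resolvent_le[OF this z] show ?thesis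
    using p by (simp add: col_stieltjes_def norm_divide field_simps)
qed

text \<open>The leave-one-out representation: the first trace involves the other columns only, so
  all dependence on the column \<open>a\<close> sits in the bounded \<open>sm_term\<close>.\<close>

lemma col_stieltjes_upd:
  assumes x: "\<And>j. j \<in> {..<n} - {k} \<Longrightarrow> x j \<in> carrier_vec p" and k: "k < n" and a: "a \<in> carrier_vec p"
  shows "col_stieltjes p n z (x(k := a)) =
    (mat_trace (resolvent p (gram p (1 / real n) ({..<n} - {k}) x) z)
      - sm_term p (gram p (1 / real n) ({..<n} - {k}) x) z (1 / real n) a) / of_nat p"
proof -
  let ?A = "gram p (1 / real n) ({..<n} - {k}) x"
  have A: "sym_psd_mat p ?A" using x by (intro gram_psd) auto
  have "gram p (1 / real n) {..<n} (x(k := a)) = gram p (1 / real n) (insert k ({..<n} - {k})) (x(k := a))"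
    using k by (simp add: insert_absorb)
  also have "\<dots> = rank1_update p (gram p (1 / real n) ({..<n} - {k}) (x(k := a))) (1 / real n) a"
    by (subst gram_insert) auto
  also have "gram p (1 / real n) ({..<n} - {k}) (x(k := a)) = ?A" by (intro gram_cong) auto
  finally show ?thesis
    using trace_resolvent_rank1[OF A z a, of "1 / real n"] by (simp only: col_stieltjes_def sm_term_def) simp
qed

text \<open>The leave-one-out trace is common to both sides and cancels; two terms of modulus at
  most \<open>1 / Im z\<close>, divided by \<open>p\<close>, remain.\<close>

lemma col_stieltjes_diff:
  assumes x: "x \<in> space (PiM {..<n} (\<lambda>_. \<mu>))" and k: "k < n" and a: "a \<in> space \<mu>"
  shows "cmod (col_stieltjes p n z (x(k := a)) - col_stieltjes p n z x) \<le> 2 / (Im z * p)"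
proof -
  let ?A = "gram p (1 / real n) ({..<n} - {k}) x"
  have xc: "x j \<in> carrier_vec p" if "j < n" for j using space_PiM_carrier[OF x] that by simp
  have A: "sym_psd_mat p ?A" using xc by (intro gram_psd) auto
  have b: "cmod (sm_term p ?A z (1 / real n) v) \<le> 1 / Im z" if "v \<in> carrier_vec p" for v
    using cmod_sm_term_le[OF A z _ that, of "1 / real n"] by simp
  have ac: "a \<in> carrier_vec p" using a by (simp add: space_mu)
  have eqa: "col_stieltjes p n z (x(k := a)) = (mat_trace (resolvent p ?A z) - sm_term p ?A z (1 / real n) a) / of_nat p"
    using xc by (intro col_stieltjes_upd k ac) auto
  \<comment> \<open>The original family is treated as a trivial update of itself.\<close>
  have "col_stieltjes p n z (x(k := x k)) = (mat_trace (resolvent p ?A z) - sm_term p ?A z (1 / real n) (x k)) / of_nat p"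
    using xc by (intro col_stieltjes_upd k xc) auto
  then have eqx: "col_stieltjes p n z x = (mat_trace (resolvent p ?A z) - sm_term p ?A z (1 / real n) (x k)) / of_nat p"
    by simp
  have "col_stieltjes p n z (x(k := a)) - col_stieltjes p n z x =
      (sm_term p ?A z (1 / real n) (x k) - sm_term p ?A z (1 / real n) a) / of_nat p"
    unfolding eqa eqx by (simp add: diff_divide_distrib)
  also have "cmod \<dots> \<le> (1 / Im z + 1 / Im z) / real p"
    unfolding norm_divide using b[OF xc[OF k]] b[OF ac]
    by (intro frac_le order_trans[OF norm_triangle_ineq4] add_mono) (use p z in auto)
  also have "\<dots> = 2 / (Im z * p)" by simp
  finally show ?thesis .
qed

lemma measurable_col_stieltjes: "col_stieltjes p n z \<in> borel_measurable (PiM {..<n} (\<lambda>_. \<mu>))"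
proof -
  have comp: "(\<lambda>x. x j $ r) \<in> borel_measurable (PiM {..<n} (\<lambda>_. \<mu>))" if "j < n" "r < p" for j r
  proof -
    have "(\<lambda>v. v $ r) \<in> borel_measurable \<mu>"
      using measurable_vec_index[OF that(2)] measurable_cong_sets[OF sets_mu refl] by blast
    then show ?thesis using that by (intro measurable_compose[OF measurable_component_singleton]) auto
  qed
  have "(\<lambda>x. mat_trace (resolvent p (gram p (1 / real n) {..<n} x) z)) \<in> borel_measurable (PiM {..<n} (\<lambda>_. \<mu>))"
  proof (rule measurable_trace_resolvent[OF _ z])
    show "sym_psd_mat p (gram p (1 / real n) {..<n} x)" if "x \<in> space (PiM {..<n} (\<lambda>_. \<mu>))" for x
      using space_PiM_carrier[OF that] by (intro gram_psd) auto
    fix r s assume "r < p" "s < p"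
    then show "(\<lambda>x. gram p (1 / real n) {..<n} x $$ (r, s)) \<in> borel_measurable (PiM {..<n} (\<lambda>_. \<mu>))"
      unfolding gram_def using comp by (simp del: sum_divide_distrib)
  qed
  then show ?thesis unfolding col_stieltjes_def[abs_def] by measurable
qed

text \<open>Real and imaginary parts are treated separately with tolerance
  \<open>\<epsilon> / 2\<close>, giving four one-sided tails. With difference constant
  \<open>c = 2 / (Im z * p)\<close> the exponent
  \<open>(\<epsilon> / 2)\<^sup>2 / (2 * c\<^sup>2 * n)\<close> produces the 32. The factor
  \<open>p\<^sup>2 / n\<close> grows linearly when \<open>p\<close> is proportional to
  \<open>n\<close>.\<close>

lemma col_stieltjes_deviation:
  assumes e: "0 < \<epsilon>"
  shows "measure (PiM {..<n} (\<lambda>_. \<mu>)) {x \<in> space (PiM {..<n} (\<lambda>_. \<mu>)).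
      \<epsilon> \<le> cmod (col_stieltjes p n z x - (\<integral>x. col_stieltjes p n z x \<partial>PiM {..<n} (\<lambda>_. \<mu>)))}
    \<le> 4 * exp (- (\<epsilon>\<^sup>2 * (Im z)\<^sup>2 / 32 * ((real p)\<^sup>2 / real n)))"
proof -
  interpret product_prob_space "\<lambda>_::nat. \<mu>" by (rule product_prob_spaceI) (rule mu)
  let ?P = "PiM {..<n} (\<lambda>_. \<mu>)" and ?F = "col_stieltjes p n z"
  interpret Q: prob_space ?P by (intro prob_space_PiM mu)
  note [measurable] = measurable_col_stieltjes
  have int: "integrable ?P ?F"
    using cmod_col_stieltjes_le by (intro Q.integrable_const_bound[of _ "1 / Im z"]) auto
  define c where "c = 2 / (Im z * p)"
  have c: "0 < c" using p z by (simp add: c_def)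
  have dev: "measure ?P {x \<in> space ?P. \<epsilon> / 2 \<le> \<bar>g (?F x) - (\<integral>x. g (?F x) \<partial>?P)\<bar>}
      \<le> 2 * exp (- ((\<epsilon> / 2)\<^sup>2 / (2 * c\<^sup>2 * card {..<n})))"
    if g: "\<And>a. \<bar>g a\<bar> \<le> cmod a" "\<And>a b. g (a - b) = g a - g b" and gm: "g \<in> borel_measurable borel"
    for g :: "complex \<Rightarrow> real"
  proof (rule bounded_differences_tail[where B = "1 / Im z"])
    show "(\<lambda>x. g (?F x)) \<in> borel_measurable ?P" using gm by measurable
    show "\<bar>g (?F x)\<bar> \<le> 1 / Im z" if "x \<in> space ?P" for x
      using g(1) cmod_col_stieltjes_le[OF that] order_trans by blast
    show "\<bar>g (?F (x(i := a))) - g (?F x)\<bar> \<le> c" if "x \<in> space ?P" "i \<in> {..<n}" "a \<in> space \<mu>" for x i a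
      using col_stieltjes_diff[OF that(1) _ that(3), of i] that(2) g(1)[of "?F (x(i := a)) - ?F x"]
      by (simp add: g(2) c_def)
  qed (use c e n in \<open>auto simp: lessThan_empty_iff\<close>)
  let ?E = "\<integral>x. ?F x \<partial>?P"
  have "{x \<in> space ?P. \<epsilon> \<le> cmod (?F x - ?E)} \<subseteq>
      {x \<in> space ?P. \<epsilon> / 2 \<le> \<bar>Re (?F x) - (\<integral>x. Re (?F x) \<partial>?P)\<bar>} \<union>
      {x \<in> space ?P. \<epsilon> / 2 \<le> \<bar>Im (?F x) - (\<integral>x. Im (?F x) \<partial>?P)\<bar>}"
  proof
    fix x assume x: "x \<in> {x \<in> space ?P. \<epsilon> \<le> cmod (?F x - ?E)}"
    have "Re ?E = (\<integral>x. Re (?F x) \<partial>?P)" "Im ?E = (\<integral>x. Im (?F x) \<partial>?P)"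
      using int by simp_all
    with cmod_le[of "?F x - ?E"] x
    show "x \<in> {x \<in> space ?P. \<epsilon> / 2 \<le> \<bar>Re (?F x) - (\<integral>x. Re (?F x) \<partial>?P)\<bar>} \<union>
      {x \<in> space ?P. \<epsilon> / 2 \<le> \<bar>Im (?F x) - (\<integral>x. Im (?F x) \<partial>?P)\<bar>}"
      by auto
  qed
  then have "measure ?P {x \<in> space ?P. \<epsilon> \<le> cmod (?F x - ?E)} \<le> measure ?P (
      {x \<in> space ?P. \<epsilon> / 2 \<le> \<bar>Re (?F x) - (\<integral>x. Re (?F x) \<partial>?P)\<bar>} \<union>
      {x \<in> space ?P. \<epsilon> / 2 \<le> \<bar>Im (?F x) - (\<integral>x. Im (?F x) \<partial>?P)\<bar>})"
    by (rule Q.finite_measure_mono) measurable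
  also have "\<dots> \<le> measure ?P {x \<in> space ?P. \<epsilon> / 2 \<le> \<bar>Re (?F x) - (\<integral>x. Re (?F x) \<partial>?P)\<bar>} +
      measure ?P {x \<in> space ?P. \<epsilon> / 2 \<le> \<bar>Im (?F x) - (\<integral>x. Im (?F x) \<partial>?P)\<bar>}"
    by (rule measure_Un_le) measurable
  also have "\<dots> \<le> 2 * exp (- ((\<epsilon> / 2)\<^sup>2 / (2 * c\<^sup>2 * card {..<n}))) + 2 * exp (- ((\<epsilon> / 2)\<^sup>2 / (2 * c\<^sup>2 * card {..<n})))"
    by (intro add_mono dev) (auto simp: abs_Re_le_cmod abs_Im_le_cmod)
  also have "(\<epsilon> / 2)\<^sup>2 / (2 * c\<^sup>2 * card {..<n}) = \<epsilon>\<^sup>2 * (Im z)\<^sup>2 / 32 * ((real p)\<^sup>2 / real n)"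
    using z p by (simp add: c_def power_divide power_mult_distrib field_simps)
  finally show ?thesis by simp
qed

end

section \<open>From product measures to the random matrices\<close>

lemma iid_columns_law:
  assumes N: "prob_space N" and Y: "iid_columns N p n Y M x" and n: "1 \<le> n"
  shows "(\<lambda>\<omega>. \<lambda>j\<in>{..<n}. col (Y \<omega>) j) \<in> measurable N (PiM {..<n} (\<lambda>_. distr M (vec_borel p) x))"
    and "distr N (PiM {..<n} (\<lambda>_. distr M (vec_borel p) x)) (\<lambda>\<omega>. \<lambda>j\<in>{..<n}. col (Y \<omega>) j)
      = PiM {..<n} (\<lambda>_. distr M (vec_borel p) x)"
proof -
  interpret prob_space N by (rule N)
  have Ym: "Y \<in> measurable N (mat_borel p n)" using Y by (simp add: iid_columns_def)
  have rv: "(\<lambda>\<omega>. col (Y \<omega>) j) \<in> measurable N (vec_borel p)" if "j \<in> {..<n}" for j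
    using measurable_col[OF Ym] that by simp
  have sets: "sets (PiM {..<n} (\<lambda>_. distr M (vec_borel p) x)) = sets (PiM {..<n} (\<lambda>_. vec_borel p))"
    by (intro sets_PiM_cong) auto
  have "(\<lambda>\<omega>. \<lambda>j\<in>{..<n}. col (Y \<omega>) j) \<in> measurable N (PiM {..<n} (\<lambda>_. vec_borel p))"
    using rv by (intro measurable_restrict) auto
  then show "(\<lambda>\<omega>. \<lambda>j\<in>{..<n}. col (Y \<omega>) j) \<in> measurable N (PiM {..<n} (\<lambda>_. distr M (vec_borel p) x))"
    using measurable_cong_sets[OF refl sets] by blast
  have "distr N (PiM {..<n} (\<lambda>_. distr M (vec_borel p) x)) (\<lambda>\<omega>. \<lambda>j\<in>{..<n}. col (Y \<omega>) j)
      = distr N (PiM {..<n} (\<lambda>_. vec_borel p)) (\<lambda>\<omega>. \<lambda>j\<in>{..<n}. col (Y \<omega>) j)"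
    by (intro distr_cong sets refl)
  also have "\<dots> = PiM {..<n} (\<lambda>j. distr N (vec_borel p) (\<lambda>\<omega>. col (Y \<omega>) j))"
    using indep_vars_iff_distr_eq_PiM'[where I = "{..<n}" and M' = "\<lambda>_. vec_borel p" and X = "\<lambda>j \<omega>. col (Y \<omega>) j"] rv Y n
    by (auto simp: iid_columns_def lessThan_empty_iff)
  also have "\<dots> = PiM {..<n} (\<lambda>_. distr M (vec_borel p) x)"
    using Y by (intro PiM_cong) (auto simp: iid_columns_def)
  finally show "distr N (PiM {..<n} (\<lambda>_. distr M (vec_borel p) x)) (\<lambda>\<omega>. \<lambda>j\<in>{..<n}. col (Y \<omega>) j)
      = PiM {..<n} (\<lambda>_. distr M (vec_borel p) x)" .
qed

text \<open>The event depends on \<open>Y\<close> only through its columns, whose joint law is the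
  product measure, so the tail bound there carries over to \<open>N\<close>.\<close>

lemma stieltjes_trace_deviation:
  assumes N: "prob_space N" and Y: "iid_columns N p n Y M x" and p: "1 \<le> p" and n: "1 \<le> n"
    and M: "prob_space M" and x: "x \<in> measurable M (vec_borel p)" and z: "0 < Im z" and e: "0 < \<epsilon>"
  defines "E \<equiv> (\<integral>x. col_stieltjes p n z x \<partial>PiM {..<n} (\<lambda>_. distr M (vec_borel p) x))"
  shows "{\<omega> \<in> space N. \<epsilon> \<le> cmod (stieltjes_trace p n (Y \<omega>) z - E)} \<in> sets N"
    and "measure N {\<omega> \<in> space N. \<epsilon> \<le> cmod (stieltjes_trace p n (Y \<omega>) z - E)}
      \<le> 4 * exp (- (\<epsilon>\<^sup>2 * (Im z)\<^sup>2 / 32 * ((real p)\<^sup>2 / real n)))"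
proof -
  let ?\<mu> = "distr M (vec_borel p) x" and ?X = "\<lambda>\<omega>. \<lambda>j\<in>{..<n}. col (Y \<omega>) j"
  let ?P = "PiM {..<n} (\<lambda>_. ?\<mu>)"
  have mu: "prob_space ?\<mu>" using M x by (rule prob_space.prob_space_distr)
  have s: "sets ?\<mu> = sets (vec_borel p)" by simp
  note law = iid_columns_law[OF N Y n]
  note [measurable] = measurable_col_stieltjes[OF p n z mu s] law(1)
  have Yc: "Y \<omega> \<in> carrier_mat p n" if "\<omega> \<in> space N" for \<omega>
    using Y measurable_mat_borelD(1)[of Y N p n \<omega>] that by (simp add: iid_columns_def)
  let ?D = "{x \<in> space ?P. \<epsilon> \<le> cmod (col_stieltjes p n z x - E)}"
  have D: "?D \<in> sets ?P" by measurable
  have eq: "{\<omega> \<in> space N. \<epsilon> \<le> cmod (stieltjes_trace p n (Y \<omega>) z - E)} = ?X -` ?D \<inter> space N"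
    using Yc measurable_space[OF law(1)] by (auto simp: stieltjes_trace_eq)
  show "{\<omega> \<in> space N. \<epsilon> \<le> cmod (stieltjes_trace p n (Y \<omega>) z - E)} \<in> sets N"
    unfolding eq using law(1) D by (rule measurable_sets)
  have "measure N (?X -` ?D \<inter> space N) = measure (distr N ?P ?X) ?D"
    using law(1) D by (simp add: measure_distr)
  also have "\<dots> = measure ?P ?D" unfolding law(2) ..
  also have "\<dots> \<le> 4 * exp (- (\<epsilon>\<^sup>2 * (Im z)\<^sup>2 / 32 * ((real p)\<^sup>2 / real n)))"
    unfolding E_def by (rule col_stieltjes_deviation[OF p n z mu s e])
  finally show "measure N {\<omega> \<in> space N. \<epsilon> \<le> cmod (stieltjes_trace p n (Y \<omega>) z - E)}
      \<le> 4 * exp (- (\<epsilon>\<^sup>2 * (Im z)\<^sup>2 / 32 * ((real p)\<^sup>2 / real n)))"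
    unfolding eq .
qed

lemma expectation_replace:
  assumes p: "1 \<le> p" and n: "1 \<le> n" and z: "0 < Im z" and M: "prob_space M"
    and x: "x \<in> measurable M (vec_borel p)" and x': "x' \<in> measurable M (vec_borel p)"
    and d: "\<And>A. sym_psd_mat p A \<Longrightarrow>
      cmod ((\<integral>\<omega>. sm_term p A z (1 / real n) (x \<omega>) \<partial>M) - (\<integral>\<omega>. sm_term p A z (1 / real n) (x' \<omega>) \<partial>M)) \<le> d"
  shows "cmod ((\<integral>x. col_stieltjes p n z x \<partial>PiM {..<n} (\<lambda>_. distr M (vec_borel p) x)) -
      (\<integral>x. col_stieltjes p n z x \<partial>PiM {..<n} (\<lambda>_. distr M (vec_borel p) x'))) \<le> n * (d / p)"
proof (rule integral_PiM_replace[where B = "1 / Im z"])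
  let ?\<mu> = "distr M (vec_borel p) x" and ?\<nu> = "distr M (vec_borel p) x'"
  interpret prob_space M by (rule M)
  show mu: "prob_space ?\<mu>" "prob_space ?\<nu>" using x x' by (auto intro: prob_space_distr)
  have s: "sets ?\<mu> = sets (vec_borel p)" by simp
  show "sets ?\<mu> = sets ?\<nu>" by simp
  show "col_stieltjes p n z \<in> borel_measurable (PiM {..<n} (\<lambda>_. ?\<mu>))"
    by (rule measurable_col_stieltjes[OF p n z mu(1) s])
  show "cmod (col_stieltjes p n z v) \<le> 1 / Im z" if "v \<in> space (PiM {..<n} (\<lambda>_. ?\<mu>))" for v
    by (rule cmod_col_stieltjes_le[OF p n z mu(1) s that])
  fix k v assume k: "k < n" and v: "v \<in> space (PiM ({..<n} - {k}) (\<lambda>_. ?\<mu>))"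
  have vc: "v j \<in> carrier_vec p" if "j \<in> {..<n} - {k}" for j
    by (rule space_PiM_carrier[OF p n z mu(1) s v that])
  let ?A = "gram p (1 / real n) ({..<n} - {k}) v"
  have A: "sym_psd_mat p ?A" using vc by (intro gram_psd) auto
  let ?T = "mat_trace (resolvent p ?A z)"
  have I: "(\<integral>a. col_stieltjes p n z (v(k := a)) \<partial>distr M (vec_borel p) u)
      = (?T - (\<integral>\<omega>. sm_term p ?A z (1 / real n) (u \<omega>) \<partial>M)) / of_nat p"
    if u: "u \<in> measurable M (vec_borel p)" for u
  proof -
    have tm: "sm_term p ?A z (1 / real n) \<in> borel_measurable (vec_borel p)"
      using measurable_sm_term[OF A z _ measurable_ident, of "1 / real n"] by simp
    have ti: "integrable M (\<lambda>\<omega>. sm_term p ?A z (1 / real n) (u \<omega>))"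
      using cmod_sm_term_le[OF A z, of "1 / real n"] measurable_vec_borelD(1)[OF u] measurable_compose[OF u tm]
      by (intro integrable_const_bound[of _ "1 / Im z"]) auto
    have "(\<integral>a. col_stieltjes p n z (v(k := a)) \<partial>distr M (vec_borel p) u) =
        (\<integral>a. (?T - sm_term p ?A z (1 / real n) a) / of_nat p \<partial>distr M (vec_borel p) u)"
      using vc k by (intro Bochner_Integration.integral_cong refl col_stieltjes_upd[OF p n z mu(1) s]) auto
    also have "\<dots> = (\<integral>\<omega>. (?T - sm_term p ?A z (1 / real n) (u \<omega>)) / of_nat p \<partial>M)"
      by (intro integral_distr[OF u] borel_measurable_divide borel_measurable_diff borel_measurable_const tm)
    also have "\<dots> = (?T - (\<integral>\<omega>. sm_term p ?A z (1 / real n) (u \<omega>) \<partial>M)) / of_nat p"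
      using ti by (simp add: prob_space)
    finally show ?thesis .
  qed
  have "cmod ((\<integral>a. col_stieltjes p n z (v(k := a)) \<partial>?\<mu>) - (\<integral>a. col_stieltjes p n z (v(k := a)) \<partial>?\<nu>))
      = cmod (((\<integral>\<omega>. sm_term p ?A z (1 / real n) (x' \<omega>) \<partial>M) - (\<integral>\<omega>. sm_term p ?A z (1 / real n) (x \<omega>) \<partial>M)) / of_nat p)"
    unfolding I[OF x] I[OF x'] by (simp add: diff_divide_distrib)
  also have "\<dots> \<le> d / p"
    using d[OF A] unfolding norm_divide by (simp add: norm_minus_commute divide_right_mono)
  finally show "cmod ((\<integral>a. col_stieltjes p n z (v(k := a)) \<partial>?\<mu>) - (\<integral>a. col_stieltjes p n z (v(k := a)) \<partial>?\<nu>)) \<le> d / p" .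
qed

text \<open>Since \<open>r n\<close> is eventually at least \<open>\<kappa> * n\<close>, the tails
  are dominated by a geometric series and the first Borel-Cantelli lemma applies for each fixed
  tolerance.\<close>

lemma AE_tendsto_of_exp_tail:
  fixes X :: "nat \<Rightarrow> 'b \<Rightarrow> complex"
  assumes N: "prob_space N" and a: "0 < a" and k: "0 < \<kappa>"
    and r: "\<forall>\<^sub>F n in sequentially. \<kappa> * real n \<le> r n"
    and m: "\<And>n \<epsilon>. 1 \<le> n \<Longrightarrow> 0 < \<epsilon> \<Longrightarrow> {\<omega> \<in> space N. \<epsilon> \<le> cmod (X n \<omega> - E n)} \<in> sets N"
    and b: "\<And>n \<epsilon>. 1 \<le> n \<Longrightarrow> 0 < \<epsilon> \<Longrightarrow>
      measure N {\<omega> \<in> space N. \<epsilon> \<le> cmod (X n \<omega> - E n)} \<le> C * exp (- (\<epsilon>\<^sup>2 * a * r n))"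
    and C: "0 \<le> C"
  shows "AE \<omega> in N. (\<lambda>n. X n \<omega> - E n) \<longlonglongrightarrow> 0"
proof -
  interpret prob_space N by (rule N)
  have ev: "AE \<omega> in N. \<forall>\<^sub>F n in sequentially. cmod (X n \<omega> - E n) < \<epsilon>" if e: "0 < \<epsilon>" for \<epsilon>
  proof -
    \<comment> \<open>The assumptions start at \<open>n = 1\<close>; the empty set stands in at
      \<open>n = 0\<close>.\<close>
    define A where "A n = (if 1 \<le> n then {\<omega> \<in> space N. \<epsilon> \<le> cmod (X n \<omega> - E n)} else {})" for n
    have Am: "A n \<in> events" for n using m e by (simp add: A_def)
    define q where "q = exp (- (\<epsilon>\<^sup>2 * a * \<kappa>))"
    have "0 < \<epsilon>\<^sup>2 * a * \<kappa>" using e a k by simp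
    then have q: "0 \<le> q" "q < 1" by (auto simp: q_def)
    have "\<forall>\<^sub>F n in sequentially. norm (prob (A n)) \<le> C * q ^ n"
      using r eventually_ge_at_top[of 1]
    proof eventually_elim
      case (elim n)
      have "prob (A n) \<le> C * exp (- (\<epsilon>\<^sup>2 * a * r n))" using b[OF elim(2) e] elim(2) by (simp add: A_def)
      also have "\<dots> \<le> C * exp (- (\<epsilon>\<^sup>2 * a * (\<kappa> * real n)))"
        using elim(1) a C by (intro mult_left_mono) (auto intro!: mult_left_mono)
      also have "exp (- (\<epsilon>\<^sup>2 * a * (\<kappa> * real n))) = q ^ n"
        by (simp add: q_def exp_of_nat_mult[symmetric] mult_ac)
      finally show ?case by simp
    qed
    moreover have "summable (\<lambda>n. C * q ^ n)" using q by (intro summable_mult summable_geometric) simp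
    ultimately have "summable (\<lambda>n. prob (A n))" by (rule summable_comparison_test_ev)
    from borel_cantelli_AE1[OF Am _ this]
    have "AE \<omega> in N. \<forall>\<^sub>F n in sequentially. \<omega> \<in> space N - A n" by (simp add: emeasure_eq_measure)
    then show ?thesis
    proof (rule AE_mp, intro AE_I2 impI)
      fix \<omega> assume "\<omega> \<in> space N" and "\<forall>\<^sub>F n in sequentially. \<omega> \<in> space N - A n"
      from this(2) eventually_ge_at_top[of 1] show "\<forall>\<^sub>F n in sequentially. cmod (X n \<omega> - E n) < \<epsilon>"
        by eventually_elim (auto simp: A_def not_le)
    qed
  qed
  \<comment> \<open>Countably many tolerances, so that a single null set works for all of
    them.\<close>
  have "AE \<omega> in N. \<forall>m. \<forall>\<^sub>F n in sequentially. cmod (X n \<omega> - E n) < inverse (real (Suc m))"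
    unfolding AE_all_countable by (intro allI ev) simp
  then show ?thesis
  proof (rule AE_mp, intro AE_I2 impI)
    fix \<omega> assume *: "\<forall>m. \<forall>\<^sub>F n in sequentially. cmod (X n \<omega> - E n) < inverse (real (Suc m))"
    show "(\<lambda>n. X n \<omega> - E n) \<longlonglongrightarrow> 0"
    proof (rule tendstoI)
      fix e :: real assume "0 < e"
      then obtain m where "inverse (real (Suc m)) < e" using reals_Archimedean by blast
      with *[rule_format, of m] show "\<forall>\<^sub>F n in sequentially. dist (X n \<omega> - E n) 0 < e"
        by (auto elim!: eventually_mono)
    qed
  qed
qed

theorem theorem2p2:
  fixes M :: "nat \<Rightarrow> 'a measure"
    and y w :: "nat \<Rightarrow> 'a \<Rightarrow> real vec"
    and \<Sigma> :: "nat \<Rightarrow> 'a \<Rightarrow> real mat"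
    and N :: "'b measure"
    and Y Z :: "nat \<Rightarrow> nat \<Rightarrow> 'b \<Rightarrow> real mat"
    and p :: "nat \<Rightarrow> nat"
    and c :: real
    and z :: complex
  assumes "\<And>p. 1 \<le> p \<Longrightarrow> prob_space (M p)"
    and "\<And>p. 1 \<le> p \<Longrightarrow> y p \<in> measurable (M p) (vec_borel p)"
    and "\<And>p. 1 \<le> p \<Longrightarrow> \<Sigma> p \<in> measurable (M p) (mat_borel p p)"
    and "\<And>p \<omega>. 1 \<le> p \<Longrightarrow> \<omega> \<in> space (M p) \<Longrightarrow> sym_psd_mat p (\<Sigma> p \<omega>)"
    and "\<And>p. 1 \<le> p \<Longrightarrow> std_normal_vec (M p) p (w p)"
    and "\<And>p. 1 \<le> p \<Longrightarrow> indep_rv (M p) (mat_borel p p) (\<Sigma> p) (vec_borel p) (w p)"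
    and A1: "\<And>A :: nat \<Rightarrow> real mat.
          (\<forall>p\<ge>1. sym_psd_mat p (A p)) \<Longrightarrow> (\<exists>C. \<forall>p\<ge>1. spectral_norm (A p) \<le> C) \<Longrightarrow>
          tendsto_0_in_prob M
            (\<lambda>p \<omega>. (y p \<omega> \<bullet> (A p *\<^sub>v y p \<omega>) - mat_trace (\<Sigma> p \<omega> * A p)) / real p)"
    and A2: "tendsto_0_in_prob M (\<lambda>p \<omega>. mat_trace (\<Sigma> p \<omega> * \<Sigma> p \<omega>) / (real p)\<^sup>2)"
    and "prob_space N"
    and "\<And>n. 1 \<le> n \<Longrightarrow> 1 \<le> p n"
    and "\<And>n. 1 \<le> n \<Longrightarrow> iid_columns N (p n) n (Y (p n) n) (M (p n)) (y (p n))"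
    and "\<And>n. 1 \<le> n \<Longrightarrow> iid_columns N (p n) n (Z (p n) n) (M (p n))
           (\<lambda>\<omega>. psd_sqrt (\<Sigma> (p n) \<omega>) *\<^sub>v w (p n) \<omega>)"
    and "0 < c"
    and "(\<lambda>n. real (p n) / real n) \<longlonglongrightarrow> c"
    and "0 < Im z"
  shows "AE \<omega> in N.
           (\<lambda>n. stieltjes_trace (p n) n (Y (p n) n \<omega>) z
              - stieltjes_trace (p n) n (Z (p n) n \<omega>) z) \<longlonglongrightarrow> 0"
proof -
  note pr = assms(1) and ym = assms(2) and Sm = assms(3) and psd = assms(4) and normal = assms(5)
    and ind = assms(6) and N = assms(9) and p1 = assms(10) and Yiid = assms(11) and Ziid = assms(12)
    and c = assms(13) and ratio = assms(14) and z = assms(15)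
  define x where "x q \<omega> = psd_sqrt (\<Sigma> q \<omega>) *\<^sub>v w q \<omega>" for q \<omega>
  have xm: "x q \<in> measurable (M q) (vec_borel q)" if "1 \<le> q" for q
    unfolding x_def
    using measurable_psd_sqrt_mult_vec[OF Sm[OF that] psd[OF that]] normal[OF that]
    by (simp add: std_normal_vec_def)
  have yc: "quad_concentrated M y \<Sigma>"
    by (rule quad_concentrated_of_psd[OF pr ym Sm A1])
  have xc: "quad_concentrated M x \<Sigma>"
    unfolding x_def[abs_def] by (rule quad_concentrated_gaussian[OF pr Sm psd normal ind A2])
  \<comment> \<open>The concentration statements are asymptotic in the dimension; they are pulled
    back along \<open>n\<close>, for which \<open>p n\<close> has to diverge. It does, as the
    product of \<open>p n / n\<close>, tending to \<open>c > 0\<close>, and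
    \<open>n\<close>.\<close>
  have lim_p: "filterlim p at_top sequentially"
  proof -
    have "filterlim (\<lambda>n. real (p n) / real n * real n) at_top sequentially"
      by (rule filterlim_tendsto_pos_mult_at_top[OF ratio c filterlim_real_sequentially])
    then have "filterlim (\<lambda>n. real (p n)) at_top sequentially"
    proof (rule filterlim_cong[OF refl refl, THEN iffD1, rotated])
      show "\<forall>\<^sub>F n in sequentially. real (p n) / real n * real n = real (p n)"
        using eventually_gt_at_top[of 0] by eventually_elim simp
    qed
    then show ?thesis by (simp add: filterlim_sequentially_iff_filterlim_real)
  qed
  have half: "\<forall>\<^sub>F n in sequentially. c / 2 < real (p n) / real n"
    using c by (intro order_tendstoD(1)[OF ratio]) simp
  define EY where "EY n = (\<integral>v. col_stieltjes (p n) n z v \<partial>PiM {..<n} (\<lambda>_. distr (M (p n)) (vec_borel (p n)) (y (p n))))" for n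
  define EZ where "EZ n = (\<integral>v. col_stieltjes (p n) n z v \<partial>PiM {..<n} (\<lambda>_. distr (M (p n)) (vec_borel (p n)) (x (p n))))" for n
  have "(\<lambda>n. EY n - EZ n) \<longlonglongrightarrow> 0"
  proof (rule tendstoI)
    fix e :: real assume e: "0 < e"
    \<comment> \<open>Two comparisons with \<open>sm_limit\<close> cost \<open>2 * d\<close> for
      each column. Since eventually \<open>c / 2 < p n / n\<close>, the total
      \<open>n * (2 * d / p n)\<close> stays below \<open>4 * d / c = e / 2\<close>.\<close>
    define d where "d = e * c / 8"
    have d: "0 < d" using e c by (simp add: d_def)
    have ymq: "\<forall>q\<ge>1. y q \<in> measurable (M q) (vec_borel q)"
      and xmq: "\<forall>q\<ge>1. x q \<in> measurable (M q) (vec_borel q)"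
      using ym xm by blast+
    have close: "\<forall>\<^sub>F n in sequentially. \<forall>A. sym_psd_mat (p n) A \<longrightarrow>
        cmod ((\<integral>\<omega>. sm_term (p n) A z (1 / real n) (v (p n) \<omega>) \<partial>M (p n)) -
          (\<integral>\<omega>. sm_limit (p n) A z (1 / real n) (\<Sigma> (p n) \<omega>) \<partial>M (p n))) \<le> d"
      if "\<forall>q\<ge>1. v q \<in> measurable (M q) (vec_borel q)" "quad_concentrated M v \<Sigma>" for v
      by (rule eventually_sm_term_close[OF pr that(1)[rule_format] Sm psd that(2) z lim_p ratio c d])
    show "\<forall>\<^sub>F n in sequentially. dist (EY n - EZ n) 0 < e"
      using close[OF ymq yc] close[OF xmq xc] half eventually_ge_at_top[of 1]
    proof eventually_elim
      case (elim n)
      have "cmod (EY n - EZ n) \<le> n * ((2 * d) / p n)"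
        unfolding EY_def EZ_def
      proof (rule expectation_replace[OF p1[OF elim(4)] elim(4) z pr ym xm])
        fix A assume A: "sym_psd_mat (p n) A"
        show "cmod ((\<integral>\<omega>. sm_term (p n) A z (1 / real n) (y (p n) \<omega>) \<partial>M (p n)) -
            (\<integral>\<omega>. sm_term (p n) A z (1 / real n) (x (p n) \<omega>) \<partial>M (p n))) \<le> 2 * d"
          using norm_triangle_le_diff[OF add_mono[OF elim(1)[rule_format, OF A] elim(2)[rule_format, OF A]]] by simp
      qed (use p1[OF elim(4)] in auto)
      also have "\<dots> < e"
      proof -
        have "c / 2 * real n < real (p n)" using elim(3,4) by (simp add: field_simps)
        moreover have "0 < real (p n)" using p1[OF elim(4)] by simp
        ultimately have "e * (c / 2 * real n) < e * real (p n)"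
          using e by (intro mult_strict_left_mono) auto
        moreover have "2 * d * real n \<le> e * (c / 2 * real n)"
          using e c by (simp add: d_def)
        ultimately have "2 * d * real n < e * real (p n)" by linarith
        then show ?thesis using \<open>0 < real (p n)\<close> by (simp add: field_simps)
      qed
      finally show ?case by simp
    qed
  qed
  \<comment> \<open>The rate in the deviation bound is at least linear in \<open>n\<close>, as the
    Borel-Cantelli argument demands.\<close>
  moreover have r: "\<forall>\<^sub>F n in sequentially. (c / 2)\<^sup>2 * real n \<le> (real (p n))\<^sup>2 / real n"
    using half eventually_ge_at_top[of 1]
  proof eventually_elim
    case (elim n)
    have "(c / 2)\<^sup>2 * real n \<le> (real (p n) / real n)\<^sup>2 * real n"
      using elim(1) c by (intro mult_right_mono power_mono) auto
    also have "\<dots> = (real (p n))\<^sup>2 / real n" using elim(2) by (simp add: power2_eq_square)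
    finally show ?case .
  qed
  have a: "0 < (Im z)\<^sup>2 / 32" using z by simp
  have k: "0 < (c / 2)\<^sup>2" using c by simp
  have "AE \<omega> in N. (\<lambda>n. stieltjes_trace (p n) n (Y (p n) n \<omega>) z - EY n) \<longlonglongrightarrow> 0"
  proof (rule AE_tendsto_of_exp_tail[OF N a k r])
    fix n :: nat and \<epsilon> :: real assume n: "1 \<le> n" and e: "0 < \<epsilon>"
    note dev = stieltjes_trace_deviation[OF N Yiid[OF n] p1[OF n] n pr[OF p1[OF n]] ym[OF p1[OF n]] z e, folded EY_def]
    show "{\<omega> \<in> space N. \<epsilon> \<le> cmod (stieltjes_trace (p n) n (Y (p n) n \<omega>) z - EY n)} \<in> sets N" by (rule dev(1))
    show "measure N {\<omega> \<in> space N. \<epsilon> \<le> cmod (stieltjes_trace (p n) n (Y (p n) n \<omega>) z - EY n)}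
        \<le> 4 * exp (- (\<epsilon>\<^sup>2 * ((Im z)\<^sup>2 / 32) * ((real (p n))\<^sup>2 / real n)))"
      using dev(2) by simp
  qed simp
  moreover have "AE \<omega> in N. (\<lambda>n. stieltjes_trace (p n) n (Z (p n) n \<omega>) z - EZ n) \<longlonglongrightarrow> 0"
  proof (rule AE_tendsto_of_exp_tail[OF N a k r])
    fix n :: nat and \<epsilon> :: real assume n: "1 \<le> n" and e: "0 < \<epsilon>"
    note dev = stieltjes_trace_deviation[OF N Ziid[OF n, folded x_def] p1[OF n] n pr[OF p1[OF n]] xm[OF p1[OF n]] z e, folded EZ_def]
    show "{\<omega> \<in> space N. \<epsilon> \<le> cmod (stieltjes_trace (p n) n (Z (p n) n \<omega>) z - EZ n)} \<in> sets N" by (rule dev(1))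
    show "measure N {\<omega> \<in> space N. \<epsilon> \<le> cmod (stieltjes_trace (p n) n (Z (p n) n \<omega>) z - EZ n)}
        \<le> 4 * exp (- (\<epsilon>\<^sup>2 * ((Im z)\<^sup>2 / 32) * ((real (p n))\<^sup>2 / real n)))"
      using dev(2) by simp
  qed simp
  ultimately show ?thesis
  proof (elim AE_mp, intro AE_I2 impI)
    fix \<omega>
    assume 0: "(\<lambda>n. EY n - EZ n) \<longlonglongrightarrow> 0"
      and 1: "(\<lambda>n. stieltjes_trace (p n) n (Y (p n) n \<omega>) z - EY n) \<longlonglongrightarrow> 0"
      and 2: "(\<lambda>n. stieltjes_trace (p n) n (Z (p n) n \<omega>) z - EZ n) \<longlonglongrightarrow> 0"
    \<comment> \<open>The difference of the two transforms is the fluctuation for \<open>Y\<close>,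
      plus the difference of the means, minus the fluctuation for \<open>Z\<close>.\<close>
    from tendsto_diff[OF tendsto_add[OF 1 0] 2]
    show "(\<lambda>n. stieltjes_trace (p n) n (Y (p n) n \<omega>) z - stieltjes_trace (p n) n (Z (p n) n \<omega>) z) \<longlonglongrightarrow> 0"
      by simp
  qed
qed

end
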